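(* Let $X$ be a metric space homeomorphic to $\overline{D}$ such that, for some $L>0$, $\mathcal{H}^2(B(x,r))\le L\cdot r^2$ for every $x\in X$ and $r>0$. Let $Q\ge1$ and let $u\colon\overline{D}\to X$ be a homeomorphism satisfying $\operatorname{MOD}(\Gamma)\le Q\cdot\operatorname{MOD}(u\circ\Gamma)$ for every family $\Gamma$ of curves in $\overline{D}$. Then $u$ is quasisymmetric if and only if $X$ is doubling and linearly locally connected.
   Context: $\overline{D}$ is the closed unit disc in $\mathbb{R}^2$ (with Lebesgue measure). For a family $\Gamma$ of curves in a metric space $Y$ (with reference measure the Hausdorff $2$-measure $\mathcal{H}^2$, normalized as Lebesgue measure on $\mathbb{R}^2$), $\operatorname{MOD}(\Gamma)=\inf_\rho\int_Y\rho^2\,d\mathcal{H}^2$, the infimum over Borel $\rho\colon Y\to[0,\infty]$ with $\int_\gamma\rho\ge1$ for every locally rectifiable $\gamma\in\Gamma$. $u\circ\Gamma=\{u\circ\gamma:\gamma\in\Gamma\}$. $X$ is doubling if there is $N$ such that every ball of radius $2r$ is covered by $N$ balls of radius $r$. Linearly locally connected: there is $\lambda\ge1$ such that for all $x$, $r>0$, any two points of $B(x,r)$ can be joined by a continuum in $B(x,\lambda r)$ and any two points of $X\setminus B(x,r)$ by a continuum in $X\setminus B(x,r/\lambda)$. A homeomorphism $\varphi$ is quasisymmetric if there is a homeomorphism $\eta$ of $[0,\infty)$ with $d(\varphi(z),\varphi(a))\le\eta(t)d(\varphi(z),\varphi(b))$ whenever $d(z,a)\le t\,d(z,b)$. *)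

theory Defs
  imports "HOL-Analysis.Analysis"
begin

text \<open>Approximating outer measure with covers of mesh at most delta.  Covering sets
  are required to be bounded (the library's diameter is 0 on unbounded sets).
  Normalizing constant pi/4 so that the measure equals Lebesgue measure on R^2.\<close>
definition hausdorff2_delta :: "real \<Rightarrow> 'a::metric_space set \<Rightarrow> ennreal" where
  "hausdorff2_delta \<delta> A =
     (INF C \<in> {C :: nat \<Rightarrow> 'a set. A \<subseteq> (\<Union>i. C i) \<and>
                   (\<forall>i. bounded (C i) \<and> diameter (C i) \<le> \<delta>)}.
        (\<Sum>i. ennreal (pi / 4 * (diameter (C i))\<^sup>2)))"

definition hausdorff2_outer :: "'a::metric_space set \<Rightarrow> ennreal" where
  "hausdorff2_outer A = (SUP \<delta> \<in> {0<..}. hausdorff2_delta \<delta> A)"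

definition hausdorff2_measure :: "'a::metric_space set \<Rightarrow> 'a measure" where
  "hausdorff2_measure Y = measure_of Y (sets (restrict_space borel Y)) hausdorff2_outer"

definition curve_in :: "'a::metric_space set \<Rightarrow> real set \<times> (real \<Rightarrow> 'a) \<Rightarrow> bool" where
  "curve_in Y c \<longleftrightarrow> is_interval (fst c) \<and> fst c \<noteq> {} \<and>
      continuous_on (fst c) (snd c) \<and> snd c ` fst c \<subseteq> Y"

definition curve_length :: "(real \<Rightarrow> 'a::metric_space) \<Rightarrow> real \<Rightarrow> real \<Rightarrow> ennreal" where
  "curve_length g a b =
     (SUP p \<in> {p :: nat \<times> (nat \<Rightarrow> real). snd p 0 = a \<and> snd p (fst p) = b \<and> (\<forall>i<fst p. snd p i \<le> snd p (Suc i))}.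
        (\<Sum>i<fst p. ennreal (dist (g (snd p i)) (g (snd p (Suc i))))))"

definition locally_rectifiable :: "real set \<times> (real \<Rightarrow> 'a::metric_space) \<Rightarrow> bool" where
  "locally_rectifiable c \<longleftrightarrow>
     (\<forall>a b. a \<le> b \<and> {a..b} \<subseteq> fst c \<longrightarrow> curve_length (snd c) a b < \<infinity>)"

definition arclength_param :: "(real \<Rightarrow> 'a::metric_space) \<Rightarrow> real \<Rightarrow> real \<Rightarrow> real \<Rightarrow> 'a" where
  "arclength_param g a b s = g (SOME t. t \<in> {a..b} \<and> enn2real (curve_length g a t) = s)"

definition line_integral_compact ::
    "('a::metric_space \<Rightarrow> ennreal) \<Rightarrow> (real \<Rightarrow> 'a) \<Rightarrow> real \<Rightarrow> real \<Rightarrow> ennreal" where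
  "line_integral_compact \<rho> g a b =
     (\<integral>\<^sup>+ s. indicator {0..enn2real (curve_length g a b)} s * \<rho> (arclength_param g a b s) \<partial>lborel)"

definition line_integral :: "('a::metric_space \<Rightarrow> ennreal) \<Rightarrow> real set \<times> (real \<Rightarrow> 'a) \<Rightarrow> ennreal" where
  "line_integral \<rho> c =
     (SUP p \<in> {p :: real \<times> real. fst p \<le> snd p \<and> {fst p..snd p} \<subseteq> fst c}. line_integral_compact \<rho> (snd c) (fst p) (snd p))"

definition modulus :: "'a::metric_space measure \<Rightarrow> 'a set \<Rightarrow> (real set \<times> (real \<Rightarrow> 'a)) set \<Rightarrow> ennreal" where
  "modulus M Y \<Gamma> =
     (INF \<rho> \<in> {\<rho> :: 'a \<Rightarrow> ennreal. \<rho> \<in> borel_measurable (restrict_space borel Y) \<and>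
                 (\<forall>c\<in>\<Gamma>. locally_rectifiable c \<longrightarrow> line_integral \<rho> c \<ge> 1)}.
        \<integral>\<^sup>+ y. (\<rho> y)\<^sup>2 \<partial>M)"

definition compose_family :: "('a \<Rightarrow> 'b) \<Rightarrow> (real set \<times> (real \<Rightarrow> 'a)) set \<Rightarrow> (real set \<times> (real \<Rightarrow> 'b)) set" where
  "compose_family u \<Gamma> = (\<lambda>c. (fst c, u \<circ> snd c)) ` \<Gamma>"

definition doubling :: "'a::metric_space set \<Rightarrow> bool" where
  "doubling X \<longleftrightarrow> (\<exists>N::nat. \<forall>x\<in>X. \<forall>r>0. \<exists>C. finite C \<and> card C \<le> N \<and> C \<subseteq> X \<and>
      ball x (2 * r) \<inter> X \<subseteq> (\<Union>c\<in>C. ball c r \<inter> X))"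

definition continuum_joining :: "'a::metric_space set \<Rightarrow> 'a \<Rightarrow> 'a \<Rightarrow> bool" where
  "continuum_joining K y z \<longleftrightarrow> compact K \<and> connected K \<and> y \<in> K \<and> z \<in> K"

definition linearly_locally_connected :: "'a::metric_space set \<Rightarrow> bool" where
  "linearly_locally_connected X \<longleftrightarrow> (\<exists>lam\<ge>1. \<forall>x\<in>X. \<forall>r>0.
      (\<forall>y\<in>ball x r \<inter> X. \<forall>z\<in>ball x r \<inter> X.
          \<exists>K. continuum_joining K y z \<and> K \<subseteq> ball x (lam * r) \<inter> X) \<and>
      (\<forall>y\<in>X - ball x r. \<forall>z\<in>X - ball x r.
          \<exists>K. continuum_joining K y z \<and> K \<subseteq> X - ball x (r / lam)))"

definition quasisymmetric :: "'a::metric_space set \<Rightarrow> 'b::metric_space set \<Rightarrow> ('a \<Rightarrow> 'b) \<Rightarrow> bool" where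
  "quasisymmetric S T f \<longleftrightarrow> (\<exists>g. homeomorphism S T f g) \<and>
     (\<exists>\<eta> \<eta>'. homeomorphism {0::real..} {0..} \<eta> \<eta>' \<and>
        (\<forall>z\<in>S. \<forall>a\<in>S. \<forall>b\<in>S. \<forall>t\<ge>0. dist z a \<le> t * dist z b \<longrightarrow>
            dist (f z) (f a) \<le> \<eta> t * dist (f z) (f b)))"

end

theory Submission
  imports Defs
begin

text \<open>Quasisymmetric maps transport doubling and linear local connectivity from the disc. For the
  converse, let \<open>z\<close>, \<open>a\<close>, \<open>b\<close> be close together with \<open>|z - a| \<le> |z - b|\<close>, and suppose that \<open>u a\<close> is much
  farther from \<open>u z\<close> than \<open>u b\<close>. Linear local connectivity yields a continuum in a small ball joining
  \<open>u z\<close> to \<open>u b\<close>, and one outside of a large ball joining \<open>u a\<close> to a far point. The growth condition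
  bounds the modulus of the curves meeting both by a quantity that is small if the ratio of the radii
  is large, while the modulus of the preimages is bounded from below: a density of small energy has
  small integral along most lines of a grid of curves in the disc, and such lines meet both continua
  because one of the coordinate projections of a continuum is large. Hence \<open>u\<close> is weakly
  quasisymmetric, and weakly quasisymmetric maps from a convex set to a doubling space are
  quasisymmetric. Large scales are controlled by compactness.\<close>

section \<open>Length and arc length parametrization\<close>

text \<open>The modulus inequality points in one direction, and each side is estimated where that is
  easy. An upper bound in \<open>X\<close> takes a single explicit density; a lower bound in the
  disc takes, for each density, a single curve on which it is small, and Fubini supplies it. Energy
  is invariant under scaling in dimension two, so a window of side comparable to
  \<open>dist z a\<close> gives the absolute constant \<open>1 / 10 ^ 10\<close>. Line integrals are
  defined through an arc length parametrization chosen by \<open>SOME\<close>, so neither estimate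
  is a direct computation. Both rest on one fact: a K-Lipschitz function on an interval enlarges
  Lebesgue measure at most by the factor K. Applied to the length function, it bounds line integrals
  along Lipschitz curves from above; applied to the distance from a centre, as a function of arc
  length, it bounds them from below. In the disc the obstacle is the boundary circle: near a point
  where an axis-parallel line is tangent to it, straight grid lines need not cross inside the disc.
  The grid is therefore bent to follow the circle.\<close>

lemma sum_le_curve_length:
  assumes "p 0 = a" "p n = b" "\<And>i. i < n \<Longrightarrow> p i \<le> p (Suc i)"
  shows "(\<Sum>i<n. ennreal (dist (g (p i)) (g (p (Suc i))))) \<le> curve_length g a b"
proof -
  have "(n, p) \<in> {p :: nat \<times> (nat \<Rightarrow> real). snd p 0 = a \<and> snd p (fst p) = b \<and> (\<forall>i<fst p. snd p i \<le> snd p (Suc i))}"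
    using assms by simp
  from SUP_upper[OF this, of "\<lambda>p. \<Sum>i<fst p. ennreal (dist (g (snd p i)) (g (snd p (Suc i))))"]
  show ?thesis unfolding curve_length_def by simp
qed

lemma curve_length_least:
  assumes "\<And>n p. p 0 = a \<Longrightarrow> p n = b \<Longrightarrow> (\<And>i. i < n \<Longrightarrow> p i \<le> p (Suc i)) \<Longrightarrow>
    (\<Sum>i<n. ennreal (dist (g (p i)) (g (p (Suc i))))) \<le> B"
  shows "curve_length g a b \<le> B"
  unfolding curve_length_def by (rule SUP_least) (use assms in force)

lemma chain_mono:
  fixes p :: "nat \<Rightarrow> real"
  assumes "\<And>i. i < n \<Longrightarrow> p i \<le> p (Suc i)" "i \<le> j" "j \<le> n"
  shows "p i \<le> p j"
  using assms(2,3)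
proof (induction j rule: dec_induct)
  case (step k)
  then show ?case using assms(1)[of k] by simp
qed simp

lemma curve_length_extend:
  assumes "a \<le> b" "b \<le> c"
  shows "curve_length g a b + ennreal (dist (g b) (g c)) \<le> curve_length g a c"
proof -
  let ?I = "{p :: nat \<times> (nat \<Rightarrow> real). snd p 0 = a \<and> snd p (fst p) = b \<and> (\<forall>i<fst p. snd p i \<le> snd p (Suc i))}"
  have ne: "?I \<noteq> {}"
  proof -
    have "(1, \<lambda>i. if i = 0 then a else b) \<in> ?I" using assms by simp
    then show ?thesis by blast
  qed
  show ?thesis unfolding curve_length_def[of g a b]
  proof (subst ennreal_SUP_add_left[OF ne, symmetric], rule SUP_least)
    fix q assume q: "q \<in> ?I"
    obtain n p where [simp]: "q = (n, p)" by (cases q)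
    define p' where "p' = (\<lambda>i. if i \<le> n then p i else c)"
    have "(\<Sum>i<Suc n. ennreal (dist (g (p' i)) (g (p' (Suc i))))) \<le> curve_length g a c"
      by (rule sum_le_curve_length) (use q assms in \<open>auto simp: p'_def less_Suc_eq\<close>)
    then show "(\<Sum>i<fst q. ennreal (dist (g (snd q i)) (g (snd q (Suc i))))) + ennreal (dist (g b) (g c)) \<le> curve_length g a c"
      using q by (simp add: p'_def)
  qed
qed

lemma dist_le_curve_length:
  assumes "a \<le> b"
  shows "ennreal (dist (g a) (g b)) \<le> curve_length g a b"
  using curve_length_extend[of a a b g] assms
  by (meson add_increasing dual_order.trans order_refl zero_le)

text \<open>Induction along a partition of \<open>[b, c]\<close> by
  \<open>curve_length_extend\<close> adds its increments to the whole length of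
  \<open>[a, b]\<close>, so only one supremum has to be opened.\<close>

lemma curve_length_superadd:
  assumes "a \<le> b" "b \<le> c"
  shows "curve_length g a b + curve_length g b c \<le> curve_length g a c"
proof -
  let ?I = "{p :: nat \<times> (nat \<Rightarrow> real). snd p 0 = b \<and> snd p (fst p) = c \<and> (\<forall>i<fst p. snd p i \<le> snd p (Suc i))}"
  have ne: "?I \<noteq> {}"
  proof -
    have "(1, \<lambda>i. if i = 0 then b else c) \<in> ?I" using assms by simp
    then show ?thesis by blast
  qed
  have "curve_length g b c + curve_length g a b \<le> curve_length g a c" unfolding curve_length_def[of g b c]
  proof (subst ennreal_SUP_add_left[OF ne, symmetric], rule SUP_least)
    fix q assume q: "q \<in> ?I"
    obtain n p where [simp]: "q = (n, p)" by (cases q)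
    have "(\<Sum>i<k. ennreal (dist (g (p i)) (g (p (Suc i))))) + curve_length g a b \<le> curve_length g a (p k)" if "k \<le> n" for k
      using that
    proof (induction k)
      case (Suc k)
      have "b \<le> p k" using chain_mono[of n p 0 k] q Suc by auto
      have "(\<Sum>i<Suc k. ennreal (dist (g (p i)) (g (p (Suc i))))) + curve_length g a b
        = (\<Sum>i<k. ennreal (dist (g (p i)) (g (p (Suc i))))) + curve_length g a b + ennreal (dist (g (p k)) (g (p (Suc k))))"
        by (simp add: ac_simps)
      also have "\<dots> \<le> curve_length g a (p k) + ennreal (dist (g (p k)) (g (p (Suc k))))"
        using Suc by (intro add_right_mono) simp
      also have "\<dots> \<le> curve_length g a (p (Suc k))"
        using \<open>b \<le> p k\<close> assms q Suc by (intro curve_length_extend) auto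
      finally show ?case .
    qed (use q in simp)
    from this[of n] q show "(\<Sum>i<fst q. ennreal (dist (g (snd q i)) (g (snd q (Suc i))))) + curve_length g a b \<le> curve_length g a c"
      by simp
  qed
  then show ?thesis by (simp add: add.commute)
qed

text \<open>Refinement at \<open>b\<close>: the single increment that jumps over \<open>b\<close> is
  split by the triangle inequality. It is the case of the induction in which \<open>p k\<close>
  still lies before \<open>b\<close>.\<close>

lemma curve_length_subadd:
  assumes "a \<le> b" "b \<le> c"
  shows "curve_length g a c \<le> curve_length g a b + curve_length g b c"
proof (rule curve_length_least)
  fix n p assume p: "p 0 = a" "p n = c" "\<And>i. i < n \<Longrightarrow> p i \<le> p (Suc i)"
  have "(\<Sum>i<k. ennreal (dist (g (p i)) (g (p (Suc i))))) \<le> curve_length g a b + curve_length g b (p k)"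
    if "k \<le> n" "b \<le> p k" for k
    using that
  proof (induction k)
    case (Suc k)
    have ak: "a \<le> p k" "p k \<le> p (Suc k)" using chain_mono[of n p 0 k] p Suc by auto
    show ?case
    proof (cases "b \<le> p k")
      case True
      have "(\<Sum>i<Suc k. ennreal (dist (g (p i)) (g (p (Suc i)))))
        \<le> curve_length g a b + curve_length g b (p k) + ennreal (dist (g (p k)) (g (p (Suc k))))"
        using Suc True by (simp add: add_right_mono)
      also have "\<dots> \<le> curve_length g a b + curve_length g b (p (Suc k))"
        unfolding add.assoc using True ak by (intro add_left_mono curve_length_extend) auto
      finally show ?thesis .
    next
      case False
      have "(\<Sum>i<Suc k. ennreal (dist (g (p i)) (g (p (Suc i)))))
         \<le> curve_length g a (p k) + (ennreal (dist (g (p k)) (g b)) + ennreal (dist (g b) (g (p (Suc k)))))"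
        unfolding sum.lessThan_Suc
      proof (rule add_mono)
        show "(\<Sum>i<k. ennreal (dist (g (p i)) (g (p (Suc i))))) \<le> curve_length g a (p k)"
          using p Suc by (intro sum_le_curve_length) auto
        show "ennreal (dist (g (p k)) (g (p (Suc k)))) \<le> ennreal (dist (g (p k)) (g b)) + ennreal (dist (g b) (g (p (Suc k))))"
          by (metis dist_triangle ennreal_leI ennreal_plus zero_le_dist)
      qed
      also have "\<dots> \<le> curve_length g a b + curve_length g b (p (Suc k))"
        unfolding add.assoc[symmetric] using False ak Suc
        by (intro add_mono curve_length_extend dist_le_curve_length) auto
      finally show ?thesis .
    qed
  qed simp
  from this[of n] p assms show "(\<Sum>i<n. ennreal (dist (g (p i)) (g (p (Suc i))))) \<le> curve_length g a b + curve_length g b c"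
    by simp
qed

lemma curve_length_add:
  assumes "a \<le> b" "b \<le> c"
  shows "curve_length g a c = curve_length g a b + curve_length g b c"
  using curve_length_subadd[OF assms] curve_length_superadd[OF assms] by (rule antisym)

lemma curve_length_refl [simp]: "curve_length g a a = 0"
proof -
  have "(\<Sum>i<n. ennreal (dist (g (p i)) (g (p (Suc i))))) = 0"
    if p: "p 0 = a" "p n = a" "\<And>i. i < n \<Longrightarrow> p i \<le> p (Suc i)" for n p
  proof -
    have "p i = a" if "i \<le> n" for i
      using chain_mono[of n p 0 i] chain_mono[of n p i n] p that by force
    then show ?thesis by simp
  qed
  then have "curve_length g a a \<le> 0" by (intro curve_length_least) auto
  then show ?thesis by simp
qed

text \<open>A partition that nearly realizes the length is clamped to \<open>[s', t']\<close>.
  Clamping moves each point by less than \<open>\<delta>\<close>, so uniform continuity keeps the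
  loss small. Continuity of the length function will follow from this.\<close>

lemma curve_length_lower_semicontinuous:
  assumes cont: "continuous_on {s..t} g" and c: "c < curve_length g s t"
  obtains \<delta> where "\<delta> > 0" "\<And>s' t'. s \<le> s' \<Longrightarrow> s' \<le> t' \<Longrightarrow> t' \<le> t \<Longrightarrow> s' < s + \<delta> \<Longrightarrow> t - \<delta> < t' \<Longrightarrow>
    c < curve_length g s' t'"
proof -
  obtain n p where p: "p 0 = s" "p n = t" "\<And>i. i < n \<Longrightarrow> p i \<le> p (Suc i)"
    and cS: "c < (\<Sum>i<n. ennreal (dist (g (p i)) (g (p (Suc i)))))"
    using c unfolding curve_length_def less_SUP_iff by auto
  define S where "S = (\<Sum>i<n. dist (g (p i)) (g (p (Suc i))))"
  have cS: "c < ennreal S" using cS by (simp add: S_def sum_nonneg)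
  then obtain c' where c': "c = ennreal c'" "0 \<le> c'" "c' < S"
    by (metis ennreal_cases ennreal_less_iff not_less_iff_gr_or_eq order_less_trans ennreal_less_top)
  \<comment> \<open>Each of the \<open>n\<close> increments loses at most \<open>2 * e\<close>; with
    \<open>n + 1\<close> the total loss stays strictly below \<open>S - c'\<close>, also for
    \<open>n = 0\<close>.\<close>
  define e where "e = (S - c') / (2 * (n + 1))"
  have e: "e > 0" using c' by (simp add: e_def)
  have "uniformly_continuous_on {s..t} g" using cont by (simp add: compact_uniformly_continuous)
  then obtain \<delta> where d: "\<delta> > 0" and unif: "\<And>x y. x \<in> {s..t} \<Longrightarrow> y \<in> {s..t} \<Longrightarrow> dist x y < \<delta> \<Longrightarrow> dist (g x) (g y) < e"
    using e unfolding uniformly_continuous_on_def by metis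
  show ?thesis
  proof
    fix s' t' assume st: "s \<le> s'" "s' \<le> t'" "t' \<le> t" "s' < s + \<delta>" "t - \<delta> < t'"
    define q where "q = (\<lambda>i. max s' (min t' (p i)))"
    have pin: "p i \<in> {s..t}" if "i \<le> n" for i
      using chain_mono[of n p 0 i] chain_mono[of n p i n] p that by force
    have qp: "dist (g (p i)) (g (q i)) < e" if "i \<le> n" for i
      by (rule unif) (use pin[OF that] st d in \<open>auto simp: q_def dist_real_def\<close>)
    have "S \<le> (\<Sum>i<n. dist (g (q i)) (g (q (Suc i))) + 2 * e)"
      unfolding S_def
    proof (rule sum_mono)
      fix i assume i: "i \<in> {..<n}"
      have "dist (g (p i)) (g (p (Suc i))) \<le> dist (g (p i)) (g (q i)) + dist (g (q i)) (g (q (Suc i))) + dist (g (p (Suc i))) (g (q (Suc i)))"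
        by metric
      then show "dist (g (p i)) (g (p (Suc i))) \<le> dist (g (q i)) (g (q (Suc i))) + 2 * e"
        using qp[of i] qp[of "Suc i"] i by simp
    qed
    also have "\<dots> = (\<Sum>i<n. dist (g (q i)) (g (q (Suc i)))) + 2 * n * e"
      by (simp add: sum.distrib)
    also have "2 * n * e < S - c'"
      using c' by (simp add: e_def field_simps)
    finally have "c' < (\<Sum>i<n. dist (g (q i)) (g (q (Suc i))))" by simp
    then have "c < (\<Sum>i<n. ennreal (dist (g (q i)) (g (q (Suc i)))))"
      using c' by (simp add: ennreal_less_iff sum_nonneg)
    also have "\<dots> \<le> curve_length g s' t'"
    proof -
      have "q i \<le> q (Suc i)" if "i < n" for i
        using p(3)[OF that] unfolding q_def by linarith
      then show ?thesis
        by (intro sum_le_curve_length) (use p st in \<open>auto simp: q_def\<close>)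
    qed
    finally show "c < curve_length g s' t'" .
  qed (use d in simp)
qed

lemma curve_length_mono:
  assumes "a \<le> b" "b \<le> c"
  shows "curve_length g a b \<le> curve_length g a c" "curve_length g b c \<le> curve_length g a c"
  by (simp_all add: curve_length_add[OF assms])

section \<open>Arc length as a parameter on a rectifiable arc\<close>

locale rectifiable_arc =
  fixes g :: "real \<Rightarrow> 'a::metric_space" and a b :: real
  assumes le: "a \<le> b" and cont: "continuous_on {a..b} g" and finite_length: "curve_length g a b < \<infinity>"
begin

definition len :: "real \<Rightarrow> real" where "len t = enn2real (curve_length g a t)"

lemma finite_sub: "a \<le> s \<Longrightarrow> s \<le> t \<Longrightarrow> t \<le> b \<Longrightarrow> curve_length g s t < \<infinity>"
  by (meson curve_length_mono finite_length order.trans order_le_less_trans)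

lemma curve_length_sub:
  assumes "a \<le> s" "s \<le> t" "t \<le> b"
  shows "curve_length g s t = ennreal (len t - len s)"
proof -
  have f: "curve_length g a s < top" "curve_length g s t < top" "curve_length g a t < top"
    using finite_sub[of a s] finite_sub[of s t] finite_sub[of a t] assms by auto
  have "curve_length g a t = curve_length g a s + curve_length g s t"
    using assms by (intro curve_length_add)
  then have "len t = len s + enn2real (curve_length g s t)"
    unfolding len_def using f by (simp add: enn2real_plus)
  then show ?thesis using f by simp
qed

lemma len_mono: "a \<le> s \<Longrightarrow> s \<le> t \<Longrightarrow> t \<le> b \<Longrightarrow> len s \<le> len t"
  unfolding len_def using finite_sub[of a t] curve_length_mono(1)[of a s t g] by (auto intro!: enn2real_mono)

lemma len_a [simp]: "len a = 0" by (simp add: len_def)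

lemma dist_le_len:
  assumes "s \<in> {a..b}" "t \<in> {a..b}"
  shows "dist (g s) (g t) \<le> \<bar>len s - len t\<bar>"
proof -
  have *: "dist (g s) (g t) \<le> len t - len s" if "a \<le> s" "s \<le> t" "t \<le> b" for s t
    using dist_le_curve_length[of s t g] curve_length_sub[OF that] len_mono[OF that] that
    by (simp add: ennreal_le_iff)
  show ?thesis using *[of s t] *[of t s] assms by (cases "s \<le> t") (auto simp: dist_commute)
qed

text \<open>Left continuity is lower semicontinuity on \<open>[a, t]\<close>. Right continuity is
  lower semicontinuity on \<open>[t, b]\<close>, since length that survives on \<open>[x, b]\<close>
  cannot have been spent on \<open>[t, x]\<close>. The case distinctions remove negative thresholds,
  which \<open>ennreal\<close> would truncate to 0.\<close>

lemma continuous_len: "continuous_on {a..b} len"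
  unfolding continuous_on_iff
proof (intro ballI allI impI)
  fix t e :: real assume t: "t \<in> {a..b}" and e: "e > 0"
  have left: "\<exists>d>0. \<forall>x. a \<le> x \<and> x \<le> t \<and> t - d < x \<longrightarrow> len t - e < len x"
  proof (cases "len t - e < 0")
    case True
    have "0 \<le> len x" for x by (simp add: len_def)
    then show ?thesis using True by (intro exI[of _ 1]) (metis less_le_trans zero_less_one)
  next
    case False
    have "ennreal (len t - e) < curve_length g a t"
      using curve_length_sub[of a t] t e False by (simp add: ennreal_less_iff)
    then obtain d where d: "d > 0" "\<And>s' t'. a \<le> s' \<Longrightarrow> s' \<le> t' \<Longrightarrow> t' \<le> t \<Longrightarrow> s' < a + d \<Longrightarrow> t - d < t' \<Longrightarrow>
       ennreal (len t - e) < curve_length g s' t'"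
      using curve_length_lower_semicontinuous[of a t g "ennreal (len t - e)"] continuous_on_subset[OF cont] t
      by (metis atLeastAtMost_iff atLeastatMost_subset_iff order_refl)
    have "len t - e < len x" if "a \<le> x" "x \<le> t" "t - d < x" for x
    proof -
      have "ennreal (len t - e) < curve_length g a x" using d that by (intro d(2)) auto
      then show ?thesis using curve_length_sub[of a x] that t False by (simp add: ennreal_less_iff)
    qed
    then show ?thesis using d by blast
  qed
  have right: "\<exists>d>0. \<forall>x. t \<le> x \<and> x \<le> b \<and> x < t + d \<longrightarrow> len x < len t + e"
  proof (cases "len b - len t - e < 0")
    case True
    have "len x \<le> len b" if "t \<le> x" "x \<le> b" for x using len_mono[of x b] t that by auto
    then show ?thesis using True by (intro exI[of _ 1]) force
  next
    case False
    have "ennreal (len b - len t - e) < curve_length g t b"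
      using curve_length_sub[of t b] t e False by (simp add: ennreal_less_iff)
    then obtain d where d: "d > 0" "\<And>s' t'. t \<le> s' \<Longrightarrow> s' \<le> t' \<Longrightarrow> t' \<le> b \<Longrightarrow> s' < t + d \<Longrightarrow> b - d < t' \<Longrightarrow>
       ennreal (len b - len t - e) < curve_length g s' t'"
      using curve_length_lower_semicontinuous[of t b g "ennreal (len b - len t - e)"] continuous_on_subset[OF cont] t
      by (metis atLeastAtMost_iff atLeastatMost_subset_iff order_refl)
    have "len x < len t + e" if "t \<le> x" "x \<le> b" "x < t + d" for x
    proof -
      have "ennreal (len b - len t - e) < curve_length g x b" using d that by (intro d(2)) auto
      then show ?thesis using curve_length_sub[of x b] that t False by (simp add: ennreal_less_iff)
    qed
    then show ?thesis using d by blast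
  qed
  obtain d1 where d1: "d1>0" "\<And>x. a \<le> x \<Longrightarrow> x \<le> t \<Longrightarrow> t - d1 < x \<Longrightarrow> len t - e < len x" using left by blast
  obtain d2 where d2: "d2>0" "\<And>x. t \<le> x \<Longrightarrow> x \<le> b \<Longrightarrow> x < t + d2 \<Longrightarrow> len x < len t + e" using right by blast
  show "\<exists>d>0. \<forall>x'\<in>{a..b}. dist x' t < d \<longrightarrow> dist (len x') (len t) < e"
  proof (intro exI[of _ "min d1 d2"] conjI ballI impI)
    fix x assume x: "x \<in> {a..b}" "dist x t < min d1 d2"
    show "dist (len x) (len t) < e"
    proof (cases "x \<le> t")
      case True
      then show ?thesis using d1(2)[of x] x len_mono[of x t] t by (auto simp: dist_real_def)
    next
      case False
      then show ?thesis using d2(2)[of x] x len_mono[of t x] t by (auto simp: dist_real_def)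
    qed
  qed (use d1 d2 in simp)
qed

lemma len_image: "len ` {a..b} = {0..len b}"
proof
  show "len ` {a..b} \<subseteq> {0..len b}" using len_mono[of a] len_mono[of _ b] by auto
  show "{0..len b} \<subseteq> len ` {a..b}"
    using IVT'[OF _ _ le continuous_len] by (auto simp: image_def) (metis atLeastAtMost_iff)
qed

abbreviation arc_param :: "real \<Rightarrow> 'a" where "arc_param \<equiv> arclength_param g a b"

lemma arc_obtain:
  assumes "s \<in> {0..len b}"
  obtains t where "t \<in> {a..b}" "len t = s" "arc_param s = g t"
proof -
  let ?P = "\<lambda>t. t \<in> {a..b} \<and> enn2real (curve_length g a t) = s"
  have "\<exists>t. ?P t" using assms len_image by (metis (no_types) imageE len_def)
  then have "?P (SOME t. ?P t)" by (rule someI_ex)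
  then show ?thesis using that[of "SOME t. ?P t"] by (auto simp: arclength_param_def len_def)
qed

text \<open>The choice made by \<open>SOME\<close> is harmless: two parameters with the same value
  of \<open>len\<close> have images at distance 0.\<close>

lemma arc_len: "t \<in> {a..b} \<Longrightarrow> arc_param (len t) = g t"
proof -
  assume t: "t \<in> {a..b}"
  then have "len t \<in> {0..len b}" using len_image by blast
  then obtain t' where "t' \<in> {a..b}" "len t' = len t" "arc_param (len t) = g t'" by (rule arc_obtain)
  then show "arc_param (len t) = g t" using dist_le_len[of t' t] t by simp
qed

lemma dist_arc:
  assumes "s \<in> {0..len b}" "s' \<in> {0..len b}"
  shows "dist (arc_param s) (arc_param s') \<le> \<bar>s - s'\<bar>"
  using arc_obtain[OF assms(1)] arc_obtain[OF assms(2)] dist_le_len by metis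

lemma arc_image: "arc_param ` {0..len b} \<subseteq> g ` {a..b}"
  using arc_obtain by blast

lemma continuous_arc: "continuous_on {0..len b} arc_param"
  unfolding continuous_on_iff using dist_arc
  by (metis dist_real_def le_less_trans)

lemma line_integral_compact_eq:
  "line_integral_compact \<rho> g a b = (\<integral>\<^sup>+ s. indicator {0..len b} s * \<rho> (arc_param s) \<partial>lborel)"
  by (simp add: line_integral_compact_def len_def)

end

lemma curve_length_Lipschitz:
  assumes "a \<le> b" and lip: "\<And>s t. s \<in> {a..b} \<Longrightarrow> t \<in> {a..b} \<Longrightarrow> dist (g s) (g t) \<le> K * \<bar>s - t\<bar>"
  shows "curve_length g a b \<le> ennreal (K * (b - a))"
proof (rule curve_length_least)
  fix n p assume p: "p 0 = a" "p n = b" "\<And>i. i < n \<Longrightarrow> p i \<le> p (Suc i)"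
  have pin: "p i \<in> {a..b}" if "i \<le> n" for i
    using chain_mono[of n p 0 i] chain_mono[of n p i n] p that by force
  have "(\<Sum>i<n. dist (g (p i)) (g (p (Suc i)))) \<le> (\<Sum>i<n. K * (p (Suc i) - p i))"
  proof (rule sum_mono)
    fix i assume "i \<in> {..<n}"
    then show "dist (g (p i)) (g (p (Suc i))) \<le> K * (p (Suc i) - p i)"
      using lip[OF pin pin, of i "Suc i"] p(3)[of i] by (simp add: abs_minus_commute)
  qed
  also have "\<dots> = K * (b - a)"
    using p by (simp add: sum_lessThan_telescope flip: sum_distrib_left)
  finally show "(\<Sum>i<n. ennreal (dist (g (p i)) (g (p (Suc i))))) \<le> ennreal (K * (b - a))"
    by (simp add: ennreal_leI)
qed

section \<open>Line integrals along Lipschitz images\<close>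

text \<open>The preimage of \<open>B\<close> is covered, up to a small excess, by intervals, each of
  which has its image in an interval \<open>K\<close> times as long. As their interiors are
  disjoint, the lengths add up to no more than the measure of the union.\<close>

lemma emeasure_Lipschitz_image_le:
  fixes f :: "real \<Rightarrow> real"
  assumes "K \<ge> 0" and lip: "\<And>s t. s \<in> {a..b} \<Longrightarrow> t \<in> {a..b} \<Longrightarrow> \<bar>f s - f t\<bar> \<le> K * \<bar>s - t\<bar>"
    and B: "B \<in> sets borel" "B \<subseteq> f ` {a..b}" and A: "{t \<in> {a..b}. f t \<in> B} \<in> sets borel"
  shows "emeasure lborel B \<le> ennreal K * emeasure lborel {t \<in> {a..b}. f t \<in> B}"
proof -
  define A where "A = {t \<in> {a..b}. f t \<in> B}"
  have Ab: "A \<in> sets borel" "A \<subseteq> cbox a b" using A by (auto simp: A_def)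
  have Alm: "A \<in> lmeasurable"
    by (rule bounded_set_imp_lmeasurable) (use Ab bounded_subset[OF bounded_cbox Ab(2)] in auto)
  have fin: "emeasure lborel A = ennreal (measure lebesgue A)"
    using emeasure_completion[of A lborel] emeasure_eq_measure2[OF Alm] Ab(1) by simp
  have "emeasure lborel B \<le> ennreal K * emeasure lborel A + ennreal e" if e: "e > 0" for e
  proof -
    \<comment> \<open>The denominator \<open>K + 1\<close> admits \<open>K = 0\<close>.\<close>
    define e' where "e' = e / (K + 1)"
    have e': "e' > 0" using e \<open>K \<ge> 0\<close> by (simp add: e'_def)
    obtain D where D: "countable D" "\<And>I. I \<in> D \<Longrightarrow> I \<subseteq> cbox a b \<and> I \<noteq> {} \<and> (\<exists>c d. I = cbox c d)"
      "pairwise (\<lambda>A B. interior A \<inter> interior B = {}) D" "A \<subseteq> \<Union>D" "\<Union>D \<in> lmeasurable"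
      "measure lebesgue (\<Union>D) \<le> measure lebesgue A + e'"
      by (rule measurable_outer_intervals_bounded[OF Alm Ab(2) e']) (rule that)
    \<comment> \<open>\<open>D\<close> may be finite; the sequence \<open>C\<close> pads its
      enumeration with empty sets.\<close>
    define J where "J = to_nat_on D ` D"
    define C where "C = (\<lambda>n. if n \<in> J then from_nat_into D n else {})"
    have CD: "C n \<in> D" if "n \<in> J" for n
      using that D(1) by (auto simp: C_def J_def)
    have Cint: "\<exists>c d. C n = {c..d} \<and> (n \<in> J \<longrightarrow> c \<le> d \<and> {c..d} \<subseteq> {a..b})" for n
    proof (cases "n \<in> J")
      case True
      with D(2)[OF CD[OF True]] show ?thesis by fastforce
    next
      case False
      then show ?thesis by (intro exI[of _ 1] exI[of _ 0]) (simp add: C_def)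
    qed
    have UC: "\<Union>D \<subseteq> (\<Union>n. C n)"
    proof
      fix x assume "x \<in> \<Union>D"
      then obtain I where I: "I \<in> D" "x \<in> I" by blast
      then have "x \<in> C (to_nat_on D I)" using D(1) by (simp add: C_def J_def)
      then show "x \<in> (\<Union>n. C n)" by blast
    qed
    have CU: "(\<Union>n. C n) \<subseteq> \<Union>D"
      using CD by (auto simp: C_def split: if_splits)
    have disj: "disjoint_family (\<lambda>n. interior (C n))"
      unfolding disjoint_family_on_def
    proof (intro ballI impI)
      fix m n :: nat assume "m \<noteq> n"
      show "interior (C m) \<inter> interior (C n) = {}"
      proof (cases "m \<in> J \<and> n \<in> J")
        case True
        then obtain I I' where I: "I \<in> D" "m = to_nat_on D I" "I' \<in> D" "n = to_nat_on D I'"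
          by (auto simp: J_def)
        then have "C m = I" "C n = I'" "I \<noteq> I'" using True D(1) \<open>m \<noteq> n\<close> by (auto simp: C_def)
        then show ?thesis using D(3) I unfolding pairwise_def by blast
      qed (auto simp: C_def)
    qed
    have cover: "\<exists>S. S \<in> sets borel \<and> f ` C n \<subseteq> S \<and> emeasure lborel S \<le> ennreal K * emeasure lborel (interior (C n))" for n
    proof -
      obtain c d where cd: "C n = {c..d}" "n \<in> J \<longrightarrow> c \<le> d \<and> {c..d} \<subseteq> {a..b}" using Cint by blast
      show ?thesis
      proof (cases "n \<in> J")
        case True
        define m where "m = (c + d) / 2"
        define r where "r = K * (d - c) / 2"
        have "c \<le> d" "{c..d} \<subseteq> {a..b}" using cd True by auto
        then have ab: "a \<le> c" "d \<le> b" by auto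
        have r: "0 \<le> r" using \<open>K \<ge> 0\<close> \<open>c \<le> d\<close> by (simp add: r_def)
        have "f ` C n \<subseteq> {f m - r .. f m + r}"
        proof clarsimp
          fix x assume "x \<in> C n"
          then have x: "c \<le> x" "x \<le> d" using cd by auto
          then have "\<bar>f x - f m\<bar> \<le> K * \<bar>x - m\<bar>" using ab \<open>c \<le> d\<close> by (intro lip) (auto simp: m_def)
          also have "\<dots> \<le> K * ((d - c) / 2)"
            using x \<open>K \<ge> 0\<close> by (intro mult_left_mono) (auto simp: m_def abs_if field_simps)
          finally have "\<bar>f x - f m\<bar> \<le> r" by (simp add: r_def)
          then show "f m - r \<le> f x \<and> f x \<le> f m + r" by linarith
        qed
        moreover have "emeasure lborel {f m - r .. f m + r} \<le> ennreal K * emeasure lborel (interior (C n))"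
          using \<open>c \<le> d\<close> r \<open>K \<ge> 0\<close> by (simp add: cd r_def flip: ennreal_mult)
        ultimately show ?thesis by (intro exI[of _ "{f m - r .. f m + r}"]) auto
      next
        case False
        then show ?thesis by (auto simp: C_def)
      qed
    qed
    obtain S where S: "\<And>n. S n \<in> sets borel" "\<And>n. f ` C n \<subseteq> S n"
      "\<And>n. emeasure lborel (S n) \<le> ennreal K * emeasure lborel (interior (C n))"
      using cover by metis
    have "B \<subseteq> f ` A" using B by (auto simp: A_def)
    also have "\<dots> \<subseteq> f ` (\<Union>n. C n)" using D(4) UC by blast
    also have "\<dots> \<subseteq> (\<Union>n. S n)" using S(2) by blast
    finally have "emeasure lborel B \<le> emeasure lborel (\<Union>n. S n)"
      using S(1) by (intro emeasure_mono) auto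
    also have "\<dots> \<le> (\<Sum>n. emeasure lborel (S n))"
      using S(1) by (intro emeasure_subadditive_countably) auto
    also have "\<dots> \<le> (\<Sum>n. ennreal K * emeasure lborel (interior (C n)))"
      using S(3) by (intro suminf_le) auto
    also have "\<dots> = ennreal K * (\<Sum>n. emeasure lborel (interior (C n)))"
      by simp
    also have "(\<Sum>n. emeasure lborel (interior (C n))) = emeasure lborel (\<Union>n. interior (C n))"
      using disj by (intro suminf_emeasure) auto
    also have "emeasure lborel (\<Union>n. interior (C n)) = emeasure lebesgue (\<Union>n. interior (C n))"
      by (subst emeasure_completion) auto
    also have "\<dots> \<le> emeasure lebesgue (\<Union>D)"
      using CU interior_subset D(5) by (intro emeasure_mono) (blast, auto)
    also have "\<dots> \<le> ennreal (measure lebesgue A + e')"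
      using D(5,6) by (simp add: emeasure_eq_measure2 ennreal_leI)
    finally have "emeasure lborel B \<le> ennreal K * ennreal (measure lebesgue A + e')"
      by (simp add: mult_left_mono)
    also have "\<dots> = ennreal K * emeasure lborel A + ennreal (K * e')"
      unfolding fin using \<open>K \<ge> 0\<close> e' by (simp add: ennreal_mult'' distrib_left ennreal_plus)
    also have "\<dots> \<le> ennreal K * emeasure lborel A + ennreal e"
      using e \<open>K \<ge> 0\<close> by (intro add_left_mono ennreal_leI) (simp add: e'_def field_simps)
    finally show ?thesis .
  qed
  then show ?thesis unfolding A_def
    by (rule ennreal_le_epsilon)
qed

text \<open>The area formula with the multiplicity dropped. Phrased as a comparison of two measures,
  Lebesgue measure on the image and \<open>K\<close> times the push-forward, the estimate for sets
  passes to all Borel integrands at once.\<close>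

lemma nn_integral_Lipschitz_image_le:
  fixes f :: "real \<Rightarrow> real"
  assumes K: "K \<ge> 0" and lip: "\<And>s t. s \<in> {a..b} \<Longrightarrow> t \<in> {a..b} \<Longrightarrow> \<bar>f s - f t\<bar> \<le> K * \<bar>s - t\<bar>"
    and F[measurable]: "F \<in> borel_measurable borel"
  shows "(\<integral>\<^sup>+ x. F x * indicator (f ` {a..b}) x \<partial>lborel) \<le> ennreal K * (\<integral>\<^sup>+ t. F (f t) * indicator {a..b} t \<partial>lborel)"
proof -
  have cont: "continuous_on {a..b} f"
    by (rule lipschitz_on_continuous_on, rule lipschitz_onI[of _ _ K]) (use lip K in \<open>auto simp: dist_real_def\<close>)
  have [measurable]: "f ` {a..b} \<in> sets borel"
    using compact_continuous_image[OF cont] by (simp add: borel_compact)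
  \<comment> \<open>Extension by 0 makes the function Borel on the whole line; the density
    \<open>indicator {a..b}\<close> in \<open>N\<close> discards the added values.\<close>
  define f' where "f' = (\<lambda>t. if t \<in> {a..b} then f t else 0)"
  have [measurable]: "f' \<in> borel_measurable borel"
    unfolding f'_def by (rule borel_measurable_continuous_on_if) (auto intro: cont)
  define M where "M = density lborel (indicator (f ` {a..b}))"
  define N where "N = scale_measure (ennreal K) (distr (density lborel (indicator {a..b})) borel f')"
  have "M \<le> N"
  proof (subst le_measure)
    show "sets M = sets N" by (simp add: M_def N_def)
    show "\<forall>B\<in>sets M. emeasure M B \<le> emeasure N B"
    proof
      fix B assume "B \<in> sets M"
      then have [measurable]: "B \<in> sets borel" by (simp add: M_def)
      have eq: "f' -` B \<inter> {a..b} = {t \<in> {a..b}. f t \<in> f ` {a..b} \<inter> B}" by (auto simp: f'_def)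
      have m': "f' -` B \<in> sets borel"
        using measurable_sets_borel[of f' borel B] by (auto simp: space_borel)
      then have m: "f' -` B \<inter> {a..b} \<in> sets borel" by auto
      have "emeasure M B = emeasure lborel (f ` {a..b} \<inter> B)"
      proof -
        have "(\<integral>\<^sup>+ x. indicator (f ` {a..b}) x * indicator B x \<partial>lborel) = (\<integral>\<^sup>+ x. indicator (f ` {a..b} \<inter> B) x \<partial>lborel)"
          by (rule nn_integral_cong) (simp add: indicator_def)
        then show ?thesis by (simp add: M_def emeasure_density)
      qed
      also have "\<dots> \<le> ennreal K * emeasure lborel (f' -` B \<inter> {a..b})"
        unfolding eq by (rule emeasure_Lipschitz_image_le[OF K lip]) (use m[unfolded eq] in auto)
      also have "\<dots> = emeasure N B"
      proof -
        have "(\<integral>\<^sup>+ x. indicator {a..b} x * indicator (f' -` B) x \<partial>lborel) = (\<integral>\<^sup>+ x. indicator (f' -` B \<inter> {a..b}) x \<partial>lborel)"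
          by (rule nn_integral_cong) (auto simp: indicator_def)
        then show ?thesis using m m' by (simp add: N_def emeasure_distr emeasure_density)
      qed
      finally show "emeasure M B \<le> emeasure N B" .
    qed
  qed
  have "(\<integral>\<^sup>+ x. F x * indicator (f ` {a..b}) x \<partial>lborel) = nn_integral M F"
    by (simp add: M_def nn_integral_density mult.commute)
  also have "\<dots> \<le> nn_integral N F"
    by (rule nn_integral_mono_measure) (use \<open>M \<le> N\<close> in \<open>auto simp: M_def N_def\<close>)
  also have "\<dots> = ennreal K * (\<integral>\<^sup>+ t. indicator {a..b} t * F (f' t) \<partial>lborel)"
    by (simp add: N_def nn_integral_scale_measure nn_integral_distr nn_integral_density)
  also have "(\<integral>\<^sup>+ t. indicator {a..b} t * F (f' t) \<partial>lborel) = (\<integral>\<^sup>+ t. F (f t) * indicator {a..b} t \<partial>lborel)"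
    by (rule nn_integral_cong) (auto simp: f'_def indicator_def)
  finally show ?thesis .
qed

text \<open>The substitution \<open>x = len t\<close> in the arc length integral, with
  \<open>len\<close> inheriting the Lipschitz constant of \<open>g\<close>.\<close>

lemma (in rectifiable_arc) line_integral_compact_le:
  assumes K: "K \<ge> 0" and lip: "\<And>s t. s \<in> {a..b} \<Longrightarrow> t \<in> {a..b} \<Longrightarrow> dist (g s) (g t) \<le> K * \<bar>s - t\<bar>"
    and D: "g ` {a..b} \<subseteq> D" and \<rho>: "\<rho> \<in> borel_measurable (restrict_space borel D)"
  shows "line_integral_compact \<rho> g a b \<le> ennreal K * (\<integral>\<^sup>+ t. \<rho> (g t) * indicator {a..b} t \<partial>lborel)"
proof -
  define F where "F = (\<lambda>x. \<rho> (arc_param x) * indicator {0..len b} x)"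
  have "arc_param \<in> measurable (restrict_space borel {0..len b}) (restrict_space borel D)"
    using arc_image D by (intro measurable_restrict_space2 borel_measurable_continuous_on_restrict continuous_arc)
      (auto simp: space_restrict_space)
  then have "(\<lambda>x. \<rho> (arc_param x)) \<in> borel_measurable (restrict_space borel {0..len b})"
    using \<rho> by (rule measurable_compose)
  then have [measurable]: "F \<in> borel_measurable borel"
    unfolding F_def by (subst (asm) borel_measurable_restrict_space_iff_ennreal) auto
  have liplen: "\<bar>len s - len t\<bar> \<le> K * \<bar>s - t\<bar>" if "s \<in> {a..b}" "t \<in> {a..b}" for s t
  proof -
    have *: "len t - len s \<le> K * (t - s)" if "a \<le> s" "s \<le> t" "t \<le> b" for s t
      using curve_length_sub[OF that] curve_length_Lipschitz[of s t g K] lip that K by (simp add: ennreal_le_iff)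
    show ?thesis
      using *[of s t] *[of t s] len_mono[of s t] len_mono[of t s] that by (cases "s \<le> t") auto
  qed
  have "line_integral_compact \<rho> g a b = (\<integral>\<^sup>+ x. F x * indicator (len ` {a..b}) x \<partial>lborel)"
    unfolding line_integral_compact_eq len_image F_def
    by (rule nn_integral_cong) (auto simp: indicator_def)
  also have "\<dots> \<le> ennreal K * (\<integral>\<^sup>+ t. F (len t) * indicator {a..b} t \<partial>lborel)"
    by (rule nn_integral_Lipschitz_image_le) (use K liplen in auto)
  also have "(\<integral>\<^sup>+ t. F (len t) * indicator {a..b} t \<partial>lborel) = (\<integral>\<^sup>+ t. \<rho> (g t) * indicator {a..b} t \<partial>lborel)"
    using len_image by (intro nn_integral_cong) (auto simp: F_def indicator_def arc_len)
  finally show ?thesis .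
qed

lemma line_integral_Lipschitz_le:
  assumes "K \<ge> 0" and lip: "\<And>s t. s \<in> {0..T} \<Longrightarrow> t \<in> {0..T} \<Longrightarrow> dist (f s) (f t) \<le> K * \<bar>s - t\<bar>"
    and D: "f ` {0..T} \<subseteq> D" and \<rho>: "\<rho> \<in> borel_measurable (restrict_space borel D)"
  shows "line_integral \<rho> ({0..T}, f) \<le> ennreal K * (\<integral>\<^sup>+ t. \<rho> (f t) * indicator {0..T} t \<partial>lborel)"
  unfolding line_integral_def
proof (rule SUP_least, clarsimp simp del: atLeastatMost_subset_iff)
  fix a b :: real assume ab: "a \<le> b" "{a..b} \<subseteq> {0..T}"
  have cont: "continuous_on {a..b} f"
    by (rule lipschitz_on_continuous_on, rule lipschitz_onI[of _ _ K]) (use lip ab assms(1) in \<open>auto simp: dist_real_def\<close>)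
  have "curve_length f a b \<le> ennreal (K * (b - a))"
    using ab by (intro curve_length_Lipschitz lip) auto
  then interpret rectifiable_arc f a b
    by unfold_locales (use ab cont in \<open>auto intro: le_less_trans\<close>)
  have "line_integral_compact \<rho> f a b \<le> ennreal K * (\<integral>\<^sup>+ t. \<rho> (f t) * indicator {a..b} t \<partial>lborel)"
    by (rule line_integral_compact_le[of _ D]) (use assms ab in auto)
  also have "\<dots> \<le> ennreal K * (\<integral>\<^sup>+ t. \<rho> (f t) * indicator {0..T} t \<partial>lborel)"
    using ab by (intro mult_left_mono nn_integral_mono) (auto simp: indicator_def)
  finally show "line_integral_compact \<rho> f a b \<le> ennreal K * (\<integral>\<^sup>+ t. \<rho> (f t) * indicator {0..T} t \<partial>lborel)" .
qed

text \<open>\<open>h\<close> along the arc length parametrization is 1-Lipschitz, so a density that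
  depends only on \<open>h\<close> collects at least its integral over the values that
  \<open>h\<close> takes on the curve. It will be used with \<open>h\<close> the distance from a
  centre.\<close>

lemma (in rectifiable_arc) line_integral_compact_ge:
  assumes h: "\<And>x y. \<bar>h x - h y\<bar> \<le> dist x y" and \<phi>: "\<phi> \<in> borel_measurable borel"
  shows "(\<integral>\<^sup>+ x. \<phi> x * indicator (h ` g ` {a..b}) x \<partial>lborel) \<le> line_integral_compact (\<lambda>y. \<phi> (h y)) g a b"
proof -
  have "arc_param ` {0..len b} = g ` {a..b}"
  proof
    show "g ` {a..b} \<subseteq> arc_param ` {0..len b}"
      using arc_len len_image by (metis image_eqI image_subsetI)
  qed (rule arc_image)
  then have "(\<integral>\<^sup>+ x. \<phi> x * indicator (h ` g ` {a..b}) x \<partial>lborel)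
    = (\<integral>\<^sup>+ x. \<phi> x * indicator ((\<lambda>x. h (arc_param x)) ` {0..len b}) x \<partial>lborel)"
    by (metis image_image)
  also have "\<dots> \<le> ennreal 1 * (\<integral>\<^sup>+ t. \<phi> (h (arc_param t)) * indicator {0..len b} t \<partial>lborel)"
  proof -
    have *: "\<bar>h (arc_param s) - h (arc_param t)\<bar> \<le> 1 * \<bar>s - t\<bar>" if "s \<in> {0..len b}" "t \<in> {0..len b}" for s t
      using order_trans[OF h dist_arc[OF that]] by simp
    show ?thesis
      by (rule nn_integral_Lipschitz_image_le[OF _ * \<phi>]) simp_all
  qed
  also have "\<dots> = line_integral_compact (\<lambda>y. \<phi> (h y)) g a b"
    unfolding line_integral_compact_eq by (simp add: mult.commute)
  finally show ?thesis .
qed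

section \<open>Weakly quasisymmetric maps into doubling spaces\<close>

lemma doubling_iterate:
  fixes X :: "'a::metric_space set"
  assumes "doubling X"
  obtains N :: nat where "\<And>k x r. x \<in> X \<Longrightarrow> r > 0 \<Longrightarrow>
    \<exists>C. finite C \<and> card C \<le> N ^ k \<and> C \<subseteq> X \<and> ball x (2 ^ k * r) \<inter> X \<subseteq> (\<Union>c\<in>C. ball c r)"
proof -
  obtain N where N: "\<And>x r. x \<in> X \<Longrightarrow> r > 0 \<Longrightarrow> \<exists>C. finite C \<and> card C \<le> N \<and> C \<subseteq> X \<and>
      ball x (2 * r) \<inter> X \<subseteq> (\<Union>c\<in>C. ball c r \<inter> X)"
    using assms unfolding doubling_def by metis
  have "\<exists>C. finite C \<and> card C \<le> N ^ k \<and> C \<subseteq> X \<and> ball x (2 ^ k * r) \<inter> X \<subseteq> (\<Union>c\<in>C. ball c r)"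
    if "x \<in> X" "r > 0" for k x r
    using that
  proof (induction k arbitrary: r)
    case 0
    then show ?case by (intro exI[of _ "{x}"]) auto
  next
    case (Suc k)
    have "\<exists>C. finite C \<and> card C \<le> N ^ k \<and> C \<subseteq> X \<and> ball x (2 ^ k * (2 * r)) \<inter> X \<subseteq> (\<Union>c\<in>C. ball c (2 * r))"
      by (rule Suc.IH) (use Suc.prems in auto)
    then obtain C where C: "finite C" "card C \<le> N ^ k" "C \<subseteq> X" "ball x (2 ^ k * (2 * r)) \<inter> X \<subseteq> (\<Union>c\<in>C. ball c (2 * r))"
      by blast
    have "\<forall>c\<in>C. \<exists>B. finite B \<and> card B \<le> N \<and> B \<subseteq> X \<and> ball c (2 * r) \<inter> X \<subseteq> (\<Union>b\<in>B. ball b r \<inter> X)"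
      using N C(3) Suc.prems by blast
    then obtain B where B: "\<And>c. c \<in> C \<Longrightarrow> finite (B c)" "\<And>c. c \<in> C \<Longrightarrow> card (B c) \<le> N" "\<And>c. c \<in> C \<Longrightarrow> B c \<subseteq> X"
      "\<And>c. c \<in> C \<Longrightarrow> ball c (2 * r) \<inter> X \<subseteq> (\<Union>b\<in>B c. ball b r \<inter> X)"
      by metis
    show ?case
    proof (intro exI[of _ "\<Union>c\<in>C. B c"] conjI)
      have "card (\<Union>c\<in>C. B c) \<le> (\<Sum>c\<in>C. card (B c))" by (rule card_UN_le[OF C(1)])
      also have "\<dots> \<le> card C * N" using B(2) sum_bounded_above[of C "\<lambda>c. card (B c)" N] by simp
      also have "\<dots> \<le> N ^ Suc k" using C(2) by (simp add: mult.commute)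
      finally show "card (\<Union>c\<in>C. B c) \<le> N ^ Suc k" .
      show "ball x (2 ^ Suc k * r) \<inter> X \<subseteq> (\<Union>c\<in>\<Union>c\<in>C. B c. ball c r)"
      proof
        fix y assume y: "y \<in> ball x (2 ^ Suc k * r) \<inter> X"
        then obtain c where "c \<in> C" "y \<in> ball c (2 * r)" using C(4) by (auto simp: ac_simps)
        then obtain b where "b \<in> B c" "y \<in> ball b r" using B(4)[of c] y by blast
        then show "y \<in> (\<Union>c\<in>\<Union>c\<in>C. B c. ball c r)" using \<open>c \<in> C\<close> by blast
      qed
    qed (use B C in auto)
  qed
  then show ?thesis by (rule that)
qed

text \<open>As \<open>\<beta> \<ge> 1\<close>, the maximum is the first power on
  \<open>[0, 1]\<close> and the second beyond 1. Inverting swaps the exponents, so the pieces of the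
  inverse are selected by a minimum.\<close>

lemma homeomorphism_max_powr:
  fixes \<beta> C :: real
  assumes \<beta>: "\<beta> \<ge> 1" and C: "C > 0"
  shows "homeomorphism {0..} {0..} (\<lambda>t. C * max (t powr (1 / \<beta>)) (t powr \<beta>))
    (\<lambda>s. min ((s / C) powr \<beta>) ((s / C) powr (1 / \<beta>)))"
proof -
  have pq: "0 < 1 / \<beta>" "1 / \<beta> \<le> \<beta>" "0 < \<beta>" using \<beta> order_trans[of "1 / \<beta>" 1 \<beta>] by auto
  have le1: "x powr \<beta> \<le> x powr (1 / \<beta>)" if "0 \<le> x" "x \<le> 1" for x :: real
    using powr_mono'[of "1 / \<beta>" \<beta> x] pq that by simp
  have ge1: "x powr (1 / \<beta>) \<le> x powr \<beta>" if "1 \<le> x" for x :: real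
    using powr_mono[of "1 / \<beta>" \<beta> x] pq that by simp
  have inv: "(x powr (1 / \<beta>)) powr \<beta> = x" "(x powr \<beta>) powr (1 / \<beta>) = x" if "0 \<le> x" for x :: real
    using that pq by (simp_all add: powr_powr)
  have p1: "x powr a \<le> 1" if "0 \<le> x" "x \<le> 1" "0 < a" for x a :: real
    using powr_mono2[of a x 1] that by simp
  have p2: "1 \<le> x powr a" if "1 \<le> x" "0 < a" for x a :: real
    using that by (simp add: ge_one_powr_ge_zero)
  show ?thesis
  proof (rule homeomorphismI)
    show "continuous_on {0..} (\<lambda>t. C * max (t powr (1 / \<beta>)) (t powr \<beta>))"
      using pq by (intro continuous_intros continuous_on_powr') auto
    show "continuous_on {0..} (\<lambda>s. min ((s / C) powr \<beta>) ((s / C) powr (1 / \<beta>)))"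
      using pq C by (intro continuous_intros continuous_on_powr') auto
    show "min ((C * max (x powr (1 / \<beta>)) (x powr \<beta>) / C) powr \<beta>) ((C * max (x powr (1 / \<beta>)) (x powr \<beta>) / C) powr (1 / \<beta>)) = x"
      if "x \<in> {0..}" for x
    proof (cases "x \<le> 1")
      case True
      have "max (x powr (1 / \<beta>)) (x powr \<beta>) = x powr (1 / \<beta>)" using le1[of x] True that by (simp add: max_absorb1)
      then show ?thesis using le1[of "x powr (1 / \<beta>)"] p1[of x "1 / \<beta>"] inv(1)[of x] True that C pq
        by simp
    next
      case False
      have "max (x powr (1 / \<beta>)) (x powr \<beta>) = x powr \<beta>" using ge1[of x] False by (simp add: max_absorb2)
      then show ?thesis using ge1[of "x powr \<beta>"] p2[of x \<beta>] inv(2)[of x] False C pq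
        by simp
    qed
    show "C * max (min ((s / C) powr \<beta>) ((s / C) powr (1 / \<beta>)) powr (1 / \<beta>)) (min ((s / C) powr \<beta>) ((s / C) powr (1 / \<beta>)) powr \<beta>) = s"
      if "s \<in> {0..}" for s
    proof -
      define y where "y = s / C"
      have y: "y \<ge> 0" "s = C * y" using that C by (auto simp: y_def)
      have "max (min (y powr \<beta>) (y powr (1 / \<beta>)) powr (1 / \<beta>)) (min (y powr \<beta>) (y powr (1 / \<beta>)) powr \<beta>) = y"
      proof (cases "y \<le> 1")
        case True
        have "min (y powr \<beta>) (y powr (1 / \<beta>)) = y powr \<beta>" using le1[of y] True y by (simp add: min_absorb1)
        then show ?thesis using le1[of "y powr \<beta>"] p1[of y \<beta>] inv(2)[of y] True y pq by simp
      next
        case False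
        have "min (y powr \<beta>) (y powr (1 / \<beta>)) = y powr (1 / \<beta>)" using ge1[of y] False by (simp add: min_absorb2)
        then show ?thesis using ge1[of "y powr (1 / \<beta>)"] p2[of y "1 / \<beta>"] inv(1)[of y] False pq by simp
      qed
      then show ?thesis using y(2) unfolding y_def[symmetric] by simp
    qed
  qed (use C in \<open>auto simp: le_max_iff_disj\<close>)
qed

text \<open>Turns a bound obtained by \<open>n\<close> doublings into a power of \<open>t\<close>:
  \<open>n\<close> is \<open>log 2 t\<close> rounded up, and the factor \<open>M\<close> pays for
  the rounding.\<close>

lemma power_bound_large:
  fixes M t :: real
  assumes "M \<ge> 1" "t \<ge> 1"
  obtains n :: nat where "t \<le> 2 ^ n" "M ^ n \<le> M * t powr (log 2 M)"
proof
  define n where "n = nat \<lceil>log 2 t\<rceil>"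
  have l: "0 \<le> log 2 t" using assms by simp
  have n: "log 2 t \<le> n" "n \<le> log 2 t + 1" using l unfolding n_def by linarith+
  have "t = 2 powr (log 2 t)" using assms by simp
  also have "\<dots> \<le> 2 powr n" using n by (intro powr_mono) auto
  finally show "t \<le> 2 ^ n" by (simp add: powr_realpow)
  have "M ^ n = M powr n" using assms by (simp add: powr_realpow)
  also have "\<dots> \<le> M powr (log 2 t + 1)" using n assms by (intro powr_mono) auto
  also have "\<dots> = M * M powr (log 2 t)" using assms by (simp add: powr_add)
  also have "M powr (log 2 t) = t powr (log 2 M)"
    using assms by (simp add: powr_def log_def)
  finally show "M ^ n \<le> M * t powr (log 2 M)" .
qed

lemma power_bound_small:
  fixes \<theta> t :: real
  assumes "0 < \<theta>" "\<theta> < 1" "0 < t" "t \<le> 1"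
  obtains n :: nat where "t \<le> \<theta> ^ n" "(1 / 2) ^ n \<le> 2 * t powr (log \<theta> (1 / 2))"
proof
  define n where "n = nat \<lfloor>log \<theta> t\<rfloor>"
  have l: "0 \<le> log \<theta> t" using assms by (simp add: log_def divide_nonpos_neg)
  have n: "n \<le> log \<theta> t" "log \<theta> t \<le> n + 1" using l unfolding n_def by linarith+
  have "t = \<theta> powr (log \<theta> t)" using assms by simp
  also have "\<dots> \<le> \<theta> powr n" using n assms by (intro powr_mono') auto
  finally show "t \<le> \<theta> ^ n" using assms by (simp add: powr_realpow)
  have "(1 / 2) ^ n = 2 * (1 / 2 :: real) powr (n + 1)" by (simp add: powr_add powr_realpow)
  also have "\<dots> \<le> 2 * (1 / 2) powr (log \<theta> t)" using n by (intro mult_left_mono powr_mono') auto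
  also have "(1 / 2 :: real) powr (log \<theta> t) = t powr (log \<theta> (1 / 2))"
    using assms by (simp add: powr_def log_def)
  finally show "(1 / 2 :: real) ^ n \<le> 2 * t powr (log \<theta> (1 / 2))" .
qed

locale weakly_quasisymmetric =
  fixes S :: "'b::real_normed_vector set" and X :: "'a::metric_space set" and u :: "'b \<Rightarrow> 'a" and H :: real
  assumes convex: "convex S" and image: "u ` S \<subseteq> X" and H: "H \<ge> 1"
    and weak: "\<And>z a b. z \<in> S \<Longrightarrow> a \<in> S \<Longrightarrow> b \<in> S \<Longrightarrow> dist z a \<le> dist z b \<Longrightarrow> dist (u z) (u a) \<le> H * dist (u z) (u b)"
begin

definition between :: "'b \<Rightarrow> 'b \<Rightarrow> real \<Rightarrow> 'b" where "between z a t = z + t *\<^sub>R (a - z)"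

lemma between_mem: "z \<in> S \<Longrightarrow> a \<in> S \<Longrightarrow> 0 \<le> t \<Longrightarrow> t \<le> 1 \<Longrightarrow> between z a t \<in> S"
  using convexD_alt[OF convex, of z a t] by (simp add: between_def algebra_simps)

lemma dist_between: "dist (between z a s) (between z a t) = \<bar>s - t\<bar> * dist z a"
proof -
  have "between z a s - between z a t = (s - t) *\<^sub>R (a - z)" by (simp add: between_def algebra_simps)
  then show ?thesis by (simp add: dist_norm norm_minus_commute)
qed

lemma between_0 [simp]: "between z a 0 = z" and between_1 [simp]: "between z a 1 = a"
  by (simp_all add: between_def)

lemma dist_between0: "dist z (between z a t) = \<bar>t\<bar> * dist z a"
  using dist_between[of z a 0 t] by simp

text \<open>Two centres are used: the first half of the segment is seen from \<open>z\<close>, the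
  second from its midpoint, which is equally far from \<open>z\<close> and \<open>a\<close> and lies
  in \<open>S\<close> by convexity.\<close>

lemma weak_double:
  assumes "z \<in> S" "a \<in> S" "b \<in> S" "dist z a \<le> 2 * dist z b"
  shows "dist (u z) (u a) \<le> (H + H\<^sup>2) * dist (u z) (u b)"
proof -
  define m where "m = between z a (1/2)"
  have m: "m \<in> S" using assms between_mem by (simp add: m_def)
  have "dist z m \<le> dist z b" using assms dist_between0[of z a "1/2"] by (simp add: m_def)
  then have 1: "dist (u z) (u m) \<le> H * dist (u z) (u b)" using weak assms m by blast
  have "dist m a = dist m z" using dist_between[of z a "1/2" 1] dist_between[of z a "1/2" 0] by (simp add: m_def)
  then have "dist (u m) (u a) \<le> H * dist (u m) (u z)" using weak assms m by (metis order_refl)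
  also have "\<dots> \<le> H * (H * dist (u z) (u b))" using 1 H by (simp add: dist_commute)
  finally show ?thesis using 1 dist_triangle[of "u z" "u a" "u m"] by (simp add: power2_eq_square algebra_simps)
qed

lemma weak_power:
  assumes "z \<in> S" "a \<in> S" "b \<in> S" "dist z a \<le> 2 ^ n * dist z b"
  shows "dist (u z) (u a) \<le> H * (H + H\<^sup>2) ^ n * dist (u z) (u b)"
  using assms
proof (induction n arbitrary: a)
  case 0
  then show ?case using weak by simp
next
  case (Suc n)
  define m where "m = between z a (1/2)"
  have m: "m \<in> S" using Suc.prems between_mem by (simp add: m_def)
  have dm: "dist z m = dist z a / 2" using dist_between0[of z a "1/2"] by (simp add: m_def)
  have "dist (u z) (u a) \<le> (H + H\<^sup>2) * dist (u z) (u m)"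
    using dm Suc.prems m by (intro weak_double) auto
  also have "\<dots> \<le> (H + H\<^sup>2) * (H * (H + H\<^sup>2) ^ n * dist (u z) (u b))"
    using dm Suc m H by (intro mult_left_mono Suc.IH) auto
  finally show ?case by (simp add: mult_ac)
qed

text \<open>The points at distance \<open>(1 / 3) ^ i * dist z b\<close> from \<open>z\<close> on the segment from \<open>z\<close> to \<open>b\<close> have images that are
  pairwise separated on the scale of the distance from \<open>u z\<close> to \<open>u a\<close>; doubling limits their number.\<close>

lemma weak_small:
  assumes "doubling X"
  obtains \<theta> where "0 < \<theta>" "\<theta> < 1" "\<And>z a b. z \<in> S \<Longrightarrow> a \<in> S \<Longrightarrow> b \<in> S \<Longrightarrow> dist z a \<le> \<theta> * dist z b \<Longrightarrow>
    dist (u z) (u a) \<le> dist (u z) (u b) / 2"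
proof -
  obtain N where N: "\<And>k x r. x \<in> X \<Longrightarrow> r > 0 \<Longrightarrow>
    \<exists>C. finite C \<and> card C \<le> N ^ k \<and> C \<subseteq> X \<and> ball x (2 ^ k * r) \<inter> X \<subseteq> (\<Union>c\<in>C. ball c r)"
    by (rule doubling_iterate[OF assms]) (rule that)
  \<comment> \<open>With \<open>r = R / (4 * H\<^sup>2)\<close> below, \<open>k\<close> doublings of
    \<open>r\<close> exceed \<open>H * R\<close>, the radius that contains all the points
    \<open>u (q i)\<close>.\<close>
  obtain k :: nat where k: "8 * H ^ 3 < 2 ^ k" using real_arch_pow[of 2 "8 * H ^ 3"] by auto
  define s where "s = Suc (N ^ k)"
  define \<theta> :: real where "\<theta> = (1 / 3) ^ s"
  show ?thesis
  proof (rule that)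
    show "0 < \<theta>" "\<theta> < 1" unfolding \<theta>_def s_def by (simp, intro power_Suc_less_one) auto
    fix z a b assume zab: "z \<in> S" "a \<in> S" "b \<in> S" and le: "dist z a \<le> \<theta> * dist z b"
    show "dist (u z) (u a) \<le> dist (u z) (u b) / 2"
    proof (rule ccontr)
      assume not: "\<not> ?thesis"
      define R where "R = dist (u z) (u b)"
      have neg: "R / 2 < dist (u z) (u a)" using not by (simp add: R_def)
      have R: "R > 0"
      proof (rule ccontr)
        assume "\<not> R > 0"
        then have "u z = u b" by (simp add: R_def)
        have "\<theta> * dist z b \<le> 1 * dist z b" using \<open>\<theta> < 1\<close> by (intro mult_right_mono) auto
        then have "dist (u z) (u a) \<le> H * dist (u z) (u b)" using le zab by (intro weak) auto
        then show False using neg \<open>u z = u b\<close> by (simp add: R_def)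
      qed
      define q where "q = (\<lambda>i::nat. between z b ((1 / 3) ^ i))"
      have q: "q i \<in> S" for i unfolding q_def by (intro between_mem zab) (auto simp: power_le_one)
      have dq: "dist z (q i) = (1 / 3) ^ i * dist z b" for i by (simp add: q_def dist_between0)
      have sep: "dist (u (q i)) (u (q j)) > R / (2 * H\<^sup>2)" if "i < j" "j \<le> s" for i j
      proof -
        have "\<theta> \<le> (1 / 3) ^ j" unfolding \<theta>_def using that by (intro power_decreasing) auto
        then have "dist z a \<le> dist z (q j)" unfolding dq using le
          by (meson mult_right_mono order_trans zero_le_dist)
        then have 1: "dist (u z) (u a) \<le> H * dist (u z) (u (q j))" using zab q by (intro weak) auto
        \<comment> \<open>The geometric spacing makes \<open>q j\<close> at least as far from the
          earlier point \<open>q i\<close> as from \<open>z\<close>, so the weak inequality can be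
          centred at \<open>q j\<close>.\<close>
        have "(1 / 3 :: real) ^ j \<le> (1 / 3) ^ Suc i" using that by (intro power_decreasing) auto
        then have "(1 / 3 :: real) ^ j * 3 \<le> (1 / 3) ^ i" by simp
        moreover have "0 \<le> (1 / 3 :: real) ^ j" by simp
        ultimately have "(1 / 3 :: real) ^ j \<le> (1 / 3) ^ i - (1 / 3) ^ j" by linarith
        then have "dist (q j) z \<le> dist (q j) (q i)"
          using dist_between[of z b "(1/3)^j" "(1/3)^i"] dq[of j] by (simp add: q_def dist_commute mult_right_mono)
        then have 2: "dist (u (q j)) (u z) \<le> H * dist (u (q j)) (u (q i))" using zab q by (intro weak) auto
        have "R / 2 < H * (H * dist (u (q i)) (u (q j)))"
        proof -
          have "H * dist (u z) (u (q j)) \<le> H * (H * dist (u (q i)) (u (q j)))"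
            using 2 H by (intro mult_left_mono) (auto simp: dist_commute)
          with neg 1 show ?thesis by linarith
        qed
        then show ?thesis using H by (simp add: field_simps power2_eq_square)
      qed
      have near: "dist (u z) (u (q i)) \<le> H * R" for i
      proof -
        have "(1 / 3) ^ i * dist z b \<le> 1 * dist z b" by (intro mult_right_mono) (auto simp: power_le_one)
        then show ?thesis unfolding R_def using zab q by (intro weak) (auto simp: dq)
      qed
      \<comment> \<open>Half of the separation, so that two of the points cannot share a ball of
        radius \<open>r\<close>; yet there are \<open>s + 1\<close> points and at most
        \<open>N ^ k = s - 1\<close> balls.\<close>
      define r where "r = R / (4 * H\<^sup>2)"
      have r: "r > 0" using R H by (simp add: r_def)
      obtain C where C: "finite C" "card C \<le> N ^ k" "ball (u z) (2 ^ k * r) \<inter> X \<subseteq> (\<Union>c\<in>C. ball c r)"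
        using N[of "u z" r k] r zab image by blast
      have "H * R < 2 ^ k * r"
      proof -
        have "H * R * (4 * H\<^sup>2) = 4 * H ^ 3 * R" by (simp add: power2_eq_square power3_eq_cube)
        also have "0 \<le> H ^ 3" using H by simp
        then have "4 * H ^ 3 < 2 ^ k" using k by linarith
        then have "4 * H ^ 3 * R < 2 ^ k * R" using R by (intro mult_strict_right_mono) auto
        finally show ?thesis using H by (simp add: r_def field_simps)
      qed
      then have "u (q i) \<in> ball (u z) (2 ^ k * r) \<inter> X" for i using near[of i] image q by auto
      then have "\<exists>c\<in>C. u (q i) \<in> ball c r" for i using C(3) by blast
      then obtain c where c: "\<And>i. c i \<in> C" "\<And>i. dist (c i) (u (q i)) < r" by (metis mem_ball)
      have "\<not> inj_on c {..s}"
      proof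
        assume "inj_on c {..s}"
        then have "card {..s} \<le> card C" using c(1) C(1) by (intro card_inj_on_le) auto
        then show False using C(2) by (simp add: s_def)
      qed
      then obtain i j where ij: "i < j" "j \<le> s" "c i = c j"
        unfolding inj_on_def by (metis atMost_iff linorder_neqE_nat)
      then have "dist (u (q i)) (u (q j)) < 2 * r" using c(2)[of i] c(2)[of j] dist_triangle2[of "u (q i)" "u (q j)" "c j"]
        by (simp add: dist_commute)
      also have "2 * r = R / (2 * H\<^sup>2)" by (simp add: r_def)
      finally show False using sep[OF ij(1,2)] by simp
    qed
  qed
qed

theorem quasisymmetric_if_doubling:
  assumes hom: "homeomorphism S X u v" and dbl: "doubling X"
  shows "quasisymmetric S X u"
proof -
  obtain \<theta> where \<theta>: "0 < \<theta>" "\<theta> < 1" and small: "\<And>z a b. z \<in> S \<Longrightarrow> a \<in> S \<Longrightarrow> b \<in> S \<Longrightarrow> dist z a \<le> \<theta> * dist z b \<Longrightarrow>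
    dist (u z) (u a) \<le> dist (u z) (u b) / 2"
    using weak_small[OF dbl] by blast
  have small_power: "dist (u z) (u a) \<le> H * (1 / 2) ^ n * dist (u z) (u b)"
    if "z \<in> S" "a \<in> S" "b \<in> S" "dist z a \<le> \<theta> ^ n * dist z b" for z a b n
    using that
  proof (induction n arbitrary: b)
    case 0
    then show ?case using weak by simp
  next
    case (Suc n)
    define m where "m = between z b \<theta>"
    have m: "m \<in> S" using Suc.prems between_mem \<theta> by (simp add: m_def)
    have dm: "dist z m = \<theta> * dist z b" using dist_between0[of z b \<theta>] \<theta> by (simp add: m_def)
    have "dist (u z) (u a) \<le> H * (1 / 2) ^ n * dist (u z) (u m)"
      using dm Suc m by (intro Suc.IH) (auto simp: mult_ac)
    also have "\<dots> \<le> H * (1 / 2) ^ n * (dist (u z) (u b) / 2)"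
      using dm Suc.prems m H by (intro mult_left_mono small) auto
    finally show ?case by (simp add: mult_ac)
  qed
  define M where "M = H + H\<^sup>2"
  have M: "M \<ge> 1" using H by (simp add: M_def add_increasing2)
  define \<alpha> where "\<alpha> = log \<theta> (1 / 2)"
  have \<alpha>: "\<alpha> > 0" using \<theta> divide_neg_neg[of "ln (1 / 2)" "ln \<theta>"] by (simp add: \<alpha>_def log_def)
  \<comment> \<open>One exponent for both regimes: \<open>1 / \<beta>\<close> lies below the decay
    exponent \<open>\<alpha>\<close> for \<open>t \<le> 1\<close>, and \<open>\<beta>\<close> above
    the growth exponent \<open>log 2 M\<close> for \<open>t \<ge> 1\<close>. The constant
    \<open>C\<close> then absorbs the prefactors \<open>2 * H\<close> and \<open>H * M\<close> of
    the two regimes.\<close>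
  define \<beta> where "\<beta> = max 1 (max (log 2 M) (1 / \<alpha>))"
  have \<beta>: "\<beta> \<ge> 1" "\<beta> \<ge> log 2 M" "1 / \<alpha> \<le> \<beta>"
    by (auto simp: \<beta>_def)
  then have \<beta>\<alpha>: "1 / \<beta> \<le> \<alpha>" using \<alpha> by (simp add: field_simps)
  define C where "C = 2 * H * M"
  have C: "C > 0" using H M by (simp add: C_def)
  let ?\<eta> = "\<lambda>t. C * max (t powr (1 / \<beta>)) (t powr \<beta>)"
  have "dist (u z) (u a) \<le> ?\<eta> t * dist (u z) (u b)"
    if zab: "z \<in> S" "a \<in> S" "b \<in> S" and t: "t \<ge> 0" "dist z a \<le> t * dist z b" for z a b t
  proof -
    consider "t = 0" | "0 < t" "t \<le> 1" | "1 \<le> t" using t by linarith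
    then show ?thesis
    proof cases
      case 1
      then show ?thesis using t by simp
    next
      case 2
      obtain n where n: "t \<le> \<theta> ^ n" "(1 / 2) ^ n \<le> 2 * t powr \<alpha>"
        using power_bound_small[OF \<theta> 2] unfolding \<alpha>_def by blast
      have "dist z a \<le> \<theta> ^ n * dist z b" using t n by (meson mult_right_mono order_trans zero_le_dist)
      then have "dist (u z) (u a) \<le> H * (1 / 2) ^ n * dist (u z) (u b)" using small_power zab by blast
      also have "H * (1 / 2) ^ n \<le> ?\<eta> t"
      proof -
        have "H * (1 / 2) ^ n \<le> H * (2 * t powr \<alpha>)" using n H by (intro mult_left_mono) auto
        also have "\<dots> = (2 * H * 1) * t powr \<alpha>" by simp
        also have "\<dots> \<le> C * max (t powr (1 / \<beta>)) (t powr \<beta>)" unfolding C_def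
          using H M powr_mono'[of "1 / \<beta>" \<alpha> t] 2 \<beta> \<beta>\<alpha> by (intro mult_mono) (auto simp: le_max_iff_disj)
        finally show ?thesis .
      qed
      finally show ?thesis by (simp add: mult_right_mono)
    next
      case 3
      obtain n where n: "t \<le> 2 ^ n" "M ^ n \<le> M * t powr (log 2 M)"
        using power_bound_large[OF M 3] by blast
      have "dist z a \<le> 2 ^ n * dist z b" using t n by (meson mult_right_mono order_trans zero_le_dist)
      then have "dist (u z) (u a) \<le> H * M ^ n * dist (u z) (u b)" using weak_power zab unfolding M_def by blast
      also have "H * M ^ n \<le> ?\<eta> t"
      proof -
        have "H * M ^ n \<le> H * (M * t powr (log 2 M))" using n H by (intro mult_left_mono) auto
        also have "\<dots> = (H * M) * t powr (log 2 M)" by simp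
        also have "\<dots> \<le> C * max (t powr (1 / \<beta>)) (t powr \<beta>)" unfolding C_def
          using H M powr_mono[of "log 2 M" \<beta> t] 3 \<beta> by (intro mult_mono) (auto simp: le_max_iff_disj)
        finally show ?thesis .
      qed
      finally show ?thesis by (simp add: mult_right_mono)
    qed
  qed
  then show ?thesis unfolding quasisymmetric_def
    using hom homeomorphism_max_powr[OF \<beta>(1) C] by blast
qed

end

section \<open>Consequences of quasisymmetry\<close>

text \<open>If \<open>\<eta>\<close> vanished at some \<open>t > 0\<close>, small positive values
  would be taken on both sides of \<open>t\<close>, against injectivity. Together with continuity
  this makes \<open>\<eta>\<close> small near 0.\<close>

lemma homeomorphism_halfline_zero:
  fixes \<eta> :: "real \<Rightarrow> real"
  assumes "homeomorphism {0..} {0..} \<eta> \<eta>'"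
  shows "\<eta> 0 = 0"
proof (rule ccontr)
  assume ne: "\<eta> 0 \<noteq> 0"
  define t where "t = \<eta>' 0"
  have cont: "continuous_on {0..} \<eta>" and img: "\<eta> ` {0..} = {0..}"
    and inv: "\<And>x. x \<ge> 0 \<Longrightarrow> \<eta>' (\<eta> x) = x"
    using assms by (auto simp: homeomorphism_def)
  have t: "t \<ge> 0" "\<eta> t = 0" using assms unfolding t_def homeomorphism_def by (auto simp: image_iff)
  have nonneg: "\<eta> x \<ge> 0" if "x \<ge> 0" for x using img that by auto
  have pos: "\<eta> x > 0" if "x \<ge> 0" "x \<noteq> t" for x
    using nonneg[OF that(1)] inv[OF that(1)] inv[OF t(1)] t that by (metis less_eq_real_def)
  have "t > 0" using t ne by (cases "t = 0") auto
  define y where "y = min (\<eta> 0) (\<eta> (t + 1))"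
  have y: "y > 0" using pos[of 0] pos[of "t + 1"] t \<open>t > 0\<close> by (simp add: y_def)
  obtain x1 where x1: "0 \<le> x1" "x1 \<le> t" "\<eta> x1 = y"
    using IVT2'[of \<eta> t y 0] t y continuous_on_subset[OF cont, of "{0..t}"] by (auto simp: y_def)
  obtain x2 where x2: "t \<le> x2" "x2 \<le> t + 1" "\<eta> x2 = y"
    using IVT'[of \<eta> t y "t + 1"] t y continuous_on_subset[OF cont, of "{t..t+1}"] by (auto simp: y_def)
  have "x1 = x2" using inv[of x1] inv[of x2] x1 x2 t by simp
  then have "x1 = t" using x1 x2 by simp
  then show False using x1 y t by simp
qed

text \<open>Rescaling to the unit ball makes the bound independent of \<open>p\<close> and
  \<open>R\<close>: the points of \<open>P\<close> fall into distinct members of one fixed cover by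
  balls of radius \<open>\<epsilon> / 2\<close>.\<close>

lemma separated_card_bound:
  fixes \<epsilon> :: real
  assumes "\<epsilon> > 0"
  shows "\<exists>N::nat. \<forall>(p::'b::euclidean_space) R P. R > 0 \<longrightarrow> P \<subseteq> cball p R \<longrightarrow>
     (\<forall>x\<in>P. \<forall>y\<in>P. x \<noteq> y \<longrightarrow> \<epsilon> * R \<le> dist x y) \<longrightarrow> card P \<le> N"
proof -
  obtain K where K: "finite K" "cball (0::'b) 1 \<subseteq> (\<Union>x\<in>K. ball x (\<epsilon> / 2))"
    using compact_cball[of "0::'b" 1] assms by (metis compact_eq_totally_bounded half_gt_zero)
  have "card P \<le> card K" if R: "R > 0" and P: "P \<subseteq> cball p R"
     and sep: "\<forall>x\<in>P. \<forall>y\<in>P. x \<noteq> y \<longrightarrow> \<epsilon> * R \<le> dist x y" for p :: 'b and R P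
  proof -
    have "\<exists>k\<in>K. dist k ((q - p) /\<^sub>R R) < \<epsilon> / 2" if "q \<in> P" for q
    proof -
      have "(q - p) /\<^sub>R R \<in> cball 0 1"
      proof -
        have "norm ((q - p) /\<^sub>R R) = dist p q / R"
          using R by (simp add: dist_norm norm_minus_commute divide_inverse_commute)
        then show ?thesis using P that R by (auto simp: subset_iff)
      qed
      then obtain k where "k \<in> K" "(q - p) /\<^sub>R R \<in> ball k (\<epsilon> / 2)" using K(2) by blast
      then show ?thesis by auto
    qed
    then obtain c where c: "\<And>q. q \<in> P \<Longrightarrow> c q \<in> K" "\<And>q. q \<in> P \<Longrightarrow> dist (c q) ((q - p) /\<^sub>R R) < \<epsilon> / 2"
      by metis
    have "inj_on c P"
    proof (rule inj_onI, rule ccontr)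
      fix x y assume xy: "x \<in> P" "y \<in> P" "c x = c y" "x \<noteq> y"
      have "dist ((x - p) /\<^sub>R R) ((y - p) /\<^sub>R R) < \<epsilon>"
        using c(2)[OF xy(1)] c(2)[OF xy(2), folded xy(3)] dist_triangle3[of "(x - p) /\<^sub>R R" "(y - p) /\<^sub>R R" "c x"] by linarith
      also have "dist ((x - p) /\<^sub>R R) ((y - p) /\<^sub>R R) = dist x y / R"
        using R by (simp add: dist_norm divide_inverse_commute flip: scaleR_diff_right)
      finally show False using sep[rule_format, OF xy(1,2,4)] R by (simp add: field_simps)
    qed
    then show ?thesis using c(1) K(1) by (intro card_inj_on_le) auto
  qed
  then show ?thesis by blast
qed

text \<open>The preimages of a separated set are separated on their own scale, the largest distance
  \<open>R\<close> from \<open>v x\<close>, and a Euclidean ball holds a bounded number of such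
  points. A separated set of largest size then provides the centres of the cover.\<close>

lemma quasisymmetric_imp_doubling:
  fixes S :: "'b::euclidean_space set" and X :: "'a::metric_space set"
  assumes "quasisymmetric S X u"
  shows "doubling X"
proof -
  obtain v \<eta> \<eta>' where hom: "homeomorphism S X u v" and \<eta>: "homeomorphism {0::real..} {0..} \<eta> \<eta>'"
    and qs: "\<And>z a b t. z \<in> S \<Longrightarrow> a \<in> S \<Longrightarrow> b \<in> S \<Longrightarrow> t \<ge> 0 \<Longrightarrow> dist z a \<le> t * dist z b \<Longrightarrow>
       dist (u z) (u a) \<le> \<eta> t * dist (u z) (u b)"
    using assms unfolding quasisymmetric_def by blast
  have vS: "v y \<in> S" and uv: "u (v y) = y" if "y \<in> X" for y
    using hom that unfolding homeomorphism_def by auto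
  have cont: "continuous_on {0..} \<eta>" using \<eta> by (simp add: homeomorphism_def)
  \<comment> \<open>Points of \<open>ball x (2 * r)\<close> are less than \<open>4 * r\<close>
    apart, so a factor below \<open>1 / 4\<close> would push two points of a separated set closer
    than \<open>r\<close>.\<close>
  obtain \<delta> where \<delta>': "\<delta> > 0" "\<And>t. t \<in> {0..} \<Longrightarrow> dist t 0 < \<delta> \<Longrightarrow> dist (\<eta> t) (\<eta> 0) < 1 / 4"
    using continuous_on_iff[THEN iffD1, OF cont, rule_format, of 0 "1 / 4"] by auto
  have \<delta>: "\<delta> > 0" "\<And>t. t \<ge> 0 \<Longrightarrow> t < \<delta> \<Longrightarrow> \<bar>\<eta> t\<bar> < 1 / 4"
    using \<delta>' homeomorphism_halfline_zero[OF \<eta>] by (auto simp: dist_real_def)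
  obtain N where N: "\<And>(p::'b) R P. R > 0 \<Longrightarrow> P \<subseteq> cball p R \<Longrightarrow>
     \<forall>x\<in>P. \<forall>y\<in>P. x \<noteq> y \<longrightarrow> \<delta> / 2 * R \<le> dist x y \<Longrightarrow> card P \<le> N"
    using separated_card_bound[OF half_gt_zero[OF \<delta>(1)]] by metis
  have sepbound: "card Z \<le> max 1 N" if x: "x \<in> X" and r: "r > 0" and Z: "finite Z" "Z \<subseteq> ball x (2 * r) \<inter> X"
    and sep: "\<And>y z. y \<in> Z \<Longrightarrow> z \<in> Z \<Longrightarrow> y \<noteq> z \<Longrightarrow> r \<le> dist y z" for x r Z
  proof (cases "card Z \<le> 1")
    case False
    then have "Z \<noteq> {}" by auto
    define R where "R = Max ((\<lambda>z. dist (v x) (v z)) ` Z)"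
    have Rge: "dist (v x) (v z) \<le> R" if "z \<in> Z" for z
      using Z that by (simp add: R_def)
    obtain m where m: "m \<in> Z" "R = dist (v x) (v m)"
    proof -
      have "R \<in> (\<lambda>z. dist (v x) (v z)) ` Z" unfolding R_def using Z \<open>Z \<noteq> {}\<close> by (intro Max_in) auto
      then show ?thesis using that by blast
    qed
    have inj: "inj_on v Z" using Z uv by (metis Int_iff inj_on_def subset_iff)
    have R: "R > 0"
    proof (rule ccontr)
      assume "\<not> R > 0"
      then have "\<forall>z\<in>Z. v z = v x" using Rge by (metis dist_le_zero_iff dist_commute not_less order_trans)
      then have "Z \<subseteq> {x}" using uv x Z by (metis Int_iff insertI1 subset_iff)
      then show False using False card_mono[of "{x}" Z] by simp
    qed
    have "card (v ` Z) \<le> N"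
    proof (rule N[OF R], goal_cases)
      case 2
      show ?case
      proof (intro ballI impI)
        fix p q assume "p \<in> v ` Z" "q \<in> v ` Z" "p \<noteq> q"
        then obtain y z where yz: "y \<in> Z" "z \<in> Z" "p = v y" "q = v z" "y \<noteq> z" by auto
        have yzX: "y \<in> X" "z \<in> X" "m \<in> X" using yz Z m by auto
        \<comment> \<open>\<open>v x\<close> and \<open>v m\<close> are \<open>R\<close> apart, so
          one of them is at least \<open>R / 2\<close> away from \<open>p\<close>; it serves as the
          point of comparison.\<close>
        have "\<exists>w\<in>{x, m}. R / 2 \<le> dist p (v w)"
          using dist_triangle2[of "v x" "v m" p] m by (auto simp: dist_commute)
        then obtain w where w: "w \<in> {x, m}" "R / 2 \<le> dist p (v w)" by blast
        have wX: "w \<in> X" using w x yzX by auto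
        show "\<delta> / 2 * R \<le> dist p q"
        proof (rule ccontr)
          assume less: "\<not> ?thesis"
          define t where "t = dist p q / dist p (v w)"
          have pos: "dist p (v w) > 0" using w R by linarith
          have t0: "t \<ge> 0" by (simp add: t_def)
          have "dist p q < \<delta> * dist p (v w)"
          proof -
            have "\<delta> / 2 * R = \<delta> * (R / 2)" by simp
            also have "\<dots> \<le> \<delta> * dist p (v w)" using w(2) \<delta>(1) by (intro mult_left_mono) auto
            finally show ?thesis using less by linarith
          qed
          then have "t < \<delta>" using pos by (simp add: t_def field_simps)
          then have \<eta>t: "\<eta> t \<le> 1 / 4" using \<delta>(2)[OF t0] by simp
          have "r \<le> dist y z" using sep yz by blast
          also have "\<dots> \<le> \<eta> t * dist y w"
            using qs[of p q "v w" t] pos yz yzX wX vS uv t0 by (simp add: t_def)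
          also have "\<dots> \<le> 1 / 4 * dist y w" using \<eta>t by (intro mult_right_mono) auto
          also have "dist y w < 4 * r"
          proof -
            have "dist x y < 2 * r" "dist x w < 2 * r" using Z yz(1) w m r by auto
            then show ?thesis using dist_triangle3[of y w x] by linarith
          qed
          finally show False by simp
        qed
      qed
    qed (use Rge in auto)
    then show ?thesis using card_image[OF inj] by simp
  qed simp
  show ?thesis unfolding doubling_def
  proof (intro exI[of _ "max 1 N"] ballI allI impI)
    fix x r assume x: "x \<in> X" and r: "(r::real) > 0"
    define P where "P = (\<lambda>Z. finite Z \<and> Z \<subseteq> ball x (2 * r) \<inter> X \<and> (\<forall>y\<in>Z. \<forall>z\<in>Z. y \<noteq> z \<longrightarrow> r \<le> dist y z))"
    have "P {}" by (simp add: P_def)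
    moreover have bd: "\<forall>Z. P Z \<longrightarrow> card Z \<le> max 1 N" using sepbound[OF x r] by (simp add: P_def)
    ultimately obtain C where C: "P C" "\<And>Z. P Z \<Longrightarrow> card Z \<le> card C"
      using ex_has_greatest_nat[of P "{}" card "Suc (max 1 N)"] by (auto simp: less_Suc_eq_le)
    have "\<exists>c\<in>C. y \<in> ball c r" if y: "y \<in> ball x (2 * r) \<inter> X" for y
    proof (rule ccontr)
      assume no: "\<not> ?thesis"
      then have "y \<notin> C" using r by auto
      have "P (insert y C)" using C(1) y no unfolding P_def by (auto simp: not_less dist_commute)
      from C(2)[OF this] show False using C(1) \<open>y \<notin> C\<close> by (simp add: P_def)
    qed
    then show "\<exists>C. finite C \<and> card C \<le> max 1 N \<and> C \<subseteq> X \<and> ball x (2 * r) \<inter> X \<subseteq> (\<Union>c\<in>C. ball c r \<inter> X)"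
      using C(1) bd by (intro exI[of _ C]) (auto simp: P_def)
  qed
qed

text \<open>A detour around \<open>p\<close> from \<open>a\<close> to \<open>b\<close> follows the legs of the isosceles right triangle over the
  hypotenuse \<open>[a, b]\<close>. Of the two possible apexes, the one nearer to the centre lies in the disc, by
  the parallelogram law.\<close>

lemma Thales_segment_far:
  fixes e n :: "'b::real_inner"
  assumes "e \<bullet> n = 0" "norm n = norm e"
  shows "norm ((2 * \<tau>) *\<^sub>R e) ^ 2 \<le> 2 * norm ((2 * \<tau>) *\<^sub>R e - t *\<^sub>R (e + n)) ^ 2"
proof -
  have nn: "n \<bullet> n = e \<bullet> e" "n \<bullet> e = 0" using assms by (auto simp: norm_eq_sqrt_inner inner_commute)
  have eq1: "norm ((2 * \<tau>) *\<^sub>R e - t *\<^sub>R (e + n)) ^ 2 = ((2 * \<tau> - t)\<^sup>2 + t\<^sup>2) * (e \<bullet> e)"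
    unfolding power2_norm_eq_inner
    by (simp add: inner_diff_left inner_diff_right inner_add_left inner_add_right nn assms(1) power2_eq_square algebra_simps)
  have eq2: "norm ((2 * \<tau>) *\<^sub>R e) ^ 2 = 4 * \<tau>\<^sup>2 * (e \<bullet> e)"
    unfolding power2_norm_eq_inner by (simp add: power2_eq_square)
  have "4 * \<tau>\<^sup>2 \<le> 2 * ((2 * \<tau> - t)\<^sup>2 + t\<^sup>2)"
    using zero_le_power2[of "\<tau> - t"] by (simp add: power2_eq_square algebra_simps)
  then have "4 * \<tau>\<^sup>2 * (e \<bullet> e) \<le> 2 * ((2 * \<tau> - t)\<^sup>2 + t\<^sup>2) * (e \<bullet> e)"
    by (rule mult_right_mono) simp
  then show ?thesis unfolding eq1 eq2 by (simp only: mult.assoc)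
qed

lemma perpendicular_exists:
  fixes e :: "real^2"
  obtains n :: "real^2" where "e \<bullet> n = 0" "norm n = norm e"
proof
  let ?n = "(\<chi> i. if i = 1 then - (e $ 2) else e $ 1) :: real^2"
  show "e \<bullet> ?n = 0" by (simp add: inner_vec_def sum_2)
  show "norm ?n = norm e" by (simp add: norm_eq_sqrt_inner inner_vec_def sum_2)
qed

lemma disc_detour:
  fixes a b p :: "real^2"
  assumes D: "a \<in> cball 0 1" "b \<in> cball 0 1" and far: "\<rho> \<le> dist p a" "\<rho> \<le> dist p b" and "\<rho> > 0"
  obtains K where "continuum_joining K a b" "K \<subseteq> cball 0 1" "\<And>w. w \<in> K \<Longrightarrow> \<rho> / 4 \<le> dist p w"
proof (cases "\<forall>w\<in>closed_segment a b. \<rho> / 4 \<le> dist p w")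
  case True
  then show ?thesis
    by (intro that[of "closed_segment a b"]) (use D closed_segment_subset[OF D convex_cball] in \<open>auto simp: continuum_joining_def\<close>)
next
  case False
  then obtain q where q: "q \<in> closed_segment a b" "dist p q < \<rho> / 4" by auto
  then obtain \<tau> where \<tau>: "0 \<le> \<tau>" "\<tau> \<le> 1" "q = (1 - \<tau>) *\<^sub>R a + \<tau> *\<^sub>R b" by (auto simp: closed_segment_def)
  define e where "e = (1 / 2) *\<^sub>R (b - a)"
  define m where "m = (1 / 2) *\<^sub>R (a + b)"
  obtain n' where n': "e \<bullet> n' = 0" "norm n' = norm e" by (rule perpendicular_exists)
  define n where "n = (if m \<bullet> n' \<le> 0 then n' else - n')"
  have n: "e \<bullet> n = 0" "norm n = norm e" "m \<bullet> n \<le> 0" using n' by (auto simp: n_def)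
  define c where "c = m + n"
  have "norm c ^ 2 = norm m ^ 2 + norm e ^ 2 + 2 * (m \<bullet> n)"
  proof -
    have "n \<bullet> n = e \<bullet> e" using n(2) by (simp add: norm_eq_sqrt_inner)
    then show ?thesis
      unfolding c_def power2_norm_eq_inner by (simp add: inner_add_left inner_add_right inner_commute)
  qed
  also have "\<dots> \<le> norm m ^ 2 + norm e ^ 2" using n by simp
  also have "\<dots> = (norm a ^ 2 + norm b ^ 2) / 2"
    unfolding m_def e_def power2_norm_eq_inner
    by (simp add: inner_add_left inner_add_right inner_diff_left inner_diff_right inner_commute field_simps)
  also have "\<dots> \<le> 1" using D power_mono[of "norm a" 1 2] power_mono[of "norm b" 1 2] by simp
  finally have c: "c \<in> cball 0 1" by (simp add: abs_square_le_1)
  \<comment> \<open>A leg makes an angle of 45 degrees with the hypotenuse, so its points are at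
    least \<open>dist q z / sqrt 2\<close> away from \<open>q\<close>, where \<open>z\<close> is the
    common endpoint. As \<open>dist q z \<ge> 3 / 4 * \<rho>\<close>, this exceeds
    \<open>\<rho> / 2\<close>, and \<open>p\<close> is within \<open>\<rho> / 4\<close> of
    \<open>q\<close>.\<close>
  have key: "\<rho> / 4 \<le> dist p (z + t *\<^sub>R (f + n))" if z: "\<rho> \<le> dist p z" and qz: "q - z = (2 * s) *\<^sub>R f" and f: "f = e \<or> f = - e" for z f s t
  proof -
    have fn: "f \<bullet> n = 0" "norm n = norm f" using n f by auto
    have "3 / 4 * \<rho> \<le> norm (q - z)" using z q(2) dist_triangle[of p z q] by (simp add: dist_norm)
    then have "(3 / 4 * \<rho>)\<^sup>2 \<le> norm (q - z) ^ 2" using \<open>\<rho> > 0\<close> by (intro power_mono) auto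
    also have "\<dots> \<le> 2 * norm (q - z - t *\<^sub>R (f + n)) ^ 2"
      unfolding qz by (rule Thales_segment_far[OF fn])
    moreover have "(\<rho> / 2)\<^sup>2 \<le> (3 / 4 * \<rho>)\<^sup>2 / 2"
      by (simp add: power2_eq_square)
    ultimately have "(\<rho> / 2)\<^sup>2 \<le> norm (q - z - t *\<^sub>R (f + n)) ^ 2"
      by linarith
    then have "\<rho> / 2 \<le> norm (q - z - t *\<^sub>R (f + n))" by (rule power2_le_imp_le) simp
    also have "\<dots> = dist q (z + t *\<^sub>R (f + n))" by (simp add: dist_norm algebra_simps)
    finally show ?thesis using q(2) dist_triangle3[of q "z + t *\<^sub>R (f + n)" p] by linarith
  qed
  have ca: "c - a = e + n" and cb: "c - b = - e + n"
    by (simp_all add: c_def m_def e_def vec_eq_iff field_simps)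
  let ?K = "closed_segment a c \<union> closed_segment c b"
  show ?thesis
  proof (rule that[of ?K])
    show "continuum_joining ?K a b"
      by (auto simp: continuum_joining_def intro!: connected_Un)
    show "?K \<subseteq> cball 0 1" using closed_segment_subset[OF D(1) c convex_cball] closed_segment_subset[OF c D(2) convex_cball] by blast
    fix w assume "w \<in> ?K"
    then consider "w \<in> closed_segment a c" | "w \<in> closed_segment b c" by (auto simp: closed_segment_commute)
    then show "\<rho> / 4 \<le> dist p w"
    proof cases
      case 1
      then obtain t where "w = (1 - t) *\<^sub>R a + t *\<^sub>R c" by (auto simp: closed_segment_def)
      then have w: "w = a + t *\<^sub>R (e + n)"
        unfolding ca[symmetric] by (simp add: algebra_simps)
      show ?thesis unfolding w by (rule key[OF far(1), of \<tau>]) (simp_all add: \<tau>(3) e_def algebra_simps)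
    next
      case 2
      then obtain t where "w = (1 - t) *\<^sub>R b + t *\<^sub>R c" by (auto simp: closed_segment_def)
      then have w: "w = b + t *\<^sub>R (- e + n)"
        unfolding cb[symmetric] by (simp add: algebra_simps)
      show ?thesis unfolding w by (rule key[OF far(2), of "1 - \<tau>"]) (simp_all add: \<tau>(3) e_def algebra_simps)
    qed
  qed
qed

text \<open>Inside a ball, the preimages are joined through \<open>v x\<close> by two segments whose
  points are no farther from \<open>v x\<close> than the respective endpoint, which costs the factor
  \<open>\<eta> 1\<close>. Outside, the detour comes at most four times closer to \<open>v x\<close>
  than the nearer endpoint, which costs \<open>\<eta> 4\<close>.\<close>

lemma quasisymmetric_disc_imp_LLC:
  fixes X :: "'a::metric_space set" and u :: "real^2 \<Rightarrow> 'a"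
  assumes "quasisymmetric (cball 0 1) X u"
  shows "linearly_locally_connected X"
proof -
  let ?D = "cball (0::real^2) 1"
  obtain v \<eta> \<eta>' where hom: "homeomorphism ?D X u v" and \<eta>: "homeomorphism {0::real..} {0..} \<eta> \<eta>'"
    and qs: "\<And>z a b t. z \<in> ?D \<Longrightarrow> a \<in> ?D \<Longrightarrow> b \<in> ?D \<Longrightarrow> t \<ge> 0 \<Longrightarrow> dist z a \<le> t * dist z b \<Longrightarrow>
       dist (u z) (u a) \<le> \<eta> t * dist (u z) (u b)"
    using assms unfolding quasisymmetric_def by blast
  have vS: "v y \<in> ?D" and uv: "u (v y) = y" if "y \<in> X" for y
    using hom that unfolding homeomorphism_def by auto
  have cont: "continuous_on ?D u" and img: "u ` ?D = X" using hom by (auto simp: homeomorphism_def)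
  have join: "continuum_joining (u ` K) y z" "u ` K \<subseteq> X"
    if "continuum_joining K (v y) (v z)" "K \<subseteq> ?D" "y \<in> X" "z \<in> X" for K y z
  proof -
    have "continuous_on K u" using cont that by (rule_tac continuous_on_subset)
    moreover have "y \<in> u ` K" "z \<in> u ` K" using that uv unfolding continuum_joining_def by (metis image_eqI)+
    ultimately show "continuum_joining (u ` K) y z" using that
      unfolding continuum_joining_def by (blast intro: compact_continuous_image connected_continuous_image)
    show "u ` K \<subseteq> X" using that img by blast
  qed
  define lam where "lam = max 1 (max (\<eta> 1) (\<eta> 4))"
  have lam: "lam \<ge> 1" "lam \<ge> \<eta> 1" "lam \<ge> \<eta> 4" by (auto simp: lam_def)
  show ?thesis unfolding linearly_locally_connected_def
  proof (intro exI[of _ lam] conjI ballI allI impI)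
    fix x r y z assume x: "x \<in> X" and r: "(r::real) > 0" and y: "y \<in> ball x r \<inter> X" and z: "z \<in> ball x r \<inter> X"
    let ?K = "closed_segment (v x) (v y) \<union> closed_segment (v x) (v z)"
    have KD: "?K \<subseteq> ?D" using closed_segment_subset[OF vS[OF x] vS convex_cball] y z by blast
    have K: "continuum_joining ?K (v y) (v z)"
      by (auto simp: continuum_joining_def intro!: connected_Un)
    have seg: "dist x (u w) < lam * r" if "w \<in> closed_segment (v x) (v y')" "y' \<in> ball x r \<inter> X" for w y'
    proof -
      have "w \<in> ?D" using that closed_segment_subset[OF vS[OF x] vS[of y'] convex_cball] by blast
      moreover have "dist (v x) w \<le> 1 * dist (v x) (v y')"
        using that(1) segment_bound1[of w "v x" "v y'"] by (simp add: dist_norm norm_minus_commute)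
      ultimately have "dist x (u w) \<le> \<eta> 1 * dist x y'"
        using qs[of "v x" w "v y'" 1] vS uv x that by auto
      also have "\<dots> \<le> lam * dist x y'" using lam by (intro mult_right_mono) auto
      also have "\<dots> < lam * r" using that lam by (intro mult_strict_left_mono) auto
      finally show ?thesis .
    qed
    show "\<exists>K. continuum_joining K y z \<and> K \<subseteq> ball x (lam * r) \<inter> X"
    proof (intro exI[of _ "u ` ?K"] conjI)
      show "continuum_joining (u ` ?K) y z" using join(1)[OF K KD] y z by blast
      show "u ` ?K \<subseteq> ball x (lam * r) \<inter> X" using join(2)[OF K KD] y z seg by auto
    qed
  next
    fix x r y z assume x: "x \<in> X" and r: "(r::real) > 0" and y: "y \<in> X - ball x r" and z: "z \<in> X - ball x r"
    define \<rho> where "\<rho> = min (dist (v x) (v y)) (dist (v x) (v z))"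
    have yz: "y \<in> X" "z \<in> X" "r \<le> dist x y" "r \<le> dist x z" using y z by auto
    then have "v x \<noteq> v y" "v x \<noteq> v z" using uv x r by (metis dist_self not_le)+
    then have "\<rho> > 0" by (simp add: \<rho>_def)
    obtain K where K: "continuum_joining K (v y) (v z)" "K \<subseteq> ?D" "\<And>w. w \<in> K \<Longrightarrow> \<rho> / 4 \<le> dist (v x) w"
      using disc_detour[OF vS vS _ _ \<open>\<rho> > 0\<close>, of y z "v x"] yz by (metis \<rho>_def min.cobounded1 min.cobounded2)
    obtain y' where y': "y' \<in> X" "r \<le> dist x y'" "\<rho> = dist (v x) (v y')"
      using yz by (metis \<rho>_def min_def)
    have far: "r / lam \<le> dist x (u w)" if "w \<in> K" for w
    proof -
      have "dist (v x) (v y') \<le> 4 * dist (v x) w" using K(3)[OF that] y' by simp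
      then have "dist x y' \<le> \<eta> 4 * dist x (u w)" using qs[of "v x" "v y'" w 4] vS uv x y' K that by auto
      also have "\<dots> \<le> lam * dist x (u w)" using lam by (intro mult_right_mono) auto
      finally show ?thesis using y' lam by (simp add: field_simps)
    qed
    show "\<exists>K. continuum_joining K y z \<and> K \<subseteq> X - ball x (r / lam)"
    proof (intro exI[of _ "u ` K"] conjI)
      show "continuum_joining (u ` K) y z" using join(1)[OF K(1,2)] yz by blast
      have "u w \<notin> ball x (r / lam)" if "w \<in> K" for w using far[OF that] by simp
      then show "u ` K \<subseteq> X - ball x (r / lam)" using join(2)[OF K(1,2)] yz by blast
    qed
  qed (use lam in auto)
qed

section \<open>Connecting continua in the disc\<close>

text \<open>The mass of \<open>\<rho>\<close> is taken with respect to the parameter, so masses add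
  under concatenation while \<open>K\<close> stays fixed. Arc length enters only at the end, through
  \<open>line_integral_Lipschitz_le\<close>, at the price of the factor \<open>K\<close>.\<close>

definition Lipschitz_joined :: "'b::metric_space set \<Rightarrow> real \<Rightarrow> ('b \<Rightarrow> ennreal) \<Rightarrow> ennreal \<Rightarrow> 'b \<Rightarrow> 'b \<Rightarrow> bool" where
  "Lipschitz_joined D K \<rho> m P Q \<longleftrightarrow> (\<exists>T f. T \<ge> 0 \<and> f 0 = P \<and> f T = Q \<and>
     (\<forall>s\<in>{0..T}. \<forall>t\<in>{0..T}. dist (f s) (f t) \<le> K * \<bar>s - t\<bar>) \<and> f ` {0..T} \<subseteq> D \<and>
     (\<integral>\<^sup>+ t. \<rho> (f t) * indicator {0..T} t \<partial>lborel) \<le> m)"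

lemma measurable_compose_Lipschitz:
  fixes f :: "real \<Rightarrow> 'b::metric_space"
  assumes lip: "\<forall>s\<in>{a..b}. \<forall>t\<in>{a..b}. dist (f s) (f t) \<le> K * \<bar>s - t\<bar>" and "K \<ge> 0"
    and \<rho>: "\<rho> \<in> borel_measurable borel"
  shows "(\<lambda>t. (\<rho> (f t) :: ennreal) * indicator {a..b} t) \<in> borel_measurable borel"
proof -
  have "continuous_on {a..b} f"
    by (rule lipschitz_on_continuous_on, rule lipschitz_onI[of _ _ K]) (use lip assms(2) in \<open>auto simp: dist_real_def\<close>)
  then have "(\<lambda>t. \<rho> (f t)) \<in> borel_measurable (restrict_space borel {a..b})"
    using \<rho> by (auto intro: measurable_compose borel_measurable_continuous_on_restrict)
  then show ?thesis
    by (subst (asm) borel_measurable_restrict_space_iff_ennreal) auto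
qed

lemma Lipschitz_joined_line:
  fixes c :: "real \<Rightarrow> 'b::metric_space"
  assumes lip: "\<And>s t. s \<in> {a..b} \<Longrightarrow> t \<in> {a..b} \<Longrightarrow> dist (c s) (c t) \<le> K * \<bar>s - t\<bar>" and "K \<ge> 0"
    and D: "c ` {a..b} \<subseteq> D" and \<rho>: "\<rho> \<in> borel_measurable borel"
    and le: "(\<integral>\<^sup>+ t. \<rho> (c t) * indicator {a..b} t \<partial>lborel) \<le> m" and pq: "p \<in> {a..b}" "q \<in> {a..b}"
  shows "Lipschitz_joined D K \<rho> m (c p) (c q)"
proof -
  have meas: "(\<lambda>t. \<rho> (c t) * indicator {a..b} t) \<in> borel_measurable borel"
    using lip by (intro measurable_compose_Lipschitz[where K=K] assms) auto
  \<comment> \<open>The direction of travel from \<open>p\<close> to \<open>q\<close>; slope 1 or -1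
    preserves both the Lipschitz constant and the mass. Traversing backwards is what yields symmetry
    below.\<close>
  define \<sigma> :: real where "\<sigma> = (if p \<le> q then 1 else -1)"
  have \<sigma>: "\<bar>\<sigma>\<bar> = 1" "\<sigma> * \<bar>q - p\<bar> = q - p" by (auto simp: \<sigma>_def)
  have in_ab: "p + \<sigma> * t \<in> {a..b}" if "t \<in> {0..\<bar>q - p\<bar>}" for t
    using pq that by (auto simp: \<sigma>_def abs_if split: if_splits)
  show ?thesis unfolding Lipschitz_joined_def
  proof (intro exI[of _ "\<bar>q - p\<bar>"] exI[of _ "\<lambda>t. c (p + \<sigma> * t)"] conjI ballI)
    show "dist (c (p + \<sigma> * s)) (c (p + \<sigma> * t)) \<le> K * \<bar>s - t\<bar>" if "s \<in> {0..\<bar>q - p\<bar>}" "t \<in> {0..\<bar>q - p\<bar>}" for s t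
    proof -
      have "\<bar>(p + \<sigma> * s) - (p + \<sigma> * t)\<bar> = \<bar>\<sigma>\<bar> * \<bar>s - t\<bar>" by (simp add: algebra_simps flip: abs_mult)
      then show ?thesis using lip[OF in_ab in_ab, OF that] \<sigma>(1) by simp
    qed
    show "(\<lambda>t. c (p + \<sigma> * t)) ` {0..\<bar>q - p\<bar>} \<subseteq> D" using in_ab D by blast
    have "(\<integral>\<^sup>+ t. \<rho> (c (p + \<sigma> * t)) * indicator {0..\<bar>q - p\<bar>} t \<partial>lborel)
      \<le> (\<integral>\<^sup>+ t. \<rho> (c (p + \<sigma> * t)) * indicator {a..b} (p + \<sigma> * t) \<partial>lborel)"
      using in_ab by (intro nn_integral_mono) (auto simp: indicator_def)
    also have "\<dots> = (\<integral>\<^sup>+ t. \<rho> (c t) * indicator {a..b} t \<partial>lborel)"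
      using nn_integral_real_affine[OF meas, of \<sigma> p] \<sigma>(1) by auto
    finally show "(\<integral>\<^sup>+ t. \<rho> (c (p + \<sigma> * t)) * indicator {0..\<bar>q - p\<bar>} t \<partial>lborel) \<le> m" using le by simp
  qed (use \<sigma> in simp_all)
qed

lemma Lipschitz_joined_sym:
  assumes "Lipschitz_joined D K \<rho> m P Q" "K \<ge> 0" "\<rho> \<in> borel_measurable borel"
  shows "Lipschitz_joined D K \<rho> m Q P"
proof -
  obtain T f where f: "T \<ge> 0" "f 0 = P" "f T = Q" "\<And>s t. s \<in> {0..T} \<Longrightarrow> t \<in> {0..T} \<Longrightarrow> dist (f s) (f t) \<le> K * \<bar>s - t\<bar>"
    "f ` {0..T} \<subseteq> D" "(\<integral>\<^sup>+ t. \<rho> (f t) * indicator {0..T} t \<partial>lborel) \<le> m"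
    using assms(1) unfolding Lipschitz_joined_def by blast
  have "Lipschitz_joined D K \<rho> m (f T) (f 0)"
    by (rule Lipschitz_joined_line[OF f(4) assms(2) f(5) assms(3) f(6)]) (use f in auto)
  then show ?thesis using f by simp
qed

lemma Lipschitz_joined_trans:
  assumes PQ: "Lipschitz_joined D K \<rho> m P Q" and QR: "Lipschitz_joined D K \<rho> m' Q R"
    and K: "K \<ge> 0" and \<rho>: "\<rho> \<in> borel_measurable borel"
  shows "Lipschitz_joined D K \<rho> (m + m') P R"
proof -
  obtain T f where f: "T \<ge> 0" "f 0 = P" "f T = Q" "\<forall>s\<in>{0..T}. \<forall>t\<in>{0..T}. dist (f s) (f t) \<le> K * \<bar>s - t\<bar>"
    "f ` {0..T} \<subseteq> D" "(\<integral>\<^sup>+ t. \<rho> (f t) * indicator {0..T} t \<partial>lborel) \<le> m"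
    using PQ unfolding Lipschitz_joined_def by blast
  obtain U g where g: "U \<ge> 0" "g 0 = Q" "g U = R" "\<forall>s\<in>{0..U}. \<forall>t\<in>{0..U}. dist (g s) (g t) \<le> K * \<bar>s - t\<bar>"
    "g ` {0..U} \<subseteq> D" "(\<integral>\<^sup>+ t. \<rho> (g t) * indicator {0..U} t \<partial>lborel) \<le> m'"
    using QR unfolding Lipschitz_joined_def by blast
  note mf = measurable_compose_Lipschitz[OF f(4) K \<rho>] and mg = measurable_compose_Lipschitz[OF g(4) K \<rho>]
  define h where "h = (\<lambda>t. if t \<le> T then f t else g (t - T))"
  have lip: "dist (h s) (h t) \<le> K * (t - s)" if st: "0 \<le> s" "s \<le> t" "t \<le> T + U" for s t
  proof -
    consider "t \<le> T" | "s \<le> T" "T < t" | "T < s" using st by linarith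
    then show ?thesis
    proof cases
      case 1
      then show ?thesis using f(4)[rule_format, of s t] st by (simp add: h_def)
    next
      case 2
      have "dist (f s) (f T) \<le> K * (T - s)" using f(4)[rule_format, of s T] st 2 by simp
      moreover have "dist (g 0) (g (t - T)) \<le> K * (t - T)" using g(4)[rule_format, of 0 "t - T"] st 2 g(1) by simp
      moreover have "dist (f s) (g (t - T)) \<le> dist (f s) (f T) + dist (g 0) (g (t - T))"
        using f g dist_triangle by metis
      ultimately show ?thesis using 2 by (simp add: h_def algebra_simps)
    next
      case 3
      then show ?thesis using g(4)[rule_format, of "s - T" "t - T"] st by (simp add: h_def)
    qed
  qed
  show ?thesis unfolding Lipschitz_joined_def
  proof (intro exI[of _ "T + U"] exI[of _ h] conjI ballI)
    show "dist (h s) (h t) \<le> K * \<bar>s - t\<bar>" if "s \<in> {0..T + U}" "t \<in> {0..T + U}" for s t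
      using lip[of s t] lip[of t s] that by (cases "s \<le> t") (auto simp: dist_commute)
    show "h ` {0..T + U} \<subseteq> D" using f(5) g(5) by (auto simp: h_def)
    show "h (T + U) = R" using f g by (auto simp: h_def)
    have "(\<integral>\<^sup>+ t. \<rho> (h t) * indicator {0..T + U} t \<partial>lborel)
      \<le> (\<integral>\<^sup>+ t. \<rho> (f t) * indicator {0..T} t + \<rho> (g (- T + 1 * t)) * indicator {0..U} (- T + 1 * t) \<partial>lborel)"
      by (intro nn_integral_mono) (auto simp: h_def indicator_def)
    also have "\<dots> = (\<integral>\<^sup>+ t. \<rho> (f t) * indicator {0..T} t \<partial>lborel) + (\<integral>\<^sup>+ t. \<rho> (g (- T + 1 * t)) * indicator {0..U} (- T + 1 * t) \<partial>lborel)"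
      using mf measurable_compose[OF _ mg, of "\<lambda>t. - T + 1 * t" lborel] by (intro nn_integral_add) auto
    also have "(\<integral>\<^sup>+ t. \<rho> (g (- T + 1 * t)) * indicator {0..U} (- T + 1 * t) \<partial>lborel) = (\<integral>\<^sup>+ t. \<rho> (g t) * indicator {0..U} t \<partial>lborel)"
      using nn_integral_real_affine[OF mg, of 1 "- T"] by simp
    finally show "(\<integral>\<^sup>+ t. \<rho> (h t) * indicator {0..T + U} t \<partial>lborel) \<le> m + m'"
      using add_mono[OF f(6) g(6)] by (rule order_trans)
  qed (use f g in \<open>auto simp: h_def\<close>)
qed

section \<open>Coordinates on the disc: Fubini and charts by parallel chords\<close>

definition plane_point :: "2 \<Rightarrow> real \<Rightarrow> real \<Rightarrow> real^2" where
  "plane_point j x y = (\<chi> i. if i = j then x else y)"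

lemma UNIV_2_eq: "j \<noteq> k \<Longrightarrow> (UNIV :: 2 set) = {j, k}"
proof (rule UNIV_eq_I)
  show "j \<noteq> k \<Longrightarrow> x \<in> {j, k}" for x
    using exhaust_2[of j] exhaust_2[of k] exhaust_2[of x] by auto
qed

lemma forall_2_iff: "j \<noteq> k \<Longrightarrow> (\<forall>i :: 2. P i) \<longleftrightarrow> P j \<and> P k"
  using UNIV_2_eq[of j k] by (metis UNIV_I insertE singletonD)

lemma continuous_plane_point [continuous_intros]:
  "continuous_on A f \<Longrightarrow> continuous_on A g \<Longrightarrow> continuous_on A (\<lambda>x. plane_point j (f x) (g x))"
  unfolding plane_point_def
proof (intro continuous_on_vec_lambda)
  show "continuous_on A f \<Longrightarrow> continuous_on A g \<Longrightarrow> continuous_on A (\<lambda>x. if i = j then f x else g x)" for i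
    by (cases "i = j") auto
qed

lemma measurable_plane_point [measurable (raw)]:
  assumes [measurable]: "f \<in> borel_measurable M" "g \<in> borel_measurable M"
  shows "(\<lambda>x. plane_point j (f x) (g x)) \<in> borel_measurable M"
proof -
  have "(\<lambda>x. plane_point j (fst x) (snd x)) \<in> borel_measurable borel"
    by (intro borel_measurable_continuous_onI continuous_intros)
  from measurable_compose[OF _ this, of "\<lambda>x. (f x, g x)" M] show ?thesis by simp
qed

lemma lborel_plane_point:
  "lborel = distr (lborel \<Otimes>\<^sub>M lborel) borel (\<lambda>x. plane_point j (fst x) (snd x))"
proof (rule lborel_eqI)
  fix l u :: "real^2"
  assume le: "\<And>b. b \<in> Basis \<Longrightarrow> l \<bullet> b \<le> u \<bullet> b"
  obtain k :: 2 where jk: "j \<noteq> k" using exhaust_2 by (metis one_neq_zero)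
  have "axis i (1 :: real) \<in> Basis" for i :: 2 by (auto simp: Basis_vec_def)
  then have le': "l $ i \<le> u $ i" for i using le[of "axis i 1"] by (simp add: inner_axis)
  have pre: "(\<lambda>x. plane_point j (fst x) (snd x)) -` box l u = {l $ j<..<u $ j} \<times> {l $ k<..<u $ k}"
    using jk by (auto simp: plane_point_def mem_box_cart forall_2_iff[OF jk])
  have Basis: "Basis = (\<lambda>i. axis i 1 :: real^2) ` UNIV" by (auto simp: Basis_vec_def)
  have "inj (\<lambda>i. axis i 1 :: real^2)" by (simp add: inj_on_def axis_eq_axis)
  then have "(\<Prod>b\<in>Basis. (u - l) \<bullet> b) = (\<Prod>i\<in>UNIV. (u - l) \<bullet> axis i 1)"
    unfolding Basis by (subst prod.reindex) auto
  also have "\<dots> = (u $ j - l $ j) * (u $ k - l $ k)"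
    unfolding UNIV_2_eq[OF jk] using jk by (simp add: inner_axis)
  finally have B: "(\<Prod>b\<in>Basis. (u - l) \<bullet> b) = (u $ j - l $ j) * (u $ k - l $ k)" .
  show "emeasure (distr (lborel \<Otimes>\<^sub>M lborel) borel (\<lambda>x. plane_point j (fst x) (snd x))) (box l u) = (\<Prod>b\<in>Basis. (u - l) \<bullet> b)"
    unfolding B using le'[of j] le'[of k]
    by (simp add: emeasure_distr pre space_pair_measure lborel.emeasure_pair_measure_Times ennreal_mult)
qed simp

lemma nn_integral_plane_point:
  assumes [measurable]: "g \<in> borel_measurable borel"
  shows "(\<integral>\<^sup>+ x. g x \<partial>lborel) = (\<integral>\<^sup>+ y. \<integral>\<^sup>+ x. g (plane_point j x y) \<partial>lborel \<partial>lborel)"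
proof -
  have "(\<integral>\<^sup>+ x. g x \<partial>lborel) = (\<integral>\<^sup>+ x. g (plane_point j (fst x) (snd x)) \<partial>(lborel \<Otimes>\<^sub>M lborel))"
    by (subst lborel_plane_point[of j], subst nn_integral_distr) auto
  also have "\<dots> = (\<integral>\<^sup>+ y. \<integral>\<^sup>+ x. g (plane_point j x y) \<partial>lborel \<partial>lborel)"
    by (subst lborel_pair.nn_integral_snd[symmetric]) auto
  finally show ?thesis .
qed

text \<open>The chart maps a rectangle onto the part of the disc between two parallel chords; it
  stays bilipschitz up to the boundary circle. Every point of the disc has a coordinate of modulus
  at most \<open>1 / sqrt 2 < 4 / 5\<close>, so a chart with \<open>j\<close> and \<open>k\<close> suitably chosen covers a neighbourhood of it.
  The truncation in \<open>chord_coord\<close> only serves to make the inverse continuous on the whole plane.\<close>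

definition chart :: "2 \<Rightarrow> real \<Rightarrow> real \<Rightarrow> real^2" where
  "chart j s y = plane_point j (s * sqrt (1 - y\<^sup>2)) y"

definition chord_coord :: "2 \<Rightarrow> 2 \<Rightarrow> real^2 \<Rightarrow> real" where
  "chord_coord j k e = e $ j / sqrt (1 - min ((e $ k)\<^sup>2) (16 / 25))"

lemma measurable_chart [measurable (raw)]:
  assumes [measurable]: "f \<in> borel_measurable M" "g \<in> borel_measurable M"
  shows "(\<lambda>x. chart j (f x) (g x)) \<in> borel_measurable M"
  unfolding chart_def by measurable

text \<open>On the line of height \<open>y\<close> the chart scales by
  \<open>sqrt (1 - y\<^sup>2)\<close>, which is at least \<open>3 / 5\<close> for \<open>y\<close>
  in \<open>J\<close>; the factor 2 dominates its inverse.\<close>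

lemma nn_integral_chart_le:
  assumes [measurable]: "g \<in> borel_measurable borel" "J \<in> sets borel" and J: "J \<subseteq> {-4/5..4/5}"
  shows "(\<integral>\<^sup>+ y. (\<integral>\<^sup>+ s. g (chart j s y) \<partial>lborel) * indicator J y \<partial>lborel) \<le> 2 * (\<integral>\<^sup>+ x. g x \<partial>lborel)"
proof -
  have "(\<integral>\<^sup>+ s. g (chart j s y) \<partial>lborel) * indicator J y \<le> 2 * (\<integral>\<^sup>+ x. g (plane_point j x y) \<partial>lborel)" for y
  proof (cases "y \<in> J")
    case True
    define q where "q = sqrt (1 - y\<^sup>2)"
    have "y \<in> {-4/5..4/5}" using True J by blast
    then have "- 4 / 5 \<le> y" "y \<le> 4 / 5" by auto
    then have "\<bar>y\<bar> \<le> 4 / 5" by linarith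
    then have "y\<^sup>2 \<le> (4 / 5)\<^sup>2" using power_mono[of "\<bar>y\<bar>" "4/5" 2] by simp
    then have q: "q \<ge> 3 / 5" unfolding q_def by (intro real_le_rsqrt) (simp add: power2_eq_square)
    have [measurable]: "(\<lambda>x. g (plane_point j x y)) \<in> borel_measurable borel"
      by measurable
    have "(\<integral>\<^sup>+ x. g (plane_point j x y) \<partial>lborel) = ennreal q * (\<integral>\<^sup>+ s. g (plane_point j (0 + q * s) y) \<partial>lborel)"
      using nn_integral_real_affine[of "\<lambda>x. g (plane_point j x y)" q 0] q by simp
    also have "(\<lambda>s. g (plane_point j (0 + q * s) y)) = (\<lambda>s. g (chart j s y))"
      by (simp add: chart_def q_def mult.commute)
    finally have eq: "(\<integral>\<^sup>+ x. g (plane_point j x y) \<partial>lborel) = ennreal q * (\<integral>\<^sup>+ s. g (chart j s y) \<partial>lborel)" .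
    have "1 * (\<integral>\<^sup>+ s. g (chart j s y) \<partial>lborel) \<le> ennreal (2 * q) * (\<integral>\<^sup>+ s. g (chart j s y) \<partial>lborel)"
      using q by (intro mult_right_mono) auto
    then show ?thesis unfolding eq using q True by (simp add: ennreal_mult mult.assoc)
  qed simp
  then have "(\<integral>\<^sup>+ y. (\<integral>\<^sup>+ s. g (chart j s y) \<partial>lborel) * indicator J y \<partial>lborel)
    \<le> (\<integral>\<^sup>+ y. 2 * (\<integral>\<^sup>+ x. g (plane_point j x y) \<partial>lborel) \<partial>lborel)"
    by (intro nn_integral_mono)
  also have "\<dots> = 2 * (\<integral>\<^sup>+ x. g x \<partial>lborel)"
    unfolding nn_integral_plane_point[OF assms(1), of j] by (rule nn_integral_cmult) measurable
  finally show ?thesis .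
qed

text \<open>The difference of the roots times their sum is a difference of squares. The sum is at
  least \<open>6 / 5\<close> and \<open>\<bar>y + y'\<bar>\<close> at most \<open>8 / 5\<close>,
  with quotient \<open>4 / 3\<close>.\<close>

lemma sqrt_chord_Lipschitz:
  fixes y y' :: real
  assumes "\<bar>y\<bar> \<le> 4 / 5" "\<bar>y'\<bar> \<le> 4 / 5"
  shows "3 / 5 \<le> sqrt (1 - y\<^sup>2)" "\<bar>sqrt (1 - y\<^sup>2) - sqrt (1 - y'\<^sup>2)\<bar> \<le> 4 / 3 * \<bar>y - y'\<bar>"
proof -
  have *: "3 / 5 \<le> sqrt (1 - x\<^sup>2)" "x\<^sup>2 \<le> 1" if "\<bar>x\<bar> \<le> 4 / 5" for x :: real
  proof -
    have "x\<^sup>2 \<le> (4 / 5)\<^sup>2" using that power_mono[of "\<bar>x\<bar>" "4/5" 2] by simp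
    then show "x\<^sup>2 \<le> 1" by (simp add: power2_eq_square)
    show "3 / 5 \<le> sqrt (1 - x\<^sup>2)" by (rule real_le_rsqrt) (use \<open>x\<^sup>2 \<le> (4 / 5)\<^sup>2\<close> in \<open>simp add: power2_eq_square\<close>)
  qed
  show "3 / 5 \<le> sqrt (1 - y\<^sup>2)" by (rule *) fact
  let ?q = "sqrt (1 - y\<^sup>2)" and ?q' = "sqrt (1 - y'\<^sup>2)"
  have "(?q - ?q') * (?q + ?q') = (y' - y) * (y' + y)"
    using *(2)[OF assms(1)] *(2)[OF assms(2)] by (simp add: algebra_simps flip: power2_eq_square)
  then have "\<bar>?q - ?q'\<bar> * \<bar>?q + ?q'\<bar> = \<bar>y - y'\<bar> * \<bar>y' + y\<bar>" by (metis abs_mult abs_minus_commute)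
  also have "\<bar>y' + y\<bar> \<le> 8 / 5" using assms by linarith
  then have "\<bar>y - y'\<bar> * \<bar>y' + y\<bar> \<le> \<bar>y - y'\<bar> * (8 / 5)" by (intro mult_left_mono) auto
  finally have "\<bar>?q - ?q'\<bar> * \<bar>?q + ?q'\<bar> \<le> \<bar>y - y'\<bar> * (8 / 5)" .
  moreover have "\<bar>?q - ?q'\<bar> * (6 / 5) \<le> \<bar>?q - ?q'\<bar> * \<bar>?q + ?q'\<bar>"
    using *(1)[OF assms(1)] *(1)[OF assms(2)] by (intro mult_left_mono) auto
  moreover have "A \<le> 4 / 3 * B" if "P \<le> B * (8 / 5)" "A * (6 / 5) \<le> P" for A B P :: real
    using that by linarith
  ultimately show "\<bar>?q - ?q'\<bar> \<le> 4 / 3 * \<bar>y - y'\<bar>" by blast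
qed

context
  fixes j k :: 2
  assumes jk: "j \<noteq> k"
begin

lemma norm_sq_coords: "(norm (e :: real^2))\<^sup>2 = (e $ j)\<^sup>2 + (e $ k)\<^sup>2"
  unfolding power2_norm_eq_inner inner_vec_def UNIV_2_eq[OF jk] using jk by (simp add: power2_eq_square)

lemma chart_nth [simp]: "chart j s y $ j = s * sqrt (1 - y\<^sup>2)" "chart j s y $ k = y"
  using jk by (auto simp: chart_def plane_point_def)

lemma vec_eq_coords: "(e :: real^2) = e' \<longleftrightarrow> e $ j = e' $ j \<and> e $ k = e' $ k"
  by (simp add: vec_eq_iff forall_2_iff[OF jk])

lemma chord_coord_eq: "\<bar>e $ k\<bar> \<le> 4 / 5 \<Longrightarrow> chord_coord j k e = e $ j / sqrt (1 - (e $ k)\<^sup>2)"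
  using power_mono[of "\<bar>e $ k\<bar>" "4/5" 2] by (simp add: chord_coord_def min_absorb1 power2_eq_square)

lemma chart_chord_coord: "\<bar>e $ k\<bar> \<le> 4 / 5 \<Longrightarrow> chart j (chord_coord j k e) (e $ k) = e"
  using abs_square_less_1[of "e $ k"] by (simp add: vec_eq_coords chord_coord_eq)

lemma chord_coord_le_1:
  assumes "e \<in> cball 0 1" "\<bar>e $ k\<bar> \<le> 4 / 5"
  shows "\<bar>chord_coord j k e\<bar> \<le> 1"
proof -
  have "(e $ j)\<^sup>2 + (e $ k)\<^sup>2 \<le> 1" using assms(1) norm_sq_coords[of e] power_mono[of "norm e" 1 2] by simp
  then have "\<bar>e $ j\<bar> \<le> sqrt (1 - (e $ k)\<^sup>2)" by (intro real_le_rsqrt) simp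
  then show ?thesis using sqrt_chord_Lipschitz(1)[of "e $ k" 0] assms(2)
    unfolding chord_coord_eq[OF assms(2)] abs_divide by (subst divide_le_eq_1_pos) auto
qed

lemma chart_in_disc:
  assumes "\<bar>s\<bar> \<le> 1" "\<bar>y\<bar> \<le> 4 / 5"
  shows "chart j s y \<in> cball 0 1"
proof -
  have y: "y\<^sup>2 \<le> 1" using power_mono[of "\<bar>y\<bar>" 1 2] assms(2) by simp
  have "s\<^sup>2 \<le> 1" using power_mono[of "\<bar>s\<bar>" 1 2] assms(1) by simp
  then have "s\<^sup>2 * (1 - y\<^sup>2) \<le> 1 * (1 - y\<^sup>2)" using y by (intro mult_right_mono) auto
  then have "(norm (chart j s y))\<^sup>2 \<le> 1" using y by (simp add: norm_sq_coords power_mult_distrib)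
  then show ?thesis by (simp add: abs_square_le_1)
qed

lemma norm_le_coords: "norm (e :: real^2) \<le> \<bar>e $ j\<bar> + \<bar>e $ k\<bar>"
proof (rule power2_le_imp_le)
  show "(norm e)\<^sup>2 \<le> (\<bar>e $ j\<bar> + \<bar>e $ k\<bar>)\<^sup>2"
    unfolding norm_sq_coords by (simp add: power2_sum)
qed simp

lemma dist_chart_fst: "\<bar>y\<bar> \<le> 4 / 5 \<Longrightarrow> dist (chart j s y) (chart j s' y) \<le> \<bar>s - s'\<bar>"
proof -
  assume "\<bar>y\<bar> \<le> 4 / 5"
  then have "y\<^sup>2 \<le> 1" using power_mono[of "\<bar>y\<bar>" 1 2] by simp
  have "dist (chart j s y) (chart j s' y) \<le> \<bar>s - s'\<bar> * sqrt (1 - y\<^sup>2)"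
    using norm_le_coords[of "chart j s y - chart j s' y"] \<open>y\<^sup>2 \<le> 1\<close>
    by (simp add: dist_norm abs_mult flip: left_diff_distrib)
  also have "\<dots> \<le> \<bar>s - s'\<bar> * 1" by (intro mult_left_mono) auto
  finally show ?thesis by simp
qed

lemma dist_chart_snd:
  assumes "\<bar>s\<bar> \<le> 1" "\<bar>y\<bar> \<le> 4 / 5" "\<bar>y'\<bar> \<le> 4 / 5"
  shows "dist (chart j s y) (chart j s y') \<le> 3 * \<bar>y - y'\<bar>"
proof -
  have "dist (chart j s y) (chart j s y') \<le> \<bar>s\<bar> * \<bar>sqrt (1 - y\<^sup>2) - sqrt (1 - y'\<^sup>2)\<bar> + \<bar>y - y'\<bar>"
    using norm_le_coords[of "chart j s y - chart j s y'"]
    by (simp add: dist_norm flip: abs_mult right_diff_distrib)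
  moreover have "\<bar>s\<bar> * \<bar>sqrt (1 - y\<^sup>2) - sqrt (1 - y'\<^sup>2)\<bar> \<le> 1 * (4 / 3 * \<bar>y - y'\<bar>)"
    using assms sqrt_chord_Lipschitz(2)[OF assms(2,3)] by (intro mult_mono) auto
  moreover have "A \<le> 3 * B" if "A \<le> P + B" "P \<le> 1 * (4 / 3 * B)" "0 \<le> B" for A B P :: real
    using that by linarith
  ultimately show ?thesis using abs_ge_zero by blast
qed

lemma chord_coord_Lipschitz:
  assumes "e \<in> cball 0 1" "\<bar>e $ k\<bar> \<le> 4 / 5" "\<bar>e' $ k\<bar> \<le> 4 / 5"
  shows "\<bar>chord_coord j k e - chord_coord j k e'\<bar> \<le> 6 * dist e e'"
proof -
  let ?s = "chord_coord j k e" and ?s' = "chord_coord j k e'"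
  let ?q = "sqrt (1 - (e $ k)\<^sup>2)" and ?q' = "sqrt (1 - (e' $ k)\<^sup>2)"
  have q: "3 / 5 \<le> ?q" "3 / 5 \<le> ?q'" using sqrt_chord_Lipschitz(1) assms by auto
  have ej: "e $ j = ?s * ?q" "e' $ j = ?s' * ?q'" using q assms abs_square_less_1[of "e $ k"] abs_square_less_1[of "e' $ k"] by (simp_all add: chord_coord_eq)
  have d: "\<bar>e $ i - e' $ i\<bar> \<le> dist e e'" for i
    using component_le_norm_cart[of "e - e'" i] by (simp add: dist_norm)
  \<comment> \<open>In this splitting the difference of the roots is multiplied by
    \<open>?s\<close>, which is at most 1 in modulus because \<open>e\<close> lies in the
    disc.\<close>
  have "(?s - ?s') * ?q' = (e $ j - e' $ j) - ?s * (?q - ?q')" unfolding ej by (simp add: algebra_simps)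
  then have "\<bar>(?s - ?s') * ?q'\<bar> \<le> \<bar>e $ j - e' $ j\<bar> + \<bar>?s * (?q - ?q')\<bar>"
    by (metis abs_triangle_ineq4)
  moreover have "\<bar>?q'\<bar> = ?q'" using q(2) by linarith
  ultimately have "\<bar>?s - ?s'\<bar> * ?q' \<le> \<bar>e $ j - e' $ j\<bar> + \<bar>?s\<bar> * \<bar>?q - ?q'\<bar>"
    by (simp only: abs_mult)
  also have "\<dots> \<le> dist e e' + 1 * (4 / 3 * dist e e')"
  proof -
    have "\<bar>?q - ?q'\<bar> \<le> 4 / 3 * dist e e'"
      by (rule order_trans[OF sqrt_chord_Lipschitz(2)[OF assms(2,3)]]) (use d[of k] in simp)
    then have "\<bar>?s\<bar> * \<bar>?q - ?q'\<bar> \<le> 1 * (4 / 3 * dist e e')"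
      using chord_coord_le_1[OF assms(1,2)] by (intro mult_mono) auto
    then show ?thesis using d[of j] by linarith
  qed
  finally have "\<bar>?s - ?s'\<bar> * ?q' \<le> 7 / 3 * dist e e'" by simp
  moreover have "\<bar>?s - ?s'\<bar> * (3 / 5) \<le> \<bar>?s - ?s'\<bar> * ?q'" using q by (intro mult_left_mono) auto
  moreover have "A \<le> 6 * B" if "P \<le> 7 / 3 * B" "A * (3 / 5) \<le> P" "0 \<le> B" for A B P :: real
    using that by linarith
  ultimately show ?thesis using zero_le_dist by blast
qed

lemma continuous_chord_coord: "continuous_on A (chord_coord j k)"
  unfolding chord_coord_def by (intro continuous_intros) (auto simp: min_def)

end

section \<open>Averaging and measure estimates for families of lines\<close>

lemma nn_integral_less_obtain:
  fixes f :: "real \<Rightarrow> ennreal"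
  assumes "A \<in> sets borel" "(\<integral>\<^sup>+ x. f x * indicator A x \<partial>lborel) < m * emeasure lborel A"
  obtains x where "x \<in> A" "f x < m"
proof -
  have "\<exists>x\<in>A. f x < m"
  proof (rule ccontr)
    assume "\<not> ?thesis"
    then have "(\<integral>\<^sup>+ x. m * indicator A x \<partial>lborel) \<le> (\<integral>\<^sup>+ x. f x * indicator A x \<partial>lborel)"
      by (intro nn_integral_mono) (auto simp: indicator_def not_less)
    then show False using assms by (simp add: nn_integral_cmult_indicator)
  qed
  then show ?thesis using that by blast
qed

lemma emeasure_lborel_isometry:
  fixes A :: "real set"
  assumes [measurable]: "A \<in> sets borel" and c: "\<bar>c\<bar> = 1"
  shows "emeasure lborel {t. x + c * t \<in> A} = emeasure lborel A"
proof -
  have m: "{t. x + c * t \<in> A} \<in> sets borel" by measurable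
  have "emeasure lborel A = (\<integral>\<^sup>+ t. indicator A t \<partial>lborel)" by simp
  also have "\<dots> = (\<integral>\<^sup>+ t. indicator A (x + c * t) \<partial>lborel)"
    using nn_integral_real_affine[of "indicator A" c x] c by auto
  also have "\<dots> = (\<integral>\<^sup>+ t. indicator {t. x + c * t \<in> A} t \<partial>lborel)"
    by (intro nn_integral_cong) (simp add: indicator_def)
  also have "\<dots> = emeasure lborel {t. x + c * t \<in> A}" using m by simp
  finally show ?thesis by simp
qed

text \<open>Takes the place of the Cauchy-Schwarz inequality: integrated over a window, it bounds
  mass by energy plus area, with a weight \<open>l\<close> that is free to balance the two.\<close>

lemma ennreal_le_weighted_square:
  fixes x :: ennreal and l :: real
  assumes "l > 0"
  shows "x \<le> ennreal l * x\<^sup>2 + ennreal (1 / l)"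
proof (cases x)
  case (real r)
  have "0 \<le> (l * r - 1 / 2)\<^sup>2 + 3 / 4" by (simp add: add_nonneg_nonneg)
  also have "\<dots> = l * (l * r\<^sup>2 + 1 / l - r)" using assms by (simp add: power2_eq_square algebra_simps)
  finally have "r \<le> l * r\<^sup>2 + 1 / l" using assms by (simp add: zero_le_mult_iff)
  then have "ennreal r \<le> ennreal (l * r\<^sup>2 + 1 / l)" by (rule ennreal_leI)
  then show ?thesis using real assms by (simp add: ennreal_mult ennreal_power)
next
  case top
  then show ?thesis using assms by (simp add: ennreal_mult_top power2_eq_square ennreal_top_mult)
qed

context
  fixes j k :: 2
  assumes jk: "j \<noteq> k"
begin

text \<open>Every value in \<open>[0, \<delta> / 6]\<close> is the sup-norm distance, in chart coordinates, of some point of the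
  continuum to \<open>p\<close>, hence one of the two coordinate projections is large.\<close>

lemma continuum_projection:
  fixes E :: "(real^2) set"
  assumes E: "E \<subseteq> cball 0 1" "compact E" "connected E" and p: "p \<in> E" "\<bar>p $ k\<bar> \<le> 3 / 4" and q: "q \<in> E"
    and \<delta>: "0 < \<delta>" "\<delta> \<le> 3 / 10" "\<delta> \<le> dist p q"
  obtains E' where "E' \<subseteq> E" "\<And>e. e \<in> E' \<Longrightarrow> \<bar>chord_coord j k e - chord_coord j k p\<bar> \<le> \<delta> / 6 \<and> \<bar>e $ k - p $ k\<bar> \<le> \<delta> / 6"
    "chord_coord j k ` E' \<in> sets borel" "(\<lambda>e. e $ k) ` E' \<in> sets borel"
    "ennreal (\<delta> / 24) \<le> emeasure lborel (chord_coord j k ` E') \<or> ennreal (\<delta> / 24) \<le> emeasure lborel ((\<lambda>e. e $ k) ` E')"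
proof
  let ?S = "chord_coord j k"
  define g where "g = (\<lambda>e. max \<bar>?S e - ?S p\<bar> \<bar>e $ k - p $ k\<bar>)"
  define E' where "E' = {e \<in> E. g e \<le> \<delta> / 6}"
  have cont: "continuous_on UNIV g"
    unfolding g_def by (intro continuous_intros continuous_chord_coord[OF jk])
  have "closed {e. g e \<le> \<delta> / 6}" by (intro closed_Collect_le cont continuous_intros)
  then have "compact E'" unfolding E'_def Collect_conj_eq using E(2) by (simp add: compact_Int_closed)
  then have cpt: "compact (?S ` E')" "compact ((\<lambda>e. e $ k) ` E')"
    by (auto intro!: compact_continuous_image continuous_chord_coord[OF jk] continuous_intros)
  then show borel: "?S ` E' \<in> sets borel" "(\<lambda>e. e $ k) ` E' \<in> sets borel"
    by (auto intro: borel_compact)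
  show "E' \<subseteq> E" by (auto simp: E'_def)
  show "\<bar>?S e - ?S p\<bar> \<le> \<delta> / 6 \<and> \<bar>e $ k - p $ k\<bar> \<le> \<delta> / 6" if "e \<in> E'" for e
    using that unfolding E'_def g_def by (simp only: mem_Collect_eq max.bounded_iff)
  \<comment> \<open>If both coordinates differed by less than \<open>\<delta> / 6\<close>, the chart
    bounds would give a distance below \<open>3 * \<delta> / 6 + \<delta> / 6 < \<delta>\<close>.
    The bounds on \<open>p\<close> and \<open>\<delta>\<close> keep the coordinates within
    \<open>3 / 4 + 1 / 20 = 4 / 5\<close>.\<close>
  have gq: "\<delta> / 6 \<le> g q"
  proof (rule ccontr)
    assume "\<not> ?thesis"
    then have "g q < \<delta> / 6" by simp
    then have less: "\<bar>?S q - ?S p\<bar> < \<delta> / 6" "\<bar>q $ k - p $ k\<bar> < \<delta> / 6"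
      unfolding g_def max_less_iff_conj by blast+
    then have qk: "\<bar>q $ k\<bar> \<le> 4 / 5" and pk: "\<bar>p $ k\<bar> \<le> 4 / 5" using p \<delta> by linarith+
    have "dist p q = dist (chart j (?S p) (p $ k)) (chart j (?S q) (q $ k))"
      using chart_chord_coord[OF jk] qk pk by simp
    also have "\<dots> \<le> dist (chart j (?S p) (p $ k)) (chart j (?S p) (q $ k)) + dist (chart j (?S p) (q $ k)) (chart j (?S q) (q $ k))"
      by (rule dist_triangle)
    also have "\<dots> \<le> 3 * \<bar>p $ k - q $ k\<bar> + \<bar>?S p - ?S q\<bar>"
      using chord_coord_le_1[OF jk, of p] E p pk qk
      by (intro add_mono dist_chart_snd[OF jk] dist_chart_fst[OF jk]) auto
    also have "\<dots> < \<delta>" using less \<delta>(1) by (simp add: abs_minus_commute)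
    finally show False using \<delta>(3) by simp
  qed
  have "connected (g ` E)" using E(3) cont by (intro connected_continuous_image) (auto intro: continuous_on_subset)
  moreover have "g p = 0" by (simp add: g_def)
  ultimately have "{0..g q} \<subseteq> g ` E"
    using p(1) q by (intro connected_contains_Icc) (auto simp: image_iff)
  then have img: "{0..\<delta> / 6} \<subseteq> g ` E" using gq by auto
  let ?A = "?S ` E'" and ?B = "(\<lambda>e. e $ k) ` E'"
  \<comment> \<open>Each value \<open>t\<close> of \<open>g\<close> is a displacement by
    \<open>t\<close> or \<open>-t\<close> in one of two coordinates. Hence four isometric copies of
    the projections cover an interval of length \<open>\<delta> / 6\<close>, and one of them has at
    least the measure \<open>\<delta> / 24\<close>.\<close>
  have sub: "{0..\<delta> / 6} \<subseteq> ({t. ?S p + 1 * t \<in> ?A} \<union> {t. ?S p + (-1) * t \<in> ?A}) \<union> ({t. p $ k + 1 * t \<in> ?B} \<union> {t. p $ k + (-1) * t \<in> ?B})"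
  proof
    fix t assume t: "t \<in> {0..\<delta> / 6}"
    then obtain e where e: "e \<in> E" "g e = t" using img by blast
    then have "e \<in> E'" using t by (simp add: E'_def)
    have "?S e = ?S p + t \<or> ?S e = ?S p - t \<or> e $ k = p $ k + t \<or> e $ k = p $ k - t"
      using e(2) unfolding g_def by linarith
    then have "?S p + t \<in> ?A \<or> ?S p - t \<in> ?A \<or> p $ k + t \<in> ?B \<or> p $ k - t \<in> ?B"
      using imageI[OF \<open>e \<in> E'\<close>, of ?S] imageI[OF \<open>e \<in> E'\<close>, of "\<lambda>e. e $ k"] by metis
    then show "t \<in> ({t. ?S p + 1 * t \<in> ?A} \<union> {t. ?S p + (-1) * t \<in> ?A}) \<union> ({t. p $ k + 1 * t \<in> ?B} \<union> {t. p $ k + (-1) * t \<in> ?B})"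
      by simp
  qed
  show "ennreal (\<delta> / 24) \<le> emeasure lborel ?A \<or> ennreal (\<delta> / 24) \<le> emeasure lborel ?B"
  proof (rule ccontr)
    assume "\<not> ?thesis"
    then have less: "emeasure lborel ?A < ennreal (\<delta> / 24)" "emeasure lborel ?B < ennreal (\<delta> / 24)" by auto
    note [measurable] = borel
    have m: "{t. c + s * t \<in> ?A} \<in> sets lborel" "{t. c + s * t \<in> ?B} \<in> sets lborel" for c s :: real
      by measurable
    have "ennreal (\<delta> / 6) = emeasure lborel {0..\<delta> / 6}" using \<delta> by simp
    also have "\<dots> \<le> emeasure lborel (({t. ?S p + 1 * t \<in> ?A} \<union> {t. ?S p + (-1) * t \<in> ?A}) \<union> ({t. p $ k + 1 * t \<in> ?B} \<union> {t. p $ k + (-1) * t \<in> ?B}))"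
      by (intro emeasure_mono sub sets.Un m)
    also have "\<dots> \<le> (emeasure lborel {t. ?S p + 1 * t \<in> ?A} + emeasure lborel {t. ?S p + (-1) * t \<in> ?A})
       + (emeasure lborel {t. p $ k + 1 * t \<in> ?B} + emeasure lborel {t. p $ k + (-1) * t \<in> ?B})"
      by (intro order_trans[OF emeasure_subadditive] add_mono emeasure_subadditive sets.Un m)
    also have "\<dots> = (emeasure lborel ?A + emeasure lborel ?A) + (emeasure lborel ?B + emeasure lborel ?B)"
      by (subst (1 2 3 4) emeasure_lborel_isometry) (use borel in auto)
    also have "\<dots> < (ennreal (\<delta> / 24) + ennreal (\<delta> / 24)) + (ennreal (\<delta> / 24) + ennreal (\<delta> / 24))"
      using less by (intro add_strict_mono)
    also have "\<dots> = ennreal (\<delta> / 6)" using \<delta> by (simp flip: ennreal_plus)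
    finally show False by simp
  qed
qed

text \<open>Most coordinate lines of the window carry little \<open>\<rho>\<close>-mass. A light line through a point of \<open>E\<close> and
  one through a point of \<open>F\<close> are connected to the crossing point of two fixed light lines.\<close>

lemma chart_crossing:
  fixes E F :: "(real^2) set"
  assumes E: "E \<subseteq> cball 0 1" "compact E" "connected E" and zb: "z \<in> E" "b \<in> E"
    and F: "F \<subseteq> cball 0 1" "compact F" "connected F" and aw: "a \<in> F" "w \<in> F"
    and d: "0 < d" "d \<le> 1 / 140" "dist z a = d" "d \<le> dist z b" "d / 4 \<le> dist a w"
    and zk: "\<bar>z $ k\<bar> \<le> 71 / 100"
    and \<rho>[measurable]: "\<rho> \<in> borel_measurable borel" and small: "(\<integral>\<^sup>+ x. (\<rho> x)\<^sup>2 \<partial>lborel) < ennreal (1 / 10 ^ 10)"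
  obtains P Q where "P \<in> E" "Q \<in> F" "Lipschitz_joined (cball 0 1) 3 \<rho> (ennreal (4 / 13)) P Q"
proof -
  let ?S = "chord_coord j k"
  \<comment> \<open>The chord coordinates of \<open>a\<close> and \<open>z\<close> differ by at most
    \<open>6 * d\<close>, and the part of \<open>F\<close> used stays within \<open>d\<close> of
    \<open>a\<close> in coordinates: hence \<open>7 * d\<close>. The truncation at -1 and 1 keeps
    the window in the disc, while \<open>d \<le> 1 / 140\<close> keeps the heights below
    \<open>71 / 100 + 1 / 20 < 4 / 5\<close>.\<close>
  define lo where "lo = max (?S z - 7 * d) (-1)"
  define hi where "hi = min (?S z + 7 * d) 1"
  define lo' where "lo' = z $ k - 7 * d"
  define hi' where "hi' = z $ k + 7 * d"
  have zS: "\<bar>?S z\<bar> \<le> 1" using chord_coord_le_1[OF jk, of z] E zb zk by auto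
  have I: "d / 96 \<le> hi - lo" "hi - lo \<le> 14 * d" using zS d(1,2) unfolding lo_def hi_def by linarith+
  have J: "hi' - lo' = 14 * d" by (simp add: lo'_def hi'_def)
  have Iin: "\<bar>s\<bar> \<le> 1" if "s \<in> {lo..hi}" for s using that by (auto simp: lo_def hi_def)
  have Jin: "\<bar>y\<bar> \<le> 4 / 5" if "y \<in> {lo'..hi'}" for y using that zk d by (auto simp: lo'_def hi'_def)
  \<comment> \<open>\<open>V\<close> and \<open>H\<close> are the masses of the two families of grid
    lines; by Fubini both integrate to \<open>tot\<close>, so one estimate of \<open>tot\<close>
    serves both.\<close>
  define V where "V = (\<lambda>s. \<integral>\<^sup>+ y. \<rho> (chart j s y) * indicator {lo'..hi'} y \<partial>lborel)"
  define H where "H = (\<lambda>y. \<integral>\<^sup>+ s. \<rho> (chart j s y) * indicator {lo..hi} s \<partial>lborel)"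
  have [measurable]: "V \<in> borel_measurable borel" "H \<in> borel_measurable borel"
    unfolding V_def H_def by measurable
  define tot where "tot = (\<integral>\<^sup>+ y. H y * indicator {lo'..hi'} y \<partial>lborel)"
  have VH: "(\<integral>\<^sup>+ s. V s * indicator {lo..hi} s \<partial>lborel) = tot"
  proof -
    have "tot = (\<integral>\<^sup>+ y. \<integral>\<^sup>+ s. \<rho> (chart j s y) * indicator {lo..hi} s * indicator {lo'..hi'} y \<partial>lborel \<partial>lborel)"
      unfolding tot_def H_def by (intro nn_integral_cong nn_integral_multc[symmetric]) measurable
    also have "\<dots> = (\<integral>\<^sup>+ s. \<integral>\<^sup>+ y. \<rho> (chart j s y) * indicator {lo..hi} s * indicator {lo'..hi'} y \<partial>lborel \<partial>lborel)"
      by (rule lborel_pair.Fubini') measurable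
    also have "\<dots> = (\<integral>\<^sup>+ s. \<integral>\<^sup>+ y. \<rho> (chart j s y) * indicator {lo'..hi'} y * indicator {lo..hi} s \<partial>lborel \<partial>lborel)"
      by (simp add: mult_ac)
    also have "\<dots> = (\<integral>\<^sup>+ s. V s * indicator {lo..hi} s \<partial>lborel)"
      unfolding V_def by (intro nn_integral_cong nn_integral_multc) measurable
    finally show ?thesis by simp
  qed
  \<comment> \<open>The energy term becomes \<open>d / 10000\<close> and the area term
    \<open>196 * d / 500000\<close>. Their sum is below \<open>d / (13 * 96)\<close>: lines of mass
    at least \<open>1 / 13\<close> cannot fill a set of measure \<open>d / 96\<close>.\<close>
  define l where "l = 500000 * d"
  have l: "l > 0" using d by (simp add: l_def)
  have "tot \<le> ennreal l * (2 * (\<integral>\<^sup>+ x. (\<rho> x)\<^sup>2 \<partial>lborel)) + ennreal (1 / l) * ennreal (14 * d) * ennreal (14 * d)"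
  proof -
    have Hy: "H y \<le> ennreal l * (\<integral>\<^sup>+ s. (\<rho> (chart j s y))\<^sup>2 \<partial>lborel) + ennreal (1 / l) * ennreal (14 * d)" for y
    proof -
      have "H y \<le> (\<integral>\<^sup>+ s. ennreal l * (\<rho> (chart j s y))\<^sup>2 + ennreal (1 / l) * indicator {lo..hi} s \<partial>lborel)"
        unfolding H_def using ennreal_le_weighted_square[OF l]
        by (intro nn_integral_mono) (auto simp: indicator_def)
      also have "\<dots> = ennreal l * (\<integral>\<^sup>+ s. (\<rho> (chart j s y))\<^sup>2 \<partial>lborel) + ennreal (1 / l) * emeasure lborel {lo..hi}"
        by (subst nn_integral_add, measurable) (simp add: nn_integral_cmult nn_integral_cmult_indicator)
      also have "emeasure lborel {lo..hi} \<le> ennreal (14 * d)"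
        using I d by (subst emeasure_lborel_Icc) (auto intro!: ennreal_leI)
      finally show ?thesis by (simp add: add_left_mono mult_left_mono)
    qed
    have "tot \<le> (\<integral>\<^sup>+ y. ennreal l * ((\<integral>\<^sup>+ s. (\<rho> (chart j s y))\<^sup>2 \<partial>lborel) * indicator {lo'..hi'} y) + ennreal (1 / l) * ennreal (14 * d) * indicator {lo'..hi'} y \<partial>lborel)"
      unfolding tot_def using Hy by (intro nn_integral_mono) (auto simp: indicator_def)
    also have "\<dots> = ennreal l * (\<integral>\<^sup>+ y. (\<integral>\<^sup>+ s. (\<rho> (chart j s y))\<^sup>2 \<partial>lborel) * indicator {lo'..hi'} y \<partial>lborel) + ennreal (1 / l) * ennreal (14 * d) * emeasure lborel {lo'..hi'}"
      by (subst nn_integral_add, measurable) (simp add: nn_integral_cmult nn_integral_cmult_indicator)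
    also have "emeasure lborel {lo'..hi'} = ennreal (14 * d)"
      using J d by (subst emeasure_lborel_Icc) auto
    also have "(\<integral>\<^sup>+ y. (\<integral>\<^sup>+ s. (\<rho> (chart j s y))\<^sup>2 \<partial>lborel) * indicator {lo'..hi'} y \<partial>lborel) \<le> 2 * (\<integral>\<^sup>+ x. (\<rho> x)\<^sup>2 \<partial>lborel)"
      using Jin by (intro nn_integral_chart_le) (measurable, fastforce simp: abs_le_iff)
    finally show ?thesis by (simp add: add_right_mono mult_left_mono)
  qed
  also have "\<dots> \<le> ennreal l * (2 * ennreal (1 / 10 ^ 10)) + ennreal (1 / l) * ennreal (14 * d) * ennreal (14 * d)"
    using small by (intro add_right_mono mult_left_mono) auto
  also have "\<dots> = ennreal (l * (2 * (1 / 10 ^ 10)) + 1 / l * (14 * d) * (14 * d))"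
  proof -
    have "ennreal l * ennreal c + ennreal (1 / l) * ennreal e * ennreal e = ennreal (l * c + 1 / l * e * e)"
      if "0 \<le> c" "0 \<le> e" for c e
      using l that by (simp flip: ennreal_mult ennreal_plus)
    moreover have "2 * ennreal (1 / 10 ^ 10) = ennreal (2 * (1 / 10 ^ 10))"
      using ennreal_mult[of 2 "1 / 10 ^ 10"] by simp
    ultimately show ?thesis using d(1) by simp
  qed
  also have "\<dots> < ennreal (1 / 13 * (d / 96))"
    using d by (intro ennreal_lessI) (auto simp: l_def field_simps)
  also have "\<dots> = ennreal (1 / 13) * ennreal (d / 96)" using d(1) by (intro ennreal_mult) auto
  finally have tot: "tot < ennreal (1 / 13) * ennreal (d / 96)" .
  have goodV: "\<exists>s\<in>A. V s < ennreal (1 / 13)" if A: "A \<in> sets borel" "A \<subseteq> {lo..hi}" "ennreal (d / 96) \<le> emeasure lborel A" for A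
  proof -
    have "(\<integral>\<^sup>+ s. V s * indicator A s \<partial>lborel) \<le> tot"
      unfolding VH[symmetric] using A by (intro nn_integral_mono) (auto simp: indicator_def)
    also have "\<dots> < ennreal (1 / 13) * ennreal (d / 96)" by (rule tot)
    also have "\<dots> \<le> ennreal (1 / 13) * emeasure lborel A" using A by (intro mult_left_mono) auto
    finally show ?thesis using nn_integral_less_obtain[OF A(1)] by metis
  qed
  have goodH: "\<exists>y\<in>A. H y < ennreal (1 / 13)" if A: "A \<in> sets borel" "A \<subseteq> {lo'..hi'}" "ennreal (d / 96) \<le> emeasure lborel A" for A
  proof -
    have "(\<integral>\<^sup>+ s. H s * indicator A s \<partial>lborel) \<le> tot"
      unfolding tot_def using A by (intro nn_integral_mono) (auto simp: indicator_def)
    also have "\<dots> < ennreal (1 / 13) * ennreal (d / 96)" by (rule tot)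
    also have "\<dots> \<le> ennreal (1 / 13) * emeasure lborel A" using A by (intro mult_left_mono) auto
    finally show ?thesis using nn_integral_less_obtain[OF A(1)] by metis
  qed
  obtain s0 where s0: "s0 \<in> {lo..hi}" "V s0 < ennreal (1 / 13)"
    using goodV[of "{lo..hi}"] I d by (auto simp: ennreal_leI)
  obtain y0 where y0: "y0 \<in> {lo'..hi'}" "H y0 < ennreal (1 / 13)"
    using goodH[of "{lo'..hi'}"] J d by (auto simp: ennreal_leI)
  have vert: "Lipschitz_joined (cball 0 1) 3 \<rho> (ennreal (1 / 13)) (chart j s y) (chart j s y')"
    if "s \<in> {lo..hi}" "V s < ennreal (1 / 13)" "y \<in> {lo'..hi'}" "y' \<in> {lo'..hi'}" for s y y'
  proof (rule Lipschitz_joined_line[where a = lo' and b = hi' and c = "chart j s"])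
    show "(\<integral>\<^sup>+ t. \<rho> (chart j s t) * indicator {lo'..hi'} t \<partial>lborel) \<le> ennreal (1 / 13)"
      using that(2) by (simp add: V_def)
    show "chart j s ` {lo'..hi'} \<subseteq> cball 0 1"
      using chart_in_disc[OF jk Iin[OF that(1)] Jin] by blast
    show "dist (chart j s x) (chart j s x') \<le> 3 * \<bar>x - x'\<bar>" if "x \<in> {lo'..hi'}" "x' \<in> {lo'..hi'}" for x x'
      by (rule dist_chart_snd[OF jk Iin[OF \<open>s \<in> {lo..hi}\<close>] Jin[OF that(1)] Jin[OF that(2)]])
  qed (use that in auto)
  have horiz: "Lipschitz_joined (cball 0 1) 3 \<rho> (ennreal (1 / 13)) (chart j s y) (chart j s' y)"
    if "y \<in> {lo'..hi'}" "H y < ennreal (1 / 13)" "s \<in> {lo..hi}" "s' \<in> {lo..hi}" for s s' y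
  proof (rule Lipschitz_joined_line[where a = lo and b = hi and c = "\<lambda>s. chart j s y"])
    show "(\<integral>\<^sup>+ t. \<rho> (chart j t y) * indicator {lo..hi} t \<partial>lborel) \<le> ennreal (1 / 13)"
      using that(2) by (simp add: H_def)
    show "(\<lambda>s. chart j s y) ` {lo..hi} \<subseteq> cball 0 1"
      using chart_in_disc[OF jk Iin Jin[OF that(1)]] by blast
    show "dist (chart j x y) (chart j x' y) \<le> 3 * \<bar>x - x'\<bar>" for x x'
      by (rule order_trans[OF dist_chart_fst[OF jk Jin[OF that(1)]]]) simp
  qed (use that in auto)
  \<comment> \<open>A large projection contains the coordinate of a light line. That line meets
    \<open>E'\<close> at some \<open>P\<close> and crosses the fixed light line of the other family,
    \<open>y0\<close> or \<open>s0\<close>, along which the path continues.\<close>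
  have access: "\<exists>P\<in>E'. Lipschitz_joined (cball 0 1) 3 \<rho> (ennreal (1 / 13) + ennreal (1 / 13)) P (chart j s0 y0)"
    if E': "?S ` E' \<in> sets borel" "(\<lambda>e. e $ k) ` E' \<in> sets borel" "?S ` E' \<subseteq> {lo..hi}" "(\<lambda>e. e $ k) ` E' \<subseteq> {lo'..hi'}"
      and large: "ennreal (d / 96) \<le> emeasure lborel (?S ` E') \<or> ennreal (d / 96) \<le> emeasure lborel ((\<lambda>e. e $ k) ` E')" for E'
    using large
  proof
    assume "ennreal (d / 96) \<le> emeasure lborel (?S ` E')"
    then obtain P where P: "P \<in> E'" "V (?S P) < ennreal (1 / 13)" using goodV[OF E'(1,3)] by auto
    then have in_IJ: "?S P \<in> {lo..hi}" "P $ k \<in> {lo'..hi'}" using E' by blast+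
    have "P = chart j (?S P) (P $ k)" using chart_chord_coord[OF jk Jin[OF in_IJ(2)]] by simp
    then have "Lipschitz_joined (cball 0 1) 3 \<rho> (ennreal (1 / 13)) P (chart j (?S P) y0)"
      using vert[OF in_IJ(1) P(2) in_IJ(2) y0(1)] by simp
    from Lipschitz_joined_trans[OF this horiz[OF y0 in_IJ(1) s0(1)]] P(1) show ?thesis by auto
  next
    assume "ennreal (d / 96) \<le> emeasure lborel ((\<lambda>e. e $ k) ` E')"
    then obtain P where P: "P \<in> E'" "H (P $ k) < ennreal (1 / 13)" using goodH[OF E'(2,4)] by auto
    then have in_IJ: "?S P \<in> {lo..hi}" "P $ k \<in> {lo'..hi'}" using E' by blast+
    have "P = chart j (?S P) (P $ k)" using chart_chord_coord[OF jk Jin[OF in_IJ(2)]] by simp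
    then have "Lipschitz_joined (cball 0 1) 3 \<rho> (ennreal (1 / 13)) P (chart j s0 (P $ k))"
      using horiz[OF in_IJ(2) P(2) in_IJ(1) s0(1)] by simp
    from Lipschitz_joined_trans[OF this vert[OF s0 in_IJ(2) y0(1)]] P(1) show ?thesis by auto
  qed
  have close: "?S e \<in> {lo..hi} \<and> e $ k \<in> {lo'..hi'}"
    if "e \<in> cball 0 1" "\<bar>?S e - ?S z\<bar> \<le> 7 * d" "\<bar>e $ k - z $ k\<bar> \<le> 7 * d" for e
  proof -
    have "e $ k \<in> {lo'..hi'}" using that(3) by (auto simp: lo'_def hi'_def)
    moreover have "\<bar>?S e\<bar> \<le> 1" using chord_coord_le_1[OF jk that(1) Jin[OF \<open>e $ k \<in> _\<close>]] .
    ultimately show ?thesis using that(2) by (auto simp: lo_def hi_def)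
  qed
  have "\<exists>P\<in>E. Lipschitz_joined (cball 0 1) 3 \<rho> (ennreal (1 / 13) + ennreal (1 / 13)) P (chart j s0 y0)"
  proof -
    obtain E' where E': "E' \<subseteq> E" "\<And>e. e \<in> E' \<Longrightarrow> \<bar>?S e - ?S z\<bar> \<le> d / 6 \<and> \<bar>e $ k - z $ k\<bar> \<le> d / 6"
      "?S ` E' \<in> sets borel" "(\<lambda>e. e $ k) ` E' \<in> sets borel"
      "ennreal (d / 24) \<le> emeasure lborel (?S ` E') \<or> ennreal (d / 24) \<le> emeasure lborel ((\<lambda>e. e $ k) ` E')"
      by (rule continuum_projection[OF E zb(1) _ zb(2) d(1)]) (use zk d in auto)
    have "?S e \<in> {lo..hi} \<and> e $ k \<in> {lo'..hi'}" if "e \<in> E'" for e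
      using E'(1,2) E(1) that d(1) by (intro close) (auto dest: E'(2))
    moreover have "ennreal (d / 96) \<le> ennreal (d / 24)" using d by (intro ennreal_leI) auto
    ultimately have "\<exists>P\<in>E'. Lipschitz_joined (cball 0 1) 3 \<rho> (ennreal (1 / 13) + ennreal (1 / 13)) P (chart j s0 y0)"
      using E'(3-5) by (intro access) (auto intro: order_trans)
    then show ?thesis using E'(1) by blast
  qed
  then obtain P where P: "P \<in> E" "Lipschitz_joined (cball 0 1) 3 \<rho> (ennreal (1 / 13) + ennreal (1 / 13)) P (chart j s0 y0)" by blast
  have "\<exists>P\<in>F. Lipschitz_joined (cball 0 1) 3 \<rho> (ennreal (1 / 13) + ennreal (1 / 13)) P (chart j s0 y0)"
  proof -
    have az: "\<bar>a $ k - z $ k\<bar> \<le> d" using component_le_norm_cart[of "a - z" k] d(3) by (simp add: dist_norm norm_minus_commute)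
    then have ak: "\<bar>a $ k\<bar> \<le> 3 / 4" using zk d by linarith
    have aS: "\<bar>?S a - ?S z\<bar> \<le> 6 * d"
      using chord_coord_Lipschitz[OF jk, of a z] F aw ak zk d(3) by (auto simp: dist_commute)
    \<comment> \<open>For \<open>F\<close> only \<open>dist a w \<ge> d / 4\<close> is available;
      \<open>d / 4 / 24\<close> is the origin of the threshold \<open>d / 96\<close>.\<close>
    obtain E' where E': "E' \<subseteq> F" "\<And>e. e \<in> E' \<Longrightarrow> \<bar>?S e - ?S a\<bar> \<le> d / 4 / 6 \<and> \<bar>e $ k - a $ k\<bar> \<le> d / 4 / 6"
      "?S ` E' \<in> sets borel" "(\<lambda>e. e $ k) ` E' \<in> sets borel"
      "ennreal (d / 4 / 24) \<le> emeasure lborel (?S ` E') \<or> ennreal (d / 4 / 24) \<le> emeasure lborel ((\<lambda>e. e $ k) ` E')"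
      by (rule continuum_projection[OF F aw(1) ak aw(2), of "d / 4"]) (use d in auto)
    have "?S e \<in> {lo..hi} \<and> e $ k \<in> {lo'..hi'}" if "e \<in> E'" for e
    proof (rule close)
      show "e \<in> cball 0 1" using that E'(1) F(1) by blast
      show "\<bar>?S e - ?S z\<bar> \<le> 7 * d" using E'(2)[OF that] aS d(1) by linarith
      show "\<bar>e $ k - z $ k\<bar> \<le> 7 * d" using E'(2)[OF that] az d(1) by linarith
    qed
    then have "\<exists>P\<in>E'. Lipschitz_joined (cball 0 1) 3 \<rho> (ennreal (1 / 13) + ennreal (1 / 13)) P (chart j s0 y0)"
      using E'(3-5) by (intro access) auto
    then show ?thesis using E'(1) by blast
  qed
  then obtain Q where Q: "Q \<in> F" "Lipschitz_joined (cball 0 1) 3 \<rho> (ennreal (1 / 13) + ennreal (1 / 13)) Q (chart j s0 y0)" by blast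
  have "Lipschitz_joined (cball 0 1) 3 \<rho> (ennreal (1 / 13) + ennreal (1 / 13) + (ennreal (1 / 13) + ennreal (1 / 13))) P Q"
    by (rule Lipschitz_joined_trans[OF P(2) Lipschitz_joined_sym[OF Q(2)]]) (auto intro: \<rho>)
  then show ?thesis using that P(1) Q(1) by (simp flip: ennreal_plus)
qed

end

text \<open>The curves of the family need not start in \<open>E\<close> and end in \<open>F\<close>: meeting both is all that is needed
  to make their images cross an annulus.\<close>

lemma disc_Loewner:
  fixes E F :: "(real^2) set"
  assumes E: "E \<subseteq> cball 0 1" "compact E" "connected E" and zb: "z \<in> E" "b \<in> E"
    and F: "F \<subseteq> cball 0 1" "compact F" "connected F" and aw: "a \<in> F" "w \<in> F"
    and d: "0 < dist z a" "dist z a \<le> 1 / 140" "dist z a \<le> dist z b" "dist z a / 4 \<le> dist a w"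
  shows "ennreal (1 / 10 ^ 10) \<le> modulus (restrict_space lebesgue (cball 0 1)) (cball 0 1)
    {c. curve_in (cball 0 1) c \<and> (\<exists>t\<in>fst c. snd c t \<in> E) \<and> (\<exists>t\<in>fst c. snd c t \<in> F)}"
  unfolding modulus_def
proof (rule INF_greatest, rule ccontr, clarify)
  let ?D = "cball (0 :: real^2) 1"
  fix \<rho> :: "real^2 \<Rightarrow> ennreal"
  assume \<rho>: "\<rho> \<in> borel_measurable (restrict_space borel ?D)"
    and adm: "\<forall>c\<in>{c. curve_in ?D c \<and> (\<exists>t\<in>fst c. snd c t \<in> E) \<and> (\<exists>t\<in>fst c. snd c t \<in> F)}. locally_rectifiable c \<longrightarrow> 1 \<le> line_integral \<rho> c"
    and not_le: "\<not> ennreal (1 / 10 ^ 10) \<le> (\<integral>\<^sup>+ y. (\<rho> y)\<^sup>2 \<partial>restrict_space lebesgue ?D)"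
  \<comment> \<open>Extension by 0 turns \<open>\<rho>\<close> into a Borel function on the plane,
    as the integrals along charts require.\<close>
  define r where "r = (\<lambda>x. \<rho> x * indicator ?D x)"
  have r[measurable]: "r \<in> borel_measurable borel"
    using \<rho> unfolding r_def by (subst (asm) borel_measurable_restrict_space_iff_ennreal) auto
  have "(\<integral>\<^sup>+ x. (r x)\<^sup>2 \<partial>lborel) = (\<integral>\<^sup>+ x. (\<rho> x)\<^sup>2 * indicator ?D x \<partial>lborel)"
    by (intro nn_integral_cong) (auto simp: r_def indicator_def)
  also have "\<dots> = (\<integral>\<^sup>+ x. (\<rho> x)\<^sup>2 * indicator ?D x \<partial>lebesgue)" by (simp add: nn_integral_completion)
  also have "\<dots> = (\<integral>\<^sup>+ y. (\<rho> y)\<^sup>2 \<partial>restrict_space lebesgue ?D)"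
    by (rule nn_integral_restrict_space[symmetric]) auto
  finally have small: "(\<integral>\<^sup>+ x. (r x)\<^sup>2 \<partial>lborel) < ennreal (1 / 10 ^ 10)" using not_le by simp
  \<comment> \<open>\<open>71 / 100\<close> is slightly above \<open>1 / sqrt 2\<close>: two larger
    coordinates would give a norm above 1.\<close>
  obtain j k :: 2 where jk: "j \<noteq> k" and zk: "\<bar>z $ k\<bar> \<le> 71 / 100"
  proof -
    have ne: "(1 :: 2) \<noteq> 2" by simp
    have "norm z \<le> 1" using E zb by auto
    then have "(norm z)\<^sup>2 \<le> 1" by (simp add: power_le_one)
    then have "(z $ 1)\<^sup>2 + (z $ 2)\<^sup>2 \<le> 1" unfolding norm_sq_coords[OF ne] .
    moreover have *: "(71 / 100)\<^sup>2 < x\<^sup>2" if "\<not> \<bar>x\<bar> \<le> 71 / 100" for x :: real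
      using that power_strict_mono[of "71 / 100" "\<bar>x\<bar>" 2] by simp
    ultimately have "\<bar>z $ 1\<bar> \<le> 71 / 100 \<or> \<bar>z $ 2\<bar> \<le> 71 / 100"
    proof -
      assume le: "(z $ 1)\<^sup>2 + (z $ 2)\<^sup>2 \<le> 1"
      have "1 < (71 / 100 :: real)\<^sup>2 + (71 / 100)\<^sup>2" by (simp add: power2_eq_square)
      then show ?thesis using le *[of "z $ 1"] *[of "z $ 2"] by fastforce
    qed
    then show thesis using that[of 2 1] that[of 1 2] ne by auto
  qed
  obtain P Q where PQ: "P \<in> E" "Q \<in> F" "Lipschitz_joined ?D 3 r (ennreal (4 / 13)) P Q"
    by (rule chart_crossing[OF jk E zb F aw d(1,2) refl d(3,4) zk r small])
  then obtain T f where f: "T \<ge> 0" "f 0 = P" "f T = Q" "\<And>s t. s \<in> {0..T} \<Longrightarrow> t \<in> {0..T} \<Longrightarrow> dist (f s) (f t) \<le> 3 * \<bar>s - t\<bar>"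
    "f ` {0..T} \<subseteq> ?D" "(\<integral>\<^sup>+ t. r (f t) * indicator {0..T} t \<partial>lborel) \<le> ennreal (4 / 13)"
    unfolding Lipschitz_joined_def by blast
  have "continuous_on {0..T} f"
    by (rule lipschitz_on_continuous_on, rule lipschitz_onI[of _ _ 3]) (use f(4) in \<open>auto simp: dist_real_def\<close>)
  then have "curve_in ?D ({0..T}, f)" using f by (simp add: curve_in_def)
  moreover have "\<exists>t\<in>fst ({0..T}, f). snd ({0..T}, f) t \<in> E" "\<exists>t\<in>fst ({0..T}, f). snd ({0..T}, f) t \<in> F"
  proof -
    show "\<exists>t\<in>fst ({0..T}, f). snd ({0..T}, f) t \<in> E" using f PQ by (intro bexI[of _ 0]) auto
    show "\<exists>t\<in>fst ({0..T}, f). snd ({0..T}, f) t \<in> F" using f PQ by (intro bexI[of _ T]) auto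
  qed
  moreover have "locally_rectifiable ({0..T}, f)"
    unfolding locally_rectifiable_def
  proof (intro allI impI)
    fix s t assume st: "s \<le> t \<and> {s..t} \<subseteq> fst ({0..T}, f)"
    have "curve_length f s t \<le> ennreal (3 * (t - s))"
      by (rule curve_length_Lipschitz) (use st f(4) in auto)
    then show "curve_length (snd ({0..T}, f)) s t < \<infinity>" by (auto intro: le_less_trans)
  qed
  ultimately have "1 \<le> line_integral \<rho> ({0..T}, f)" using adm by auto
  also have "\<dots> \<le> ennreal 3 * (\<integral>\<^sup>+ t. \<rho> (f t) * indicator {0..T} t \<partial>lborel)"
    by (rule line_integral_Lipschitz_le[OF _ f(4,5) \<rho>]) auto
  also have "(\<integral>\<^sup>+ t. \<rho> (f t) * indicator {0..T} t \<partial>lborel) = (\<integral>\<^sup>+ t. r (f t) * indicator {0..T} t \<partial>lborel)"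
    using f(5) by (intro nn_integral_cong) (auto simp: r_def indicator_def image_subset_iff)
  \<comment> \<open>Four light lines of mass below \<open>1 / 13\<close>, travelled with Lipschitz
    constant 3, give at most \<open>12 / 13\<close>, less than admissibility demands.\<close>
  also have "ennreal 3 * \<dots> \<le> ennreal 3 * ennreal (4 / 13)" using f(6) by (intro mult_left_mono) auto
  also have "\<dots> = ennreal (3 * (4 / 13))" by (rule ennreal_mult[symmetric]) auto
  also have "\<dots> < 1" by (simp add: ennreal_less_one_iff)
  finally show False by simp
qed

section \<open>Modulus of curves crossing an annulus\<close>

lemma hausdorff2_outer_mono: "A \<subseteq> B \<Longrightarrow> hausdorff2_outer A \<le> hausdorff2_outer B"
  unfolding hausdorff2_outer_def hausdorff2_delta_def
  by (intro SUP_mono' INF_superset_mono) auto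

lemma space_hausdorff2_measure [simp]: "space (hausdorff2_measure Y) = Y"
  unfolding hausdorff2_measure_def by (rule space_measure_of) (auto simp: sets_restrict_space)

lemma sets_hausdorff2_measure: "B \<in> sets borel \<Longrightarrow> Y \<inter> B \<in> sets (hausdorff2_measure Y)"
  unfolding hausdorff2_measure_def
  by (subst sets_measure_of) (auto simp: sets_restrict_space intro: sigma_sets.Basic)

text \<open>No measure space property is needed for an upper bound: if \<^const>\<open>hausdorff2_outer\<close> were
  not countably additive, \<^const>\<open>measure_of\<close> would yield the zero measure.\<close>

lemma emeasure_hausdorff2_le: "emeasure (hausdorff2_measure Y) A \<le> hausdorff2_outer A"
  unfolding hausdorff2_measure_def
  by (subst emeasure_measure_of_conv) (auto simp: sets_restrict_space)

text \<open>Squared weight times measure is at most \<open>4 * L / n\<^sup>2\<close> on each of the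
  \<open>n\<close> dyadic shells, because quadratic growth cancels the decay of the weight. The
  bound thus decays like the inverse logarithm of the ratio of the radii.\<close>

lemma modulus_annulus_le:
  fixes X :: "'a::metric_space set"
  assumes x0: "x0 \<in> X" and L: "L > 0"
    and growth: "\<forall>x\<in>X. \<forall>r>0. hausdorff2_outer (ball x r \<inter> X) \<le> ennreal (L * r\<^sup>2)"
    and r: "r > 0" and n: "n > (0::nat)"
    and \<Gamma>: "\<And>c. c \<in> \<Gamma> \<Longrightarrow> curve_in X c \<and> (\<exists>s\<in>fst c. dist x0 (snd c s) \<le> r) \<and> (\<exists>t\<in>fst c. 2 ^ n * r \<le> dist x0 (snd c t))"
  shows "modulus (hausdorff2_measure X) X \<Gamma> \<le> ennreal (4 * L / n)"
proof -
  \<comment> \<open>dyadic version of the extremal weight \<open>1 / (dist x0 y * ln (R / r))\<close>\<close>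
  define w where "w = (\<lambda>k::nat. 1 / (n * (2 ^ k * r)))"
  define A where "A = (\<lambda>k::nat. {2 ^ k * r..<2 ^ Suc k * r})"
  define \<phi> :: "real \<Rightarrow> ennreal" where "\<phi> = (\<lambda>x. \<Sum>k<n. ennreal (w k) * indicator (A k) x)"
  have w: "w k \<ge> 0" for k using r by (simp add: w_def)
  have [measurable]: "A k \<in> sets borel" for k by (simp add: A_def)
  have \<phi>[measurable]: "\<phi> \<in> borel_measurable borel" unfolding \<phi>_def by measurable
  have disj: "x \<notin> A k" if "x \<in> A l" "k \<noteq> l" for x k l
  proof -
    have *: "x \<notin> A k" if "x \<in> A l" "k < l" for x k l
    proof -
      have "(2::real) ^ Suc k * r \<le> 2 ^ l * r" using that r by (intro mult_right_mono power_increasing) auto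
      then show ?thesis using that by (auto simp: A_def)
    qed
    show ?thesis using *[of x l k] *[of x k l] that by (metis linorder_neqE_nat)
  qed
  \<comment> \<open>The shells are half-open and hence disjoint, so at most one summand is nonzero
    and squaring commutes with the sum.\<close>
  have sq: "(\<phi> x)\<^sup>2 = (\<Sum>k<n. ennreal ((w k)\<^sup>2) * indicator (A k) x)" for x
  proof (cases "\<exists>l<n. x \<in> A l")
    case True
    then obtain l where l: "l < n" "x \<in> A l" by blast
    have ind: "indicator (A k) x = (if k = l then 1 else 0 :: ennreal)" for k
      using disj[of x l k] l by (auto simp: indicator_def)
    show ?thesis unfolding \<phi>_def ind using l w by (simp add: if_distrib ennreal_power cong: if_cong)
  next
    case False
    then show ?thesis by (auto simp: \<phi>_def)
  qed
  define \<rho> where "\<rho> = (\<lambda>y. \<phi> (dist x0 y))"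
  have meas: "\<rho> \<in> borel_measurable (restrict_space borel X)"
  proof -
    have "(\<lambda>y. dist x0 y) \<in> borel_measurable borel"
      by (intro borel_measurable_continuous_onI continuous_intros)
    from measurable_compose[OF this \<phi>] show ?thesis
      unfolding \<rho>_def by (rule measurable_restrict_space1)
  qed
  have int_\<phi>: "(\<integral>\<^sup>+ x. \<phi> x \<partial>lborel) = 1"
  proof -
    have "(\<integral>\<^sup>+ x. \<phi> x \<partial>lborel) = (\<Sum>k<n. ennreal (w k) * emeasure lborel (A k))"
      unfolding \<phi>_def by (subst nn_integral_sum) (auto simp: nn_integral_cmult_indicator)
    also have "\<dots> = (\<Sum>k<n. ennreal (1 / n))"
    proof (rule sum.cong[OF refl])
      fix k
      have "emeasure lborel (A k) = ennreal (2 ^ k * r)" using r by (simp add: A_def)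
      then have "ennreal (w k) * emeasure lborel (A k) = ennreal (w k * (2 ^ k * r))"
        using w r by (simp add: ennreal_mult)
      also have "w k * (2 ^ k * r) = 1 / n" using r by (simp add: w_def)
      finally show "ennreal (w k) * emeasure lborel (A k) = ennreal (1 / n)" .
    qed
    also have "\<dots> = 1"
      using n by (simp add: ennreal_of_nat_eq_real_of_nat flip: ennreal_mult)
    finally show ?thesis .
  qed
  have adm: "1 \<le> line_integral \<rho> c" if c: "c \<in> \<Gamma>" "locally_rectifiable c" for c
  proof -
    obtain I g where cIg: "c = (I, g)" by (cases c)
    have I: "is_interval I" "continuous_on I g" using \<Gamma>[OF c(1)] by (auto simp: cIg curve_in_def)
    obtain s t where st: "s \<in> I" "t \<in> I" "dist x0 (g s) \<le> r" "2 ^ n * r \<le> dist x0 (g t)"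
      using \<Gamma>[OF c(1)] by (auto simp: cIg)
    define a b where "a = min s t" and "b = max s t"
    have "a \<in> I" "b \<in> I" using st(1,2) by (auto simp: a_def b_def min_def max_def)
    then have "x \<in> I" if "x \<in> {a..b}" for x
      using mem_is_interval_1_I[OF I(1), of a b x] that by simp
    then have "{a..b} \<subseteq> I" by blast
    then have ab: "a \<le> b" "{a..b} \<subseteq> I" "s \<in> {a..b}" "t \<in> {a..b}"
      unfolding a_def b_def by simp_all
    have "curve_length g a b < \<infinity>" using c(2) ab by (auto simp: locally_rectifiable_def cIg)
    then interpret rectifiable_arc g a b
      using ab continuous_on_subset[OF I(2)] by unfold_locales auto
    \<comment> \<open>The curve attains every distance between \<open>r\<close> and
      \<open>2 ^ n * r\<close>, so it collects the full integral of \<open>\<phi>\<close>, which is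
      1.\<close>
    have "connected (dist x0 ` g ` {a..b})"
      by (intro connected_continuous_image cont continuous_intros) auto
    then have img: "{r..2 ^ n * r} \<subseteq> dist x0 ` g ` {a..b}"
      using st ab(3,4) by (meson atLeastatMost_subset_iff connected_contains_Icc imageI order_trans)
    have "\<phi> x \<le> \<phi> x * indicator (dist x0 ` g ` {a..b}) x" for x
    proof (cases "x \<in> {r..2 ^ n * r}")
      case True
      then show ?thesis using img by (auto simp: indicator_def)
    next
      case False
      have "x \<notin> A k" if "k < n" for k
      proof
        assume x: "x \<in> A k"
        have "(1::real) * r \<le> 2 ^ k * r" "(2::real) ^ Suc k * r \<le> 2 ^ n * r"
          using that r by (auto intro!: mult_right_mono power_increasing simp del: power_Suc)
        then show False using x False by (auto simp: A_def)
      qed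
      then have "\<phi> x = 0" unfolding \<phi>_def by (intro sum.neutral) auto
      then show ?thesis by simp
    qed
    then have "1 \<le> (\<integral>\<^sup>+ x. \<phi> x * indicator (dist x0 ` g ` {a..b}) x \<partial>lborel)"
      unfolding int_\<phi>[symmetric] by (intro nn_integral_mono)
    also have "\<dots> \<le> line_integral_compact \<rho> g a b"
      unfolding \<rho>_def by (rule line_integral_compact_ge[OF _ \<phi>]) (metis abs_dist_diff_le dist_commute)
    also have "\<dots> \<le> line_integral \<rho> c"
      unfolding line_integral_def using ab
      by (intro SUP_upper2[of "(a, b)"]) (auto simp: cIg)
    finally show ?thesis .
  qed
  let ?M = "hausdorff2_measure X"
  define B where "B = (\<lambda>k. X \<inter> {y. dist x0 y \<in> A k})"
  have B: "B k \<in> sets ?M" for k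
  proof -
    have "(\<lambda>y. dist x0 y) \<in> borel_measurable borel"
      by (intro borel_measurable_continuous_onI continuous_intros)
    then have "{y. dist x0 y \<in> A k} \<in> sets borel"
      using measurable_sets_borel[of "\<lambda>y. dist x0 y" borel "A k"] by (auto simp: vimage_def)
    then show ?thesis unfolding B_def by (rule sets_hausdorff2_measure)
  qed
  have term_le: "ennreal ((w k)\<^sup>2) * emeasure ?M (B k) \<le> ennreal (4 * L / n\<^sup>2)" for k
  proof -
    have "B k \<subseteq> ball x0 (2 ^ Suc k * r) \<inter> X" by (auto simp: B_def A_def)
    then have "emeasure ?M (B k) \<le> hausdorff2_outer (ball x0 (2 ^ Suc k * r) \<inter> X)"
      by (meson emeasure_hausdorff2_le hausdorff2_outer_mono order_trans)
    also have "\<dots> \<le> ennreal (L * (2 ^ Suc k * r)\<^sup>2)" using growth x0 r by auto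
    finally have "ennreal ((w k)\<^sup>2) * emeasure ?M (B k) \<le> ennreal ((w k)\<^sup>2) * ennreal (L * (2 ^ Suc k * r)\<^sup>2)"
      by (rule mult_left_mono) simp
    also have "\<dots> = ennreal ((w k)\<^sup>2 * (L * (2 ^ Suc k * r)\<^sup>2))"
      using L by (intro ennreal_mult[symmetric]) auto
    also have "(w k)\<^sup>2 * (L * (2 ^ Suc k * r)\<^sup>2) = 4 * L / n\<^sup>2"
      using r n by (simp add: w_def field_simps power2_eq_square)
    finally show ?thesis .
  qed
  have "modulus ?M X \<Gamma> \<le> (\<integral>\<^sup>+ y. (\<rho> y)\<^sup>2 \<partial>?M)"
    unfolding modulus_def using meas adm by (intro INF_lower) auto
  also have "\<dots> = (\<integral>\<^sup>+ y. (\<Sum>k<n. ennreal ((w k)\<^sup>2) * indicator (B k) y) \<partial>?M)"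
    unfolding \<rho>_def sq by (intro nn_integral_cong sum.cong refl) (auto simp: B_def indicator_def)
  also have "\<dots> = (\<Sum>k<n. ennreal ((w k)\<^sup>2) * emeasure ?M (B k))"
    using B by (subst nn_integral_sum) (auto simp: nn_integral_cmult_indicator)
  also have "\<dots> \<le> (\<Sum>k<n. ennreal (4 * L / n\<^sup>2))" by (intro sum_mono term_le)
  also have "\<dots> = ennreal (n * (4 * L / n\<^sup>2))"
    using L by (simp add: ennreal_of_nat_eq_real_of_nat flip: ennreal_mult)
  also have "n * (4 * L / n\<^sup>2) = 4 * L / n" using n by (simp add: power2_eq_square)
  finally show ?thesis .
qed

section \<open>Quasisymmetry from the modulus inequality\<close>

text \<open>Both continua have size at least comparable to \<open>dist z a\<close>: the first
  contains \<open>z\<close> and \<open>b\<close>, the second runs from \<open>a\<close> to a point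
  \<open>w\<close> at distance at least 1 from \<open>z\<close>. This is the position in which the
  lower modulus bound applies. Its absolute constant forces a bound on the ratio of the radii in
  \<open>X\<close>.\<close>

lemma modulus_LLC_imp_weakly_quasisymmetric:
  fixes X :: "'a::metric_space set" and u :: "real^2 \<Rightarrow> 'a"
  assumes L: "L > 0"
    and growth: "\<forall>x\<in>X. \<forall>r>0. hausdorff2_outer (ball x r \<inter> X) \<le> ennreal (L * r\<^sup>2)"
    and Q: "Q \<ge> 1"
    and hom: "homeomorphism (cball (0::real^2) 1) X u v"
    and modineq: "\<forall>\<Gamma>. (\<forall>c\<in>\<Gamma>. curve_in (cball (0::real^2) 1) c) \<longrightarrow>
        modulus (restrict_space lebesgue (cball (0::real^2) 1)) (cball 0 1) \<Gamma>
          \<le> ennreal Q * modulus (hausdorff2_measure X) X (compose_family u \<Gamma>)"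
    and LLC: "linearly_locally_connected X"
  obtains H where "H \<ge> 1" "\<And>z a b. z \<in> cball 0 1 \<Longrightarrow> a \<in> cball 0 1 \<Longrightarrow> b \<in> cball 0 1 \<Longrightarrow> dist z a \<le> dist z b \<Longrightarrow>
    dist (u z) (u a) \<le> H * dist (u z) (u b)"
proof -
  let ?D = "cball (0::real^2) 1"
  have cont_u: "continuous_on ?D u" and cont_v: "continuous_on X v" and uD: "u ` ?D = X" and vX: "v ` X = ?D"
    and vu: "\<And>x. x \<in> ?D \<Longrightarrow> v (u x) = x" and uv: "\<And>y. y \<in> X \<Longrightarrow> u (v y) = y"
    using hom by (auto simp: homeomorphism_def)
  have uX: "u x \<in> X" if "x \<in> ?D" for x using uD that by blast
  have "compact X" using compact_continuous_image[OF cont_u] uD by simp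
  \<comment> \<open>Uniform continuity of \<open>v\<close>, read contrapositively.\<close>
  have far: "\<exists>m>0. \<forall>x\<in>?D. \<forall>y\<in>?D. e \<le> dist x y \<longrightarrow> m \<le> dist (u x) (u y)" if "e > 0" for e
  proof -
    have "uniformly_continuous_on X v" using cont_v \<open>compact X\<close> by (rule compact_uniformly_continuous)
    then obtain m where m: "m > 0" "\<And>x y. x \<in> X \<Longrightarrow> y \<in> X \<Longrightarrow> dist x y < m \<Longrightarrow> dist (v x) (v y) < e"
      using \<open>e > 0\<close> unfolding uniformly_continuous_on_def by metis
    have "m \<le> dist (u x) (u y)" if "x \<in> ?D" "y \<in> ?D" "e \<le> dist x y" for x y
      using m(2)[OF uX[OF that(1)] uX[OF that(2)]] that vu by force
    then show ?thesis using m(1) by blast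
  qed
  obtain m1 where m1: "m1 > 0" "\<And>x y. x \<in> ?D \<Longrightarrow> y \<in> ?D \<Longrightarrow> 1 \<le> dist x y \<Longrightarrow> m1 \<le> dist (u x) (u y)"
    using far[of 1] by auto
  have "uniformly_continuous_on ?D u" using cont_u by (intro compact_uniformly_continuous) auto
  then obtain \<delta> where \<delta>: "\<delta> > 0" "\<And>x y. x \<in> ?D \<Longrightarrow> y \<in> ?D \<Longrightarrow> dist x y < \<delta> \<Longrightarrow> dist (u x) (u y) < m1"
    using m1(1) unfolding uniformly_continuous_on_def by metis
  \<comment> \<open>Below \<open>\<delta>\<close> the image distance stays below \<open>m1\<close>,
    so \<open>u w\<close> is outside the ball of radius \<open>s\<close>; \<open>1 / 140\<close> is
    the scale limit of \<open>disc_Loewner\<close>.\<close>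
  define \<delta>0 where "\<delta>0 = min (\<delta> / 2) (1 / 140)"
  have \<delta>0: "\<delta>0 > 0" "\<delta>0 < \<delta>" "\<delta>0 \<le> 1 / 140" using \<delta>(1) by (auto simp: \<delta>0_def)
  obtain m2 where m2: "m2 > 0" "\<And>x y. x \<in> ?D \<Longrightarrow> y \<in> ?D \<Longrightarrow> \<delta>0 \<le> dist x y \<Longrightarrow> m2 \<le> dist (u x) (u y)"
    using far[OF \<delta>0(1)] by auto
  obtain lam where lam: "lam \<ge> 1"
    and LLC1: "\<And>x r y z. x \<in> X \<Longrightarrow> r > 0 \<Longrightarrow> y \<in> ball x r \<inter> X \<Longrightarrow> z \<in> ball x r \<inter> X \<Longrightarrow>
          \<exists>K. continuum_joining K y z \<and> K \<subseteq> ball x (lam * r) \<inter> X"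
    and LLC2: "\<And>x r y z. x \<in> X \<Longrightarrow> r > 0 \<Longrightarrow> y \<in> X - ball x r \<Longrightarrow> z \<in> X - ball x r \<Longrightarrow>
          \<exists>K. continuum_joining K y z \<and> K \<subseteq> X - ball x (r / lam)"
    using LLC unfolding linearly_locally_connected_def by metis
  \<comment> \<open>Makes \<open>Q\<close> times the annulus bound \<open>4 * L / n\<close> smaller
    than the constant of \<open>disc_Loewner\<close>.\<close>
  obtain n :: nat where n: "Q * (4 * L) * 10 ^ 10 < n" using reals_Archimedean2 by blast
  have "0 < Q * (4 * L) * 10 ^ 10" using L Q by simp
  then have n0: "n > 0" using n by (metis less_trans of_nat_0_less_iff)
  \<comment> \<open>The first entry serves pairs with \<open>dist z a \<ge> \<delta>0\<close>, where
    image distances lie between \<open>m2\<close> and the diameter; the second is the ratio excluded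
    by the modulus argument.\<close>
  define H where "H = max (diameter X / m2) (2 * lam\<^sup>2 * 2 ^ n)"
  have pull: "v ` K \<subseteq> ?D" "compact (v ` K)" "connected (v ` K)" "u y \<in> K \<Longrightarrow> y \<in> ?D \<Longrightarrow> y \<in> v ` K"
    if K: "compact K" "connected K" "K \<subseteq> X" for K y
  proof -
    have "continuous_on K v" using cont_v K(3) by (rule continuous_on_subset)
    then show "compact (v ` K)" "connected (v ` K)" using K by (auto intro: compact_continuous_image connected_continuous_image)
    show "v ` K \<subseteq> ?D" using K(3) vX by blast
    show "y \<in> v ` K" if "u y \<in> K" "y \<in> ?D" using that vu by force
  qed
  have weak: "dist (u z) (u a) \<le> H * dist (u z) (u b)"
    if zab: "z \<in> ?D" "a \<in> ?D" "b \<in> ?D" and le: "dist z a \<le> dist z b" for z a b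
  proof (cases "\<delta>0 \<le> dist z a")
    case True
    have "dist (u z) (u a) \<le> diameter X"
      using \<open>compact X\<close> uX zab by (intro diameter_bounded_bound compact_imp_bounded) auto
    also have "diameter X = diameter X / m2 * m2" using m2(1) by simp
    also have "\<dots> \<le> H * dist (u z) (u b)"
    proof (rule mult_mono)
      show "m2 \<le> dist (u z) (u b)" using m2(2) zab True le by auto
      show "0 \<le> H" using lam by (simp add: H_def le_max_iff_disj)
    qed (use m2(1) in \<open>auto simp: H_def\<close>)
    finally show ?thesis .
  next
    case False
    define r where "r = dist (u z) (u b)"
    define s where "s = dist (u z) (u a)"
    show ?thesis
    proof (cases "z = a")
      case True
      then show ?thesis using lam by (simp add: H_def le_max_iff_disj)
    next
      case za: False
      then have zb: "z \<noteq> b" using le by auto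
      have r: "r > 0" using zb zab vu unfolding r_def by (metis zero_less_dist_iff)
      have s: "s > 0" using za zab vu unfolding s_def by (metis zero_less_dist_iff)
      have sm1: "s \<le> m1" unfolding s_def using \<delta>(2)[of z a] zab False \<delta>0 by auto
      obtain w where w: "w \<in> ?D" "1 \<le> dist z w"
      proof -
        have "dist z (axis 1 1) + dist z (- axis 1 1) \<ge> dist (axis 1 1) (- axis 1 1 :: real^2)"
          by (metis dist_triangle3)
        also have "dist (axis 1 1) (- axis 1 1 :: real^2) = 2"
          by (simp add: dist_norm norm_axis_1 flip: scaleR_2)
        finally have "1 \<le> dist z (axis 1 1) \<or> 1 \<le> dist z (- axis 1 1)" by linarith
        then show thesis using that[of "axis 1 1"] that[of "- axis 1 1"] by (auto simp: norm_axis_1)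
      qed
      \<comment> \<open>The radius is doubled because balls are open and \<open>u b\<close> lies at
        distance exactly \<open>r\<close>.\<close>
      obtain KE where KE: "continuum_joining KE (u z) (u b)" "KE \<subseteq> ball (u z) (lam * (2 * r)) \<inter> X"
        using LLC1[of "u z" "2 * r" "u z" "u b"] uX zab r by (auto simp: r_def)
      have "s \<le> dist (u z) (u w)" using m1(2)[OF zab(1) w] sm1 by simp
      then obtain KF where KF: "continuum_joining KF (u a) (u w)" "KF \<subseteq> X - ball (u z) (s / lam)"
        using LLC2[of "u z" s "u a" "u w"] uX zab w s by (auto simp: s_def)
      define E where "E = v ` KE"
      define F where "F = v ` KF"
      have E: "E \<subseteq> ?D" "compact E" "connected E" "z \<in> E" "b \<in> E"
        unfolding E_def using pull[of KE] KE zab by (auto simp: continuum_joining_def)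
      have F: "F \<subseteq> ?D" "compact F" "connected F" "a \<in> F" "w \<in> F"
        unfolding F_def using pull[of KF] KF zab w by (auto simp: continuum_joining_def)
      define \<Gamma> where "\<Gamma> = {c. curve_in ?D c \<and> (\<exists>t\<in>fst c. snd c t \<in> E) \<and> (\<exists>t\<in>fst c. snd c t \<in> F)}"
      have "ennreal (1 / 10 ^ 10) \<le> modulus (restrict_space lebesgue ?D) ?D \<Gamma>"
        unfolding \<Gamma>_def
      proof (rule disc_Loewner[OF E F])
        show "dist z a \<le> 1 / 140" using False \<delta>0 by simp
        show "dist z a / 4 \<le> dist a w"
          using w(2) dist_triangle[of z w a] False \<delta>0 by linarith
      qed (use za le in auto)
      also have "\<dots> \<le> ennreal Q * modulus (hausdorff2_measure X) X (compose_family u \<Gamma>)"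
        using modineq by (simp add: \<Gamma>_def)
      finally have lower: "ennreal (1 / 10 ^ 10) \<le> ennreal Q * modulus (hausdorff2_measure X) X (compose_family u \<Gamma>)" .
      \<comment> \<open>Otherwise \<open>KE\<close>, within \<open>2 * lam * r\<close> of
        \<open>u z\<close>, and \<open>KF\<close>, outside radius \<open>s / lam\<close>, would be
        separated by \<open>n\<close> dyadic shells. One factor \<open>lam\<close> comes from each
        of the two connectivity conditions.\<close>
      have "s < 2 ^ n * (2 * lam\<^sup>2 * r)"
      proof (rule ccontr)
        assume "\<not> ?thesis"
        then have "2 ^ n * (lam * (2 * r)) \<le> s / lam" using lam by (simp add: field_simps power2_eq_square)
        have "modulus (hausdorff2_measure X) X (compose_family u \<Gamma>) \<le> ennreal (4 * L / n)"
        proof (rule modulus_annulus_le[OF uX[OF zab(1)] L growth _ n0])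
          show "0 < lam * (2 * r)" using lam r by simp
          fix c assume "c \<in> compose_family u \<Gamma>"
          then obtain c' where c': "c' \<in> \<Gamma>" "c = (fst c', u \<circ> snd c')" by (auto simp: compose_family_def)
          then have c'D: "curve_in ?D c'" by (simp add: \<Gamma>_def)
          have "curve_in X c"
          proof -
            have "continuous_on (fst c') (u \<circ> snd c')"
              using c'D by (intro continuous_on_compose continuous_on_subset[OF cont_u]) (auto simp: curve_in_def)
            moreover have "(u \<circ> snd c') ` fst c' \<subseteq> X"
              using c'D uX unfolding curve_in_def by fastforce
            ultimately show ?thesis using c'D by (simp add: curve_in_def c'(2))
          qed
          moreover have "\<exists>t\<in>fst c. dist (u z) (snd c t) \<le> lam * (2 * r)"
          proof -
            obtain t where "t \<in> fst c'" "snd c' t \<in> E" using c'(1) by (auto simp: \<Gamma>_def)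
            then obtain y where y: "y \<in> KE" "snd c' t = v y" by (auto simp: E_def)
            then have "u (snd c' t) = y" "dist (u z) y < lam * (2 * r)" using KE(2) uv by auto
            then show ?thesis using \<open>t \<in> fst c'\<close> c'(2) by (intro bexI[of _ t]) auto
          qed
          moreover have "\<exists>t\<in>fst c. 2 ^ n * (lam * (2 * r)) \<le> dist (u z) (snd c t)"
          proof -
            obtain t where "t \<in> fst c'" "snd c' t \<in> F" using c'(1) by (auto simp: \<Gamma>_def)
            then obtain y where y: "y \<in> KF" "snd c' t = v y" by (auto simp: F_def)
            then have "u (snd c' t) = y" "s / lam \<le> dist (u z) y" using KF(2) uv by (auto simp: subset_iff)
            then show ?thesis using \<open>t \<in> fst c'\<close> c'(2) \<open>_ \<le> s / lam\<close> by (intro bexI[of _ t]) auto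
          qed
          ultimately show "curve_in X c \<and> (\<exists>s\<in>fst c. dist (u z) (snd c s) \<le> lam * (2 * r)) \<and>
              (\<exists>t\<in>fst c. 2 ^ n * (lam * (2 * r)) \<le> dist (u z) (snd c t))" by blast
        qed
        then have "ennreal Q * modulus (hausdorff2_measure X) X (compose_family u \<Gamma>) \<le> ennreal Q * ennreal (4 * L / n)"
          by (rule mult_left_mono) simp
        also have "\<dots> = ennreal (Q * (4 * L / n))" using Q L by (intro ennreal_mult[symmetric]) auto
        also have "\<dots> < ennreal (1 / 10 ^ 10)"
        proof (rule ennreal_lessI)
          have "Q * (4 * L) / n < 1 / 10 ^ 10"
            using n n0 by (subst pos_divide_less_eq) (auto simp: field_simps)
          then show "Q * (4 * L / n) < 1 / 10 ^ 10" by simp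
        qed simp
        finally show False using lower by simp
      qed
      also have "2 ^ n * (2 * lam\<^sup>2 * r) = 2 * lam\<^sup>2 * 2 ^ n * r" by simp
      also have "\<dots> \<le> H * r" using r unfolding H_def by (intro mult_right_mono) auto
      finally show ?thesis by (simp add: s_def r_def)
    qed
  qed
  show ?thesis
  proof (rule that[OF _ weak])
    have "1 * 1 \<le> lam\<^sup>2 * 2 ^ n" using lam by (intro mult_mono) (auto simp: one_le_power)
    then show "H \<ge> 1" by (simp add: H_def le_max_iff_disj)
  qed
qed

theorem theorem2p5:
  fixes X :: "'a::metric_space set"
    and u :: "real^2 \<Rightarrow> 'a"
    and L Q :: real
  assumes hom: "X homeomorphic (cball (0::real^2) 1)"
    and L: "L > 0"
    and growth: "\<forall>x\<in>X. \<forall>r>0. hausdorff2_outer (ball x r \<inter> X) \<le> ennreal (L * r\<^sup>2)"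
    and Q: "Q \<ge> 1"
    and u: "\<exists>v. homeomorphism (cball (0::real^2) 1) X u v"
    and modineq: "\<forall>\<Gamma>. (\<forall>c\<in>\<Gamma>. curve_in (cball (0::real^2) 1) c) \<longrightarrow>
        modulus (restrict_space lebesgue (cball (0::real^2) 1)) (cball 0 1) \<Gamma>
          \<le> ennreal Q * modulus (hausdorff2_measure X) X (compose_family u \<Gamma>)"
  shows "quasisymmetric (cball (0::real^2) 1) X u \<longleftrightarrow>
           doubling X \<and> linearly_locally_connected X"
proof
  assume "quasisymmetric (cball 0 1) X u"
  then show "doubling X \<and> linearly_locally_connected X"
    using quasisymmetric_imp_doubling quasisymmetric_disc_imp_LLC by blast
next
  assume X: "doubling X \<and> linearly_locally_connected X"
  obtain v where v: "homeomorphism (cball 0 1) X u v" using u by blast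
  obtain H where H: "H \<ge> 1" "\<And>z a b. z \<in> cball 0 1 \<Longrightarrow> a \<in> cball 0 1 \<Longrightarrow> b \<in> cball 0 1 \<Longrightarrow> dist z a \<le> dist z b \<Longrightarrow>
    dist (u z) (u a) \<le> H * dist (u z) (u b)"
    using modulus_LLC_imp_weakly_quasisymmetric[OF L growth Q v modineq] X by blast
  interpret weakly_quasisymmetric "cball 0 1" X u H
    using H v by unfold_locales (auto simp: homeomorphism_def)
  show "quasisymmetric (cball 0 1) X u"
    using quasisymmetric_if_doubling[OF v] X by blast
qed

end
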